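(* Let $q_0\in\mathscr{S}(\mathbb{R})$ (complex-valued) satisfy $q_0(t)\equiv 0$ for $t<0$, and suppose that $q_0$ generates no discrete eigenvalues and no spectral singularities. Let $r(\lambda)$ be its reflection coefficient, suppose $r(0)=0$, and let $M\ge1$ be the index of the first nonzero moment of $r$. Let $C>0$ and $\alpha\le-1$. Then for every integer $N\ge M+2$, the causal solution of the Maxwell–Bloch Cauchy problem with incident pulse $q_0$ in an initially-unstable medium ($D_-=1$) satisfies $$\begin{aligned}q(t,z)&=\mathrm{i}(-1)^{M+1}\frac{\overline{r_0^{(M)}}\,\mathrm{e}^{-\mathrm{i}\aleph}}{M!}\,2^{\frac12(1-M)}\left(\frac zt\right)^{\frac12(M+1)}J_{M+1}(2\mathrm{i}\sqrt{2tz})+\mathcal{O}(t^{-\frac12(M+2)(1-\alpha)})+\mathcal{O}(t^{1-N}),\\ P(t,z)&=(-1)^{M+1}\frac{\overline{r_0^{(M)}}\,\mathrm{e}^{-\mathrm{i}\aleph}}{M!}\,2^{1-\frac12M}\left(\frac zt\right)^{\frac12M}J_M(2\mathrm{i}\sqrt{2tz})+\mathcal{O}(t^{-\frac12(M+1)(1-\alpha)})+\mathcal{O}(t^{\frac32-N}),\\ D(t,z)&=1+(-1)^{M+1}\left(\frac{|r_0^{(M)}|}{M!}\right)^2 2^{1-M}\left(\frac zt\right)^MJ_M(2\mathrm{i}\sqrt{2tz})^2+\mathcal{O}(t^{-\frac12(M+1)(1-\alpha)})+\mathcal{O}(t^{\frac32-N}),\end{aligned}$$ as $t\to+\infty$ with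 $z=Ct^\alpha$. Here $J_n(\cdot)$ is the Bessel function of the first kind of order $n$.
   Context: Maxwell–Bloch Cauchy problem with incident pulse $q_0$ and $D_-\in\{1,-1\}$: seek $q(t,z)\in\mathbb{C}$, $P(t,z)\in\mathbb{C}$, $D(t,z)\in\mathbb{R}$ for $t\in\mathbb{R}$, $z\ge 0$, with $q_z=-P$, $P_t=-2qD$, $D_t=2\,\mathrm{Re}(\overline{q}P)$, $q(t,0)=q_0(t)$ for $t\in\mathbb{R}$, and $q(t,z)\to 0$, $D(t,z)\to D_-$, $P(t,z)\to 0$ as $t\to-\infty$ for $z\ge 0$. A solution is causal if $q(t,z)=0$ for all $t<0$, $z\ge 0$; under the stated hypotheses on $q_0$ a causal solution exists and is unique. Scattering data: with $\sigma_3=\mathrm{diag}(1,-1)$, let $\boldsymbol{\phi}_+(t;\lambda)$, $\lambda\in\mathbb{R}$, be the $2\times2$ matrix solution of $\boldsymbol{\phi}_t=\left(\mathrm{i}\lambda\sigma_3+\begin{pmatrix}0&q_0(t)\\-\overline{q_0(t)}&0\end{pmatrix}\right)\boldsymbol{\phi}$ with $\boldsymbol{\phi}_+(t;\lambda)=\mathrm{e}^{\mathrm{i}\lambda t\sigma_3}+o(1)$ as $t\to+\infty$. Its first column extends to $\mathrm{Im}(\lambda)\ge 0$, continuous there and analytic for $\mathrm{Im}(\lambda)>0$. Set $S_{1,1}(\lambda)=\phi_{+,1,1}(0;\lambda)$. Discrete eigenvalues are zeros of $S_{1,1}$ with $\mathrm{Im}(\lambda)>0$; spectral singularities are real zeros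 of $S_{1,1}$. The reflection coefficient is $r(\lambda)=\phi_{+,2,1}(0;\lambda)/\phi_{+,1,1}(0;\lambda)$ (which is in $\mathscr{S}(\mathbb{R})$ under the stated hypotheses). The moments are $r_0^{(m)}=\frac{\mathrm{d}^mr}{\mathrm{d}\lambda^m}(0)$, $m\ge0$; the index of the first nonzero moment is the integer $M\ge 0$ with $r_0^{(M)}\neq0$ and $r_0^{(m)}=0$ for $0\le m<M$. The real phase $\aleph$ is the principal value integral $\aleph=\frac1\pi\,\mathrm{p.v.}\!\int_{\mathbb{R}}\ln(1+|r(\lambda)|^2)\,\frac{\mathrm{d}\lambda}{\lambda}$. *)

theory Defs
  imports "HOL-Complex_Analysis.Complex_Analysis" "HOL-Library.Landau_Symbols"
begin

definition vderiv_iter :: "nat \<Rightarrow> (real \<Rightarrow> complex) \<Rightarrow> real \<Rightarrow> complex" where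
  "vderiv_iter n f = ((\<lambda>g t. vector_derivative g (at t)) ^^ n) f"

definition schwartz :: "(real \<Rightarrow> complex) \<Rightarrow> bool" where
  "schwartz f \<longleftrightarrow>
     (\<forall>n t. vderiv_iter n f differentiable (at t)) \<and>
     (\<forall>k n. bounded (range (\<lambda>t. t ^ k *\<^sub>R vderiv_iter n f t)))"

text \<open>Classical solutions: \<open>q\<close>, \<open>P\<close>, \<open>D\<close> are jointly continuous for real \<open>t\<close> and \<open>z \<ge> 0\<close>; by the
  equations, so are \<open>q\<^sub>z\<close>, \<open>P\<^sub>t\<close> and \<open>D\<^sub>t\<close>. At \<open>z = 0\<close> the \<open>z\<close>-derivative is one-sided. Values at
  \<open>z < 0\<close> are irrelevant.\<close>

definition maxwell_bloch_solution ::
  "(real \<Rightarrow> complex) \<Rightarrow> real \<Rightarrow> (real \<Rightarrow> real \<Rightarrow> complex) \<Rightarrow> (real \<Rightarrow> real \<Rightarrow> complex)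
     \<Rightarrow> (real \<Rightarrow> real \<Rightarrow> real) \<Rightarrow> bool" where
  "maxwell_bloch_solution q0 Dm q P D \<longleftrightarrow>
     continuous_on (UNIV \<times> {0..}) (\<lambda>(t, z). q t z) \<and>
     continuous_on (UNIV \<times> {0..}) (\<lambda>(t, z). P t z) \<and>
     continuous_on (UNIV \<times> {0..}) (\<lambda>(t, z). D t z) \<and>
     (\<forall>t. \<forall>z\<ge>0.
        ((\<lambda>y. q t y) has_vector_derivative - P t z) (at z within {0..}) \<and>
        ((\<lambda>s. P s z) has_vector_derivative - 2 * q t z * complex_of_real (D t z)) (at t) \<and>
        ((\<lambda>s. D s z) has_real_derivative 2 * Re (cnj (q t z) * P t z)) (at t)) \<and>
     (\<forall>t. q t 0 = q0 t) \<and>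
     (\<forall>z\<ge>0. ((\<lambda>t. q t z) \<longlongrightarrow> 0) at_bot \<and>
             ((\<lambda>t. D t z) \<longlongrightarrow> Dm) at_bot \<and>
             ((\<lambda>t. P t z) \<longlongrightarrow> 0) at_bot)"

definition causal :: "(real \<Rightarrow> real \<Rightarrow> complex) \<Rightarrow> bool" where
  "causal q \<longleftrightarrow> (\<forall>t<0. \<forall>z\<ge>0. q t z = 0)"

definition zs_matrix :: "(real \<Rightarrow> complex) \<Rightarrow> real \<Rightarrow> real \<Rightarrow> complex^2^2" where
  "zs_matrix q0 \<xi> t =
     vector [vector [\<i> * complex_of_real \<xi>, q0 t],
             vector [- cnj (q0 t), - (\<i> * complex_of_real \<xi>)]]"

definition exp_sigma3 :: "complex \<Rightarrow> complex^2^2" where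
  "exp_sigma3 w = vector [vector [exp w, 0], vector [0, exp (- w)]]"

definition is_jost_plus :: "(real \<Rightarrow> complex) \<Rightarrow> real \<Rightarrow> (real \<Rightarrow> complex^2^2) \<Rightarrow> bool" where
  "is_jost_plus q0 \<xi> \<phi> \<longleftrightarrow>
     (\<forall>t. (\<phi> has_vector_derivative (zs_matrix q0 \<xi> t ** \<phi> t)) (at t)) \<and>
     ((\<lambda>t. \<phi> t - exp_sigma3 (\<i> * complex_of_real (\<xi> * t))) \<longlongrightarrow> 0) at_top"

text \<open>The Jost solution exists and is unique for every real \<open>\<xi>\<close> when \<open>q0\<close> is in the Schwartz class.\<close>

definition jost_plus :: "(real \<Rightarrow> complex) \<Rightarrow> real \<Rightarrow> real \<Rightarrow> complex^2^2" where
  "jost_plus q0 t \<xi> = (THE \<phi>. is_jost_plus q0 \<xi> \<phi>) t"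

text \<open>Extension of a function on the real line to the closed upper half-plane, continuous there
  and analytic in the interior. There is at most one such extension (its values in the open lower
  half-plane being set to 0), and the entries of the first column of the Jost solution have one.\<close>

definition upper_extension :: "(real \<Rightarrow> complex) \<Rightarrow> complex \<Rightarrow> complex" where
  "upper_extension f =
     (THE F. continuous_on {w. Im w \<ge> 0} F \<and> F analytic_on {w. Im w > 0} \<and>
             (\<forall>x. F (complex_of_real x) = f x) \<and> (\<forall>w. Im w < 0 \<longrightarrow> F w = 0))"

definition S11 :: "(real \<Rightarrow> complex) \<Rightarrow> complex \<Rightarrow> complex" where
  "S11 q0 = upper_extension (\<lambda>\<xi>. jost_plus q0 0 \<xi> $ 1 $ 1)"

definition discrete_eigenvalues :: "(real \<Rightarrow> complex) \<Rightarrow> complex set" where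
  "discrete_eigenvalues q0 = {w. Im w > 0 \<and> S11 q0 w = 0}"

definition spectral_singularities :: "(real \<Rightarrow> complex) \<Rightarrow> real set" where
  "spectral_singularities q0 = {\<xi>. S11 q0 (complex_of_real \<xi>) = 0}"

definition reflection_coeff :: "(real \<Rightarrow> complex) \<Rightarrow> real \<Rightarrow> complex" where
  "reflection_coeff q0 \<xi> = jost_plus q0 0 \<xi> $ 2 $ 1 / jost_plus q0 0 \<xi> $ 1 $ 1"

definition moment :: "(real \<Rightarrow> complex) \<Rightarrow> nat \<Rightarrow> complex" where
  "moment r m = vderiv_iter m r 0"

definition first_nonzero_moment :: "(real \<Rightarrow> complex) \<Rightarrow> nat \<Rightarrow> bool" where
  "first_nonzero_moment r M \<longleftrightarrow> moment r M \<noteq> 0 \<and> (\<forall>m<M. moment r m = 0)"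

definition pv_integral :: "(real \<Rightarrow> real) \<Rightarrow> real" where
  "pv_integral f = Lim (at_right 0) (\<lambda>\<epsilon>. LINT x:{x. \<bar>x\<bar> > \<epsilon>}|lborel. f x)"

definition aleph_phase :: "(real \<Rightarrow> complex) \<Rightarrow> real" where
  "aleph_phase r = 1 / pi * pv_integral (\<lambda>x. ln (1 + (cmod (r x))\<^sup>2) / x)"

definition bessel_J :: "nat \<Rightarrow> complex \<Rightarrow> complex" where
  "bessel_J n w = (\<Sum>k. (-1) ^ k / (fact k * fact (k + n)) * (w / 2) ^ (2 * k + n))"

end

theory Submission
  imports Defs
begin

text \<open>No inverse scattering is needed in this regime. Let \<open>W\<close> solve the Zakharov-Shabat system in \<open>t\<close>
  with \<open>W = 1\<close> at \<open>t = 0\<close>, and let \<open>R\<^sub>j(t,z)\<close> be the coefficient of \<open>\<lambda>\<^sup>j\<close> in \<open>W \<sigma>\<^sub>3 W\<inverse>\<close>. By causality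
  \<open>R\<^sub>0 = (P, D)\<close>, and the Maxwell-Bloch equations give \<open>\<partial>\<^sub>z R\<^sub>j = [R\<^sub>0, R\<^sub>j\<^sub>+\<^sub>1]\<close> up to a constant. As long as
  \<open>R\<^sub>0\<close> is close to \<open>(0, 1)\<close>, this is nearly the linear hierarchy \<open>\<partial>\<^sub>z p\<^sub>j = - \<i> p\<^sub>j\<^sub>+\<^sub>1\<close>, which an exponential series
  solves. At \<open>z = 0\<close>, the limit of \<open>W \<sigma>\<^sub>3 W\<inverse>\<close> as \<open>t \<rightarrow> \<infinity>\<close> is given by the scattering data, so the
  coefficients with \<open>0 < j < M\<close> decay rapidly, the first component of \<open>R\<^sub>M\<close> tends to a constant \<open>\<kappa>\<close>,
  and that of \<open>R\<^sub>M\<^sub>+\<^sub>j\<close> behaves like \<open>\<kappa> (2\<i>t)\<^sup>j / j!\<close>. Inserted into the exponential series, these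
  give the Bessel functions. Since \<open>\<alpha> \<le> - 1\<close>, the product \<open>t z\<close> stays bounded, and a comparison argument for the
  infinite hierarchy bounds the errors by powers of \<open>z\<close>. The phase \<open>\<aleph>\<close> in \<open>\<kappa>\<close> is \<open>2 Im ln S\<^sub>1\<^sub>1(0)\<close>, computed from
  \<open>ln |S\<^sub>1\<^sub>1|\<close> on the real line by Cauchy's theorem.\<close>

section \<open>Growth estimates and differential equations\<close>

text \<open>The z-equation of the Lax pair has its pole at \<open>\<lambda> = 0\<close>. This is why
  Taylor coefficients at 0 evolve among themselves, and why the z-derivative of coefficient j
  involves coefficient j + 1. The hierarchy therefore never closes: each estimate in z needs the
  next coefficient. The way out is an a priori bound that is geometric in j, such as
  \<open>(2 * t) ^ j\<close>, obtained from the t-equations; n iterations of the z-equation then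
  leave a remainder with a factor 1 / n!, which vanishes as n grows. The nonlinear part of the
  z-equation is a product of two deviations from the vacuum, each carrying a factor
  \<open>z ^ M\<close>. As \<open>M \<ge> 1\<close>, their product is of order
  \<open>z ^ (M + 1)\<close>, one power below the leading term of P. Integrating
  \<open>q_z = - P\<close> gains one more power for q. The resulting errors fit the claimed powers
  of t because \<open>\<alpha> \<le> - (1 - \<alpha>) / 2\<close> says the same as
  \<open>\<alpha> \<le> - 1\<close>.\<close>

lemma norm_growth_bound:
  fixes x :: "real \<Rightarrow> 'a::real_inner" and g :: "real \<Rightarrow> real"
  assumes ab: "a \<le> b"
    and x: "\<And>t. t \<in> {a..b} \<Longrightarrow> (x has_vector_derivative x' t) (at t within {a..b})"
    and g: "\<And>t. t \<in> {a..b} \<Longrightarrow> (g has_real_derivative g' t) (at t within {a..b})"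
    and le: "\<And>t. t \<in> {a..b} \<Longrightarrow> inner (x t) (x' t) \<le> norm (x t) * g' t"
    and g': "\<And>t. t \<in> {a..b} \<Longrightarrow> 0 \<le> g' t"
  shows "norm (x b) \<le> norm (x a) + g b - g a"
proof (rule field_le_epsilon)
  fix e :: real assume e: "e > 0"
  \<comment> \<open>The norm need not be differentiable where \<open>x\<close> vanishes, so it is
    regularised by \<open>e\<close>. Only \<open>inner (x t) (x' t)\<close> enters the derivative;
    this is why the hypothesis bounds the inner product and not \<open>norm (x' t)\<close>: skew
    terms such as rotations then cost nothing.\<close>
  define h where "h t = sqrt (inner (x t) (x t) + e\<^sup>2) - g t" for t
  have pos: "inner (x t) (x t) + e\<^sup>2 > 0" for t
    using e by (simp add: add_nonneg_pos)
  have dh: "(h has_real_derivative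
      (2 * inner (x t) (x' t)) * (inverse (sqrt (inner (x t) (x t) + e\<^sup>2)) / 2) - g' t) (at t within {a..b})"
    if t: "t \<in> {a..b}" for t
  proof -
    have "((\<lambda>t. inner (x t) (x t)) has_real_derivative 2 * inner (x t) (x' t)) (at t within {a..b})"
      using has_derivative_inner[OF x[OF t, unfolded has_vector_derivative_def]
          x[OF t, unfolded has_vector_derivative_def]]
      by (auto simp: has_field_derivative_def inner_commute algebra_simps elim!: has_derivative_eq_rhs)
    then show ?thesis
      unfolding h_def
      by (auto intro!: derivative_eq_intros g[OF t]) (use pos[of t] in linarith)+
  qed
  have "h b \<le> h a"
  proof (rule DERIV_nonpos_imp_decreasing_open[OF ab])
    fix t assume t: "a < t" "t < b"
    let ?y = "(2 * inner (x t) (x' t)) * (inverse (sqrt (inner (x t) (x t) + e\<^sup>2)) / 2) - g' t"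
    have tt: "t \<in> {a..b}" using t by auto
    have "DERIV h t :> ?y"
      using dh[OF tt] t by (simp add: at_within_Icc_at)
    moreover have "?y \<le> 0"
    proof -
      have "norm (x t) \<le> sqrt (inner (x t) (x t) + e\<^sup>2)"
        by (simp add: norm_eq_sqrt_inner)
      then have "inner (x t) (x' t) \<le> sqrt (inner (x t) (x t) + e\<^sup>2) * g' t"
        using le[OF tt] g'[OF tt] by (meson mult_right_mono order_trans)
      then show ?thesis using pos[of t] by (simp add: field_simps)
    qed
    ultimately show "\<exists>y. DERIV h t :> y \<and> y \<le> 0" by blast
  next
    show "continuous_on {a..b} h"
      by (rule DERIV_continuous_on[OF dh])
  qed
  moreover have "norm (x b) \<le> sqrt (inner (x b) (x b) + e\<^sup>2)"
    by (simp add: norm_eq_sqrt_inner)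
  moreover have "sqrt (inner (x a) (x a) + e\<^sup>2) \<le> norm (x a) + e"
    using e sqrt_add_le_add_sqrt[of "inner (x a) (x a)" "e\<^sup>2"] by (simp add: norm_eq_sqrt_inner)
  ultimately show "norm (x b) \<le> norm (x a) + g b - g a + e"
    unfolding h_def by linarith
qed

text \<open>The integrating factor \<open>exp (- (L * t))\<close> removes the linear part. It is at
  most 1 on the interval, so the source keeps its bound \<open>K\<close>.\<close>

lemma gronwall_norm:
  fixes x :: "real \<Rightarrow> 'a::real_inner"
  assumes T: "0 \<le> T" and L: "0 \<le> L" and K: "0 \<le> K"
    and x: "\<And>t. t \<in> {0..T} \<Longrightarrow> (x has_vector_derivative x' t) (at t within {0..T})"
    and le: "\<And>t. t \<in> {0..T} \<Longrightarrow> inner (x t) (x' t) \<le> norm (x t) * (L * norm (x t) + K)"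
  shows "norm (x T) \<le> (norm (x 0) + K * T) * exp (L * T)"
proof -
  define y where "y t = exp (- (L * t)) *\<^sub>R x t" for t
  have "norm (y T) \<le> norm (y 0) + K * T - K * 0"
  proof (rule norm_growth_bound[OF T])
    fix t assume t: "t \<in> {0..T}"
    show "(y has_vector_derivative exp (- (L * t)) *\<^sub>R x' t - (L * exp (- (L * t))) *\<^sub>R x t) (at t within {0..T})"
      unfolding y_def by (rule derivative_eq_intros x[OF t] | simp)+
    show "((\<lambda>t. K * t) has_real_derivative K) (at t within {0..T})"
      by (auto intro!: derivative_eq_intros)
    let ?e = "exp (- (L * t))"
    have "inner (y t) (?e *\<^sub>R x' t - (L * ?e) *\<^sub>R x t) = ?e * ?e * (inner (x t) (x' t) - L * norm (x t) * norm (x t))"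
      by (simp add: y_def inner_diff_right algebra_simps power2_norm_eq_inner[symmetric] power2_eq_square)
    also have "\<dots> \<le> ?e * ?e * (norm (x t) * K)"
      using le[OF t] by (intro mult_left_mono) (auto simp: algebra_simps)
    also have "\<dots> \<le> ?e * 1 * (norm (x t) * K)"
      using t L K by (intro mult_right_mono mult_left_mono) auto
    also have "\<dots> = norm (y t) * K" by (simp add: y_def)
    finally show "inner (y t) (?e *\<^sub>R x' t - (L * ?e) *\<^sub>R x t) \<le> norm (y t) * K" .
  qed (use K in auto)
  then have "exp (- (L * T)) * norm (x T) \<le> norm (x 0) + K * T"
    by (simp add: y_def)
  then show ?thesis
    by (simp add: exp_minus field_simps)
qed

text \<open>Moves the variable endpoint into the integrand, so that continuity of integrals over a
  fixed box in their parameters becomes applicable.\<close>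

lemma integral_rescale_unit:
  fixes f :: "real \<Rightarrow> 'a::banach"
  assumes "0 \<le> t" "continuous_on {0..t} f"
  shows "integral {0..t} f = t *\<^sub>R integral {0..1} (\<lambda>\<theta>. f (t * \<theta>))"
proof (cases "t = 0")
  case False
  with assms have t: "t > 0" by simp
  have "(f has_integral integral {0..t} f) {0..t}"
    using assms by (simp add: integrable_continuous_real integrable_integral)
  from has_integral_affinity[OF this[folded cbox_interval], of t 0] t
  have "((\<lambda>x. f (t * x)) has_integral (1 / t) *\<^sub>R integral {0..t} f) ((\<lambda>x. x / t) ` {0..t})"
    by (simp add: cbox_interval divide_inverse mult.commute)
  moreover have "(\<lambda>x. x / t) ` {0..t} = {0..1}"
  proof -
    have "x \<in> (\<lambda>x. x / t) ` {0..t}" if "x \<in> {0..1}" for x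
      using that t by (intro image_eqI[of _ _ "x * t"]) (auto simp: mult_le_cancel_right)
    then show ?thesis using t by auto
  qed
  ultimately have "((\<lambda>x. f (t * x)) has_integral (1 / t) *\<^sub>R integral {0..t} f) {0..1}" by simp
  from integral_unique[OF this] t show ?thesis by simp
qed simp

lemma continuous_on_integral_param:
  fixes f :: "real \<Rightarrow> 'p::metric_space \<Rightarrow> 'a::banach"
  assumes f: "continuous_on ({0..} \<times> S) (\<lambda>(t, p). f t p)"
  shows "continuous_on ({0..} \<times> S) (\<lambda>(t, p). integral {0..t} (\<lambda>s. f s p))"
proof -
  have sec: "continuous_on {0..t} (\<lambda>s. f s p)" if "p \<in> S" for p t
  proof -
    have "continuous_on {0..t} (\<lambda>s. (s, p))" "(\<lambda>s. (s, p)) ` {0..t} \<subseteq> {0..} \<times> S"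
      using that by (auto intro!: continuous_intros)
    from continuous_on_compose2[OF f this] show ?thesis by simp
  qed
  have "continuous_on (({0..} \<times> S) \<times> cbox 0 1) (\<lambda>(x, \<theta>). f (fst x * \<theta>) (snd x))"
  proof -
    let ?g = "\<lambda>x::(real \<times> 'p) \<times> real. (fst (fst x) * snd x, snd (fst x))"
    have "continuous_on (({0..} \<times> S) \<times> cbox 0 1) ?g" "?g ` (({0..} \<times> S) \<times> cbox 0 1) \<subseteq> {0..} \<times> S"
      by (auto intro!: continuous_intros simp: cbox_interval)
    from continuous_on_compose2[OF f this] show ?thesis by (simp add: split_def)
  qed
  from integral_continuous_on_param[OF this]
  have "continuous_on ({0..} \<times> S) (\<lambda>x. fst x *\<^sub>R integral (cbox 0 1) (\<lambda>\<theta>. f (fst x * \<theta>) (snd x)))"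
    by (auto intro!: continuous_intros)
  then show ?thesis
    by (rule continuous_on_eq) (auto simp: integral_rescale_unit sec)
qed

text \<open>Picard iteration on the whole half-line. The Lipschitz constant depends on
  \<open>T\<close> but not on the state, so nothing can blow up. Consecutive iterates differ by at
  most \<open>K * ((L * t) ^ n / fact n)\<close>, uniformly over the compact parameter set, and this
  uniformity gives joint continuity in time and parameter.\<close>

lemma lipschitz_ode_solution:
  fixes f :: "real \<Rightarrow> 'p::metric_space \<Rightarrow> 'a::euclidean_space \<Rightarrow> 'a"
  assumes S: "compact S"
    and f: "continuous_on ({0..} \<times> S \<times> UNIV) (\<lambda>(t, p, x). f t p x)"
    and lip: "\<And>T. \<exists>L. \<forall>t\<in>{0..T}. \<forall>p\<in>S. \<forall>x y. norm (f t p x - f t p y) \<le> L * norm (x - y)"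
  obtains X where "continuous_on ({0..} \<times> S) (\<lambda>(t, p). X t p)"
    "\<And>p. p \<in> S \<Longrightarrow> X 0 p = x0"
    "\<And>t p. t \<ge> 0 \<Longrightarrow> p \<in> S \<Longrightarrow> ((\<lambda>s. X s p) has_vector_derivative f t p (X t p)) (at t within {0..})"
proof -
  define Y where "Y = rec_nat (\<lambda>t p. x0) (\<lambda>n Z t p. x0 + integral {0..t} (\<lambda>s. f s p (Z s p)))"
  have Y0: "Y 0 t p = x0" and YS: "Y (Suc n) t p = x0 + integral {0..t} (\<lambda>s. f s p (Y n s p))" for n t p
    by (simp_all add: Y_def)
  have fcomp: "continuous_on ({0..} \<times> S) (\<lambda>(t, p). f t p (Z t p))"
    if "continuous_on ({0..} \<times> S) (\<lambda>(t, p). Z t p)" for Z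
  proof -
    let ?g = "\<lambda>x. (fst x, snd x, Z (fst x) (snd x))"
    have "continuous_on ({0..} \<times> S) ?g" "?g ` ({0..} \<times> S) \<subseteq> {0..} \<times> S \<times> UNIV"
      using that by (auto intro!: continuous_intros simp: split_def)
    from continuous_on_compose2[OF f this] show ?thesis by (simp add: split_def)
  qed
  have contY: "continuous_on ({0..} \<times> S) (\<lambda>(t, p). Y n t p)" for n
  proof (induction n)
    case (Suc n)
    from continuous_on_integral_param[OF fcomp[OF this]] show ?case
      by (auto simp: YS split_def intro!: continuous_intros)
  qed (simp add: Y0 split_def)
  have sec: "continuous_on A (\<lambda>s. Z s p)"
    if "continuous_on ({0..} \<times> S) (\<lambda>(t, p). Z t p)" "p \<in> S" "A \<subseteq> {0..}" for Z :: "real \<Rightarrow> 'p \<Rightarrow> 'a" and p A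
  proof -
    have "continuous_on A (\<lambda>s. (s, p))" "(\<lambda>s. (s, p)) ` A \<subseteq> {0..} \<times> S"
      using that by (auto intro!: continuous_intros)
    from continuous_on_compose2[OF that(1) this] show ?thesis by simp
  qed
  have dY: "((\<lambda>s. Y (Suc n) s p) has_vector_derivative f t p (Y n t p)) (at t within {0..T})"
    if "p \<in> S" "t \<in> {0..T}" for n p t T
    unfolding YS
    using integral_has_vector_derivative[OF sec[OF fcomp[OF contY[of n]] that(1), of "{0..T}"] that(2)]
    by (auto intro!: derivative_eq_intros)
  have ex: "\<exists>Z. uniform_limit ({0..T} \<times> S) (\<lambda>n (t, p). Y n t p) Z sequentially" if T: "T \<ge> 0" for T
  proof -
    obtain L0 where L0: "\<forall>t\<in>{0..T}. \<forall>p\<in>S. \<forall>x y. norm (f t p x - f t p y) \<le> L0 * norm (x - y)"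
      using lip by blast
    define L where "L = max L0 0"
    have L: "norm (f t p x - f t p y) \<le> L * norm (x - y)" if "t \<in> {0..T}" "p \<in> S" for t p x y
      using L0 that by (smt (verit) L_def max_def mult_right_mono norm_ge_zero)
    have L_nn: "L \<ge> 0" by (simp add: L_def)
    have "compact ((\<lambda>(t, p). Y 1 t p - Y 0 t p) ` ({0..T} \<times> S))"
      using continuous_on_subset[OF continuous_on_diff[OF contY[of 1] contY[of 0]], of "{0..T} \<times> S"] T
      by (intro compact_continuous_image compact_Times S compact_Icc) (auto simp: split_def atLeastAtMost_def subset_iff)
    then obtain K where K: "\<And>t p. t \<in> {0..T} \<Longrightarrow> p \<in> S \<Longrightarrow> norm (Y 1 t p - Y 0 t p) \<le> K"
      by (force dest!: compact_imp_bounded simp: bounded_iff)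
    have step: "norm (Y (Suc n) t p - Y n t p) \<le> K * ((L * t) ^ n / fact n)" if "p \<in> S" "t \<in> {0..T}" for n p t
      using that(2)
    proof (induction n arbitrary: t)
      case 0 then show ?case using K that by (simp add: Y0)
    next
      case (Suc n)
      let ?g = "\<lambda>t. K * ((L * t) ^ Suc n / fact (Suc n))"
      let ?g' = "\<lambda>t. L * (K * ((L * t) ^ n / fact n))"
      have "norm (Y (Suc (Suc n)) t p - Y (Suc n) t p) \<le> norm (Y (Suc (Suc n)) 0 p - Y (Suc n) 0 p) + ?g t - ?g 0"
      proof (rule norm_growth_bound[where g' = ?g' and x' = "\<lambda>t. f t p (Y (Suc n) t p) - f t p (Y n t p)"])
        show "0 \<le> t" using Suc by simp
        fix s assume s: "s \<in> {0..t}"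
        then have s': "s \<in> {0..T}" using Suc by auto
        show "((\<lambda>t. Y (Suc (Suc n)) t p - Y (Suc n) t p) has_vector_derivative
            f s p (Y (Suc n) s p) - f s p (Y n s p)) (at s within {0..t})"
          by (intro has_vector_derivative_diff dY that s)
        show "(?g has_real_derivative ?g' s) (at s within {0..t})"
          by (rule derivative_eq_intros refl | simp)+
        have b: "norm (f s p (Y (Suc n) s p) - f s p (Y n s p)) \<le> ?g' s"
          using L[OF s' that(1), of "Y (Suc n) s p" "Y n s p"] Suc.IH[OF s'] L_nn
          by (smt (verit) mult_left_mono)
        then show "0 \<le> ?g' s" by (smt (verit) norm_ge_zero)
        show "inner (Y (Suc (Suc n)) s p - Y (Suc n) s p) (f s p (Y (Suc n) s p) - f s p (Y n s p))
            \<le> norm (Y (Suc (Suc n)) s p - Y (Suc n) s p) * ?g' s"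
          by (rule order_trans[OF norm_cauchy_schwarz mult_left_mono[OF b norm_ge_zero]])
      qed
      then show ?case by (simp add: YS)
    qed
    have Mb: "norm (case w of (t, p) \<Rightarrow> Y (Suc n) t p - Y n t p) \<le> K * ((L * T) ^ n / fact n)"
      if "w \<in> {0..T} \<times> S" for n w
    proof -
      obtain t p where w: "w = (t, p)" "t \<in> {0..T}" "p \<in> S" using \<open>w \<in> {0..T} \<times> S\<close> by auto
      have K0: "0 \<le> K" using K[OF w(2,3)] norm_ge_zero order_trans by blast
      have "(L * t) ^ n / fact n \<le> (L * T) ^ n / fact n"
        using w L_nn by (intro divide_right_mono power_mono mult_left_mono) auto
      then show ?thesis using step[OF w(3,2), of n] K0 w(1) mult_left_mono by fastforce
    qed
    have "summable (\<lambda>n. K * ((L * T) ^ n / fact n))"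
      using summable_mult[OF summable_exp[of "L * T"], of K] by (simp add: divide_inverse mult.commute)
    from Weierstrass_m_test[OF Mb this, of "{0..T} \<times> S" "\<lambda>n w. w"]
    have "uniform_limit ({0..T} \<times> S) (\<lambda>n w. \<Sum>i<n. (case w of (t, p) \<Rightarrow> Y (Suc i) t p - Y i t p))
        (\<lambda>w. suminf (\<lambda>i. (case w of (t, p) \<Rightarrow> Y (Suc i) t p - Y i t p))) sequentially"
      by simp
    moreover have "uniform_limit ({0..T} \<times> S) (\<lambda>n w. x0) (\<lambda>w. x0) sequentially"
      by (rule uniform_limit_const)
    ultimately
    have "uniform_limit ({0..T} \<times> S) (\<lambda>n w. x0 + (\<Sum>i<n. (case w of (t, p) \<Rightarrow> Y (Suc i) t p - Y i t p)))
        (\<lambda>w. x0 + suminf (\<lambda>i. (case w of (t, p) \<Rightarrow> Y (Suc i) t p - Y i t p))) sequentially"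
      by (intro uniform_limit_add)
    moreover have "x0 + (\<Sum>i<n. (case w of (t, p) \<Rightarrow> Y (Suc i) t p - Y i t p)) = (case w of (t, p) \<Rightarrow> Y n t p)" for n w
      using sum_lessThan_telescope[of "\<lambda>i. Y i (fst w) (snd w)" n] by (cases w) (simp add: Y0)
    ultimately show ?thesis by (intro exI) simp
  qed
  define X where "X t p = lim (\<lambda>n. Y n t p)" for t p
  have UX: "uniform_limit ({0..T} \<times> S) (\<lambda>n (t, p). Y n t p) (\<lambda>(t, p). X t p) sequentially" if T: "T \<ge> 0" for T
  proof -
    obtain Z where Z: "uniform_limit ({0..T} \<times> S) (\<lambda>n (t, p). Y n t p) Z sequentially"
      using ex[OF T] by blast
    have "Z w = (\<lambda>(t, p). X t p) w" if "w \<in> {0..T} \<times> S" for w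
      using tendsto_uniform_limitI[OF Z that] by (cases w) (auto simp: X_def limI)
    then show ?thesis
      using Z uniform_limit_cong'[of "{0..T} \<times> S" "\<lambda>n (t, p). Y n t p" "\<lambda>n (t, p). Y n t p" Z "\<lambda>(t, p). X t p" sequentially]
      by blast
  qed
  have contXT: "continuous_on ({0..T} \<times> S) (\<lambda>(t, p). X t p)" if "T \<ge> 0" for T
    by (rule uniform_limit_theorem[OF _ UX[OF that]])
      (auto intro!: eventuallyI continuous_on_subset[OF contY])
  have contX: "continuous_on ({0..} \<times> S) (\<lambda>(t, p). X t p)"
    unfolding continuous_on_eq_continuous_within
  proof
    fix w :: "real \<times> 'p" assume w: "w \<in> {0..} \<times> S"
    define T where "T = fst w + 1"
    have T: "T \<ge> 0" "w \<in> {0..T} \<times> S" using w by (auto simp: T_def)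
    have "continuous (at w within {0..T} \<times> S) (\<lambda>(t, p). X t p)"
      using contXT[OF T(1)] T(2) unfolding continuous_on_eq_continuous_within by blast
    moreover have "at w within ({0..} \<times> S) = at w within ({0..T} \<times> S)"
      by (rule at_within_nhd[of _ "{..<T} \<times> UNIV"]) (auto intro!: open_Times simp: T_def mem_Times_iff)
    ultimately show "continuous (at w within {0..} \<times> S) (\<lambda>(t, p). X t p)" by simp
  qed
  have eqX: "X t p = x0 + integral {0..t} (\<lambda>s. f s p (X s p))" if t: "t \<ge> 0" and p: "p \<in> S" for t p
  proof -
    obtain L where L: "\<forall>s\<in>{0..t}. \<forall>p\<in>S. \<forall>x y. norm (f s p x - f s p y) \<le> L * norm (x - y)"
      using lip by blast
    have u: "uniform_limit {0..t} (\<lambda>n s. Y n s p) (\<lambda>s. X s p) sequentially"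
      using uniform_limit_compose'[OF UX[OF t], of "\<lambda>s. (s, p)" "{0..t}"] p by (auto simp: Pi_iff)
    have "uniform_limit (cbox 0 t) (\<lambda>n s. f s p (Y n s p)) (\<lambda>s. f s p (X s p)) sequentially"
    proof (rule uniform_limitI)
      fix e :: real assume e: "e > 0"
      have "e / (\<bar>L\<bar> + 1) > 0" using e by simp
      from uniform_limitD[OF u this]
      show "\<forall>\<^sub>F n in sequentially. \<forall>s\<in>cbox 0 t. dist (f s p (Y n s p)) (f s p (X s p)) < e"
      proof eventually_elim
        case (elim n)
        show ?case
        proof
          fix s assume s: "s \<in> cbox 0 t"
          then have "dist (f s p (Y n s p)) (f s p (X s p)) \<le> L * norm (Y n s p - X s p)"
            using L p by (auto simp: dist_norm)
          also have "\<dots> \<le> (\<bar>L\<bar> + 1) * norm (Y n s p - X s p)"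
            by (intro mult_right_mono) auto
          also have "\<dots> < e"
            using elim s by (auto simp: dist_norm pos_less_divide_eq mult.commute)
          finally show "dist (f s p (Y n s p)) (f s p (X s p)) < e" .
        qed
      qed
    qed
    moreover have ci: "continuous_on (cbox 0 t) (\<lambda>s. f s p (Y n s p))" for n
      using sec[OF fcomp[OF contY[of n]] p] by (auto simp: cbox_interval)
    ultimately obtain I J where I: "\<And>n. ((\<lambda>s. f s p (Y n s p)) has_integral I n) (cbox 0 t)"
      and J: "((\<lambda>s. f s p (X s p)) has_integral J) (cbox 0 t)" and IJ: "I \<longlonglongrightarrow> J"
      by (rule uniform_limit_integral_cbox) auto
    have "(\<lambda>n. integral {0..t} (\<lambda>s. f s p (Y n s p))) \<longlonglongrightarrow> integral {0..t} (\<lambda>s. f s p (X s p))"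
      using IJ integral_unique[OF I] integral_unique[OF J] by (simp add: cbox_interval)
    then have "(\<lambda>n. Y (Suc n) t p) \<longlonglongrightarrow> x0 + integral {0..t} (\<lambda>s. f s p (X s p))"
      by (auto simp: YS cbox_interval intro!: tendsto_intros)
    moreover have "(\<lambda>n. Y (Suc n) t p) \<longlonglongrightarrow> X t p"
      using tendsto_uniform_limitI[OF UX[OF t], of "(t, p)"] t p by (auto intro!: LIMSEQ_Suc)
    ultimately show ?thesis using LIMSEQ_unique by blast
  qed
  show thesis
  proof (rule that[OF contX])
    show "X 0 p = x0" if "p \<in> S" for p using eqX[of 0 p] that by simp
    fix t p assume t: "(t::real) \<ge> 0" and p: "p \<in> S"
    have "((\<lambda>s. x0 + integral {0..s} (\<lambda>s. f s p (X s p))) has_vector_derivative f t p (X t p)) (at t within {0..t+1})"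
      using integral_has_vector_derivative[OF sec[OF fcomp[OF contX] p, of "{0..t+1}"], of t] t
      by (auto intro!: derivative_eq_intros)
    then have "((\<lambda>s. X s p) has_vector_derivative f t p (X t p)) (at t within {0..t+1})"
      by (rule has_vector_derivative_transform[rotated 2]) (use t p in \<open>auto simp: eqX[symmetric]\<close>)
    moreover have "at t within {0..} = at t within {0..t+1}"
      by (rule at_within_nhd[of _ "{..<t+1}"]) auto
    ultimately show "((\<lambda>s. X s p) has_vector_derivative f t p (X t p)) (at t within {0..})" by simp
  qed
qed

section \<open>The hierarchy of Taylor coefficients\<close>

text \<open>With pairs read as traceless Hermitian matrices, \<open>rot w\<close> is the commutator
  with the matrix with rows (0, w) and (- cnj w, 0), \<open>shift\<close> is the commutator with
  \<open>\<i>\<close> times the third Pauli matrix, and \<open>cr x\<close> is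
  \<open>- \<i> / 2\<close> times the commutator with x, a cross product up to sign in real
  coordinates.\<close>

definition rot :: "complex \<Rightarrow> complex \<times> real \<Rightarrow> complex \<times> real" where
  "rot w x = (- 2 * w * of_real (snd x), 2 * Re (cnj w * fst x))"

definition shift :: "complex \<times> real \<Rightarrow> complex \<times> real" where
  "shift x = (2 * \<i> * fst x, 0)"

definition cr :: "complex \<times> real \<Rightarrow> complex \<times> real \<Rightarrow> complex \<times> real" where
  "cr x y = (- \<i> * (of_real (snd x) * fst y - of_real (snd y) * fst x), Im (fst x * cnj (fst y)))"

text \<open>Skewness of the commutator. It keeps the pulse out of the norm bounds for the
  hierarchy.\<close>

lemma inner_rot [simp]: "inner x (rot w x) = 0"
  by (cases x) (simp add: rot_def inner_complex_def algebra_simps)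

lemma norm_rot: "norm (rot w x) \<le> 2 * norm w * norm x"
proof -
  obtain p d where x: "x = (p, d)" by (cases x)
  have "(Re (cnj w * p))\<^sup>2 \<le> (norm w * norm p)\<^sup>2"
    using abs_Re_le_cmod[of "cnj w * p"] by (metis abs_le_square_iff abs_norm_cancel complex_mod_cnj norm_mult)
  then have "(2 * Re (cnj w * p))\<^sup>2 \<le> 4 * (norm w)\<^sup>2 * (norm p)\<^sup>2"
    by (simp only: power_mult_distrib) simp
  then have "(norm (rot w x))\<^sup>2 \<le> (2 * norm w * norm x)\<^sup>2"
    unfolding x rot_def norm_Pair power_mult_distrib fst_conv snd_conv norm_mult
    by (simp add: power_mult_distrib distrib_left)
  then show ?thesis by (rule power2_le_imp_le) simp
qed

lemma norm_shift: "norm (shift x) \<le> 2 * norm x"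
proof (rule power2_le_imp_le)
  show "(norm (shift x))\<^sup>2 \<le> (2 * norm x)\<^sup>2"
    by (cases x) (simp add: shift_def norm_Pair norm_mult power_mult_distrib)
qed simp

text \<open>Lagrange's identity: the squares of the cross product and of the inner product add up to
  the product of the squared norms.\<close>

lemma norm_cr: "norm (cr x y) \<le> norm x * norm y"
proof -
  obtain a b where x: "x = (a, b)" by (cases x)
  obtain c d where y: "y = (c, d)" by (cases y)
  have "(norm (cr x y))\<^sup>2 + (inner x y)\<^sup>2 = (norm x * norm y)\<^sup>2"
    unfolding x y cr_def norm_Pair inner_Pair power_mult_distrib
    by (simp add: cmod_power2 inner_complex_def) (simp add: power2_eq_square algebra_simps)
  then have "(norm (cr x y))\<^sup>2 \<le> (norm x * norm y)\<^sup>2"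
    by (smt (verit) zero_le_power2)
  then show ?thesis by (rule power2_le_imp_le) simp
qed

lemma cr_same [simp]: "cr x x = 0"
  by (cases x) (simp add: cr_def zero_prod_def)

lemma cr_0_right [simp]: "cr x 0 = 0"
  by (simp add: cr_def zero_prod_def)

lemma shift_0 [simp]: "shift 0 = 0"
  by (simp add: shift_def zero_prod_def)

lemma rot_diff: "rot w (x - y) = rot w x - rot w y"
  by (simp add: rot_def algebra_simps)

lemma rot_minus_left: "rot (- w) x = - rot w x"
  by (simp add: rot_def)

lemma bounded_bilinear_rot: "bounded_bilinear rot"
proof
  show "\<exists>K. \<forall>a b. norm (rot a b) \<le> norm a * norm b * K"
    by (rule exI[of _ 2]) (metis norm_rot mult.commute mult.assoc)
qed (auto simp: rot_def algebra_simps scaleR_conv_of_real)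

lemma bounded_bilinear_cr: "bounded_bilinear cr"
proof
  show "\<exists>K. \<forall>a b. norm (cr a b) \<le> norm a * norm b * K"
    by (rule exI[of _ 1]) (simp add: norm_cr)
qed (auto simp: cr_def algebra_simps scaleR_conv_of_real)

lemma bounded_linear_shift: "bounded_linear shift"
proof (rule bounded_linear_intro[of _ 2])
  show "norm (shift x) \<le> norm x * 2" for x
    using norm_shift[of x] by simp
qed (auto simp: shift_def algebra_simps scaleR_conv_of_real)

lemmas continuous_on_rot [continuous_intros] = bounded_bilinear.continuous_on[OF bounded_bilinear_rot]
lemmas continuous_on_cr [continuous_intros] = bounded_bilinear.continuous_on[OF bounded_bilinear_cr]
lemmas continuous_on_shift [continuous_intros] = bounded_linear.continuous_on[OF bounded_linear_shift]
lemmas vderiv_rot = bounded_bilinear.has_vector_derivative[OF bounded_bilinear_rot]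
lemmas vderiv_cr = bounded_bilinear.has_vector_derivative[OF bounded_bilinear_cr]

text \<open>This is the Jacobi identity for \<open>[\<rho>, \<cdot>]\<close> in coordinates.\<close>

lemma rot_cr_jacobi:
  "cr (rot w x) y + cr x (rot w y + shift u) = rot w (cr x y) - rot (fst x) u + shift (cr x u)"
proof -
  obtain P D where x: "x = (P, D)" by (cases x)
  obtain p d where y: "y = (p, d)" by (cases y)
  obtain p' d' where u: "u = (p', d')" by (cases u)
  show ?thesis
    unfolding x y u rot_def cr_def shift_def fst_conv snd_conv add_Pair diff_Pair prod.inject fst_add snd_add
    by (simp add: complex_eq_iff) (simp add: algebra_simps)
qed

lemma zero_vector_derivative_imp_eq:
  fixes f :: "real \<Rightarrow> 'a::real_inner"
  assumes "a \<le> b" "\<And>x. x \<in> {a..b} \<Longrightarrow> (f has_vector_derivative 0) (at x within {a..b})"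
  shows "f b = f a"
proof -
  have "norm (f b - f a) \<le> norm (f a - f a) + 0 - 0"
    using assms by (intro norm_growth_bound[where x' = "\<lambda>_. 0" and g' = "\<lambda>_. 0" and x = "\<lambda>t. f t - f a"])
      (auto intro!: derivative_eq_intros)
  then show ?thesis by simp
qed

section \<open>The causal solution as a rotating Bloch vector\<close>

locale causal_mb =
  fixes q0 :: "real \<Rightarrow> complex" and q P :: "real \<Rightarrow> real \<Rightarrow> complex" and D :: "real \<Rightarrow> real \<Rightarrow> real"
  assumes sol: "maxwell_bloch_solution q0 1 q P D" and causal_q: "causal q"
begin

lemma q_boundary: "q t 0 = q0 t"
  using sol by (simp add: maxwell_bloch_solution_def)

lemma q_cont: "continuous_on (UNIV \<times> {0..}) (\<lambda>(t, z). q t z)"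
  and P_cont: "continuous_on (UNIV \<times> {0..}) (\<lambda>(t, z). P t z)"
  and D_cont: "continuous_on (UNIV \<times> {0..}) (\<lambda>(t, z). D t z)"
  using sol by (simp_all add: maxwell_bloch_solution_def)

lemma q_z: "z \<ge> 0 \<Longrightarrow> ((\<lambda>y. q t y) has_vector_derivative - P t z) (at z within {0..})"
  and P_t: "z \<ge> 0 \<Longrightarrow> ((\<lambda>s. P s z) has_vector_derivative - 2 * q t z * complex_of_real (D t z)) (at t)"
  and D_t: "z \<ge> 0 \<Longrightarrow> ((\<lambda>s. D s z) has_real_derivative 2 * Re (cnj (q t z) * P t z)) (at t)"
  using sol by (simp_all add: maxwell_bloch_solution_def)

definition rho :: "real \<Rightarrow> real \<Rightarrow> complex \<times> real" where
  "rho t z = (P t z, D t z)"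

lemma rho_t: "z \<ge> 0 \<Longrightarrow> ((\<lambda>s. rho s z) has_vector_derivative rot (q t z) (rho t z)) (at t)"
  unfolding rho_def rot_def fst_conv snd_conv
  by (intro has_vector_derivative_Pair P_t D_t[unfolded has_real_derivative_iff_has_vector_derivative])

lemma rho_cont: "continuous_on (UNIV \<times> {0..}) (\<lambda>(t, z). rho t z)"
  using continuous_on_Pair[OF P_cont D_cont] by (simp add: rho_def split_def)

text \<open>Before time 0 the field \<open>q\<close> vanishes, so \<open>rho\<close> is constant in
  t and equals its limit at minus infinity. Continuity carries the value to
  \<open>t = 0\<close>.\<close>

lemma rho_0: assumes z: "z \<ge> 0" shows "rho 0 z = (0, 1)"
proof -
  have neg: "rho t z = (0, 1)" if t: "t < 0" for t
  proof -
    have "((\<lambda>s. rho s z) \<longlongrightarrow> (0, 1)) at_bot"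
      using sol z unfolding rho_def maxwell_bloch_solution_def by (auto intro!: tendsto_Pair)
    moreover have const: "rho s z = rho t z" if "s \<le> t" for s
    proof -
      have "((\<lambda>s. rho s z) has_vector_derivative 0) (at x within {s..t})" if "x \<in> {s..t}" for x
        using rho_t[OF z, of x] causal_q t z that
        by (auto simp: causal_def rot_def zero_prod_def intro!: has_vector_derivative_at_within)
      from zero_vector_derivative_imp_eq[OF that this] show ?thesis by simp
    qed
    have "((\<lambda>s. rho s z) \<longlongrightarrow> rho t z) at_bot"
      by (rule tendsto_eventually) (auto simp: eventually_at_bot_linorder intro!: exI[of _ t] const)
    ultimately show ?thesis
      using tendsto_unique[OF trivial_limit_at_bot_linorder] by metis
  qed
  have "((\<lambda>s. rho s z) \<longlongrightarrow> rho 0 z) (at_left 0)"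
    using has_vector_derivative_continuous[OF rho_t[OF z, of 0]]
    by (simp add: continuous_within continuous_at filterlim_at_split)
  moreover have "((\<lambda>s. rho s z) \<longlongrightarrow> (0, 1)) (at_left 0)"
    by (rule tendsto_eventually) (auto simp: eventually_at_left_field intro!: exI[of _ "-1"] neg)
  ultimately show ?thesis
    using tendsto_unique[OF trivial_limit_at_left_real] by metis
qed

lemma norm_rho: assumes z: "z \<ge> 0" and t: "t \<ge> 0" shows "norm (rho t z) = 1"
proof -
  have "((\<lambda>s. inner (rho s z) (rho s z)) has_vector_derivative 0) (at x within {0..t})" for x
  proof -
    note d = has_vector_derivative_at_within[OF rho_t[OF z]]
    have "((\<lambda>s. inner (rho s z) (rho s z)) has_vector_derivative
       inner (rho x z) (rot (q x z) (rho x z)) + inner (rot (q x z) (rho x z)) (rho x z)) (at x within {0..t})"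
      by (rule bounded_bilinear.has_vector_derivative[OF bounded_bilinear_inner d d])
    then show ?thesis by (simp add: inner_commute)
  qed
  from zero_vector_derivative_imp_eq[OF t this]
  have "inner (rho t z) (rho t z) = inner (rho 0 z) (rho 0 z)" .
  then show ?thesis using rho_0[OF z] by (simp add: norm_eq_sqrt_inner)
qed

lemma norm_P: assumes "z \<ge> 0" "t \<ge> 0" shows "norm (P t z) \<le> 1"
  using norm_rho[OF assms] norm_fst_le[of "P t z" "D t z"] by (simp add: rho_def)

end

text \<open>The components \<open>R j\<close> are the coefficients of \<open>\<lambda>\<^sup>j\<close> in \<open>W \<sigma>\<^sub>3 W\<inverse>\<close>, where \<open>W\<close> is the
  Zakharov-Shabat solution that equals the identity at \<open>t = 0\<close>; a pair \<open>(p, d)\<close> encodes the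
  matrix with diagonal entries \<open>d, -d\<close> and upper right entry \<open>p\<close>.\<close>

locale mb_hierarchy = causal_mb +
  fixes Z :: real and R :: "nat \<Rightarrow> real \<Rightarrow> real \<Rightarrow> complex \<times> real"
  assumes Z: "Z \<ge> 0"
    and R_0: "R 0 = rho"
    and R_cont: "\<And>j. continuous_on ({0..} \<times> {0..Z}) (\<lambda>(t, z). R j t z)"
    and R_init: "\<And>j z. z \<in> {0..Z} \<Longrightarrow> R (Suc j) 0 z = 0"
    and R_t: "\<And>j t z. t \<ge> 0 \<Longrightarrow> z \<in> {0..Z} \<Longrightarrow>
      ((\<lambda>s. R (Suc j) s z) has_vector_derivative rot (q t z) (R (Suc j) t z) + shift (R j t z)) (at t within {0..})"

text \<open>Each coefficient solves a linear equation in t driven by the previous one, with z as a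
  parameter; dependent choice strings the solutions together, carrying joint continuity along.
  Compactness of \<open>{0..Z}\<close> makes the Lipschitz constant uniform in z.\<close>

lemma (in causal_mb) mb_hierarchy_exists:
  assumes Z: "Z \<ge> 0"
  obtains R where "mb_hierarchy q0 q P D Z R"
proof -
  let ?A = "{0..} \<times> {0..Z}"
  let ?C = "\<lambda>R. continuous_on ?A (\<lambda>(t, z). R t z)"
  let ?N = "\<lambda>R R'. (\<forall>z\<in>{0..Z}. R' 0 z = 0) \<and> (\<forall>t\<ge>0. \<forall>z\<in>{0..Z}.
      ((\<lambda>s. R' s z) has_vector_derivative rot (q t z) (R' t z) + shift (R t z)) (at t within {0..}))"
  have qc: "continuous_on ?A (\<lambda>(t, z). q t z)"
    using continuous_on_subset[OF q_cont] by (auto simp: subset_iff)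
  have "\<exists>R. \<forall>n. (?C (R n) \<and> (n = 0 \<longrightarrow> R n = rho)) \<and> ?N (R n) (R (Suc n))"
  proof (rule dependent_nat_choice)
    show "\<exists>x. ?C x \<and> (0 = (0::nat) \<longrightarrow> x = rho)"
      using continuous_on_subset[OF rho_cont, of ?A] by (auto simp: subset_iff)
    fix R and n :: nat assume R: "?C R \<and> (n = 0 \<longrightarrow> R = rho)"
    define f where "f t z x = rot (q t z) x + shift (R t z)" for t z x
    have c1: "continuous_on ({0..} \<times> {0..Z} \<times> UNIV) (\<lambda>(t, z, x). f t z x)"
    proof -
      let ?B = "{0..} \<times> {0..Z} \<times> (UNIV :: (complex \<times> real) set)"
      have m: "continuous_on ?B (\<lambda>w. (fst w, fst (snd w)))" "(\<lambda>w. (fst w, fst (snd w))) ` ?B \<subseteq> ?A"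
        by (auto intro!: continuous_intros)
      have "continuous_on ?B (\<lambda>w. q (fst w) (fst (snd w)))" "continuous_on ?B (\<lambda>w. R (fst w) (fst (snd w)))"
        using continuous_on_compose2[OF qc m] continuous_on_compose2[OF conjunct1[OF R] m] by simp_all
      then show ?thesis
        unfolding f_def split_def by (intro continuous_intros)
    qed
    have c2: "\<exists>L. \<forall>t\<in>{0..T}. \<forall>z\<in>{0..Z}. \<forall>x y. norm (f t z x - f t z y) \<le> L * norm (x - y)" for T
    proof -
      have "compact ((\<lambda>(t, z). q t z) ` ({0..T} \<times> {0..Z}))"
        by (intro compact_continuous_image compact_Times compact_Icc continuous_on_subset[OF q_cont]) auto
      then obtain B where B: "\<And>t z. t \<in> {0..T} \<Longrightarrow> z \<in> {0..Z} \<Longrightarrow> norm (q t z) \<le> B"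
        by (force dest!: compact_imp_bounded simp: bounded_iff)
      have "norm (f t z x - f t z y) \<le> 2 * B * norm (x - y)" if "t \<in> {0..T}" "z \<in> {0..Z}" for t z x y
      proof -
        have "norm (f t z x - f t z y) = norm (rot (q t z) (x - y))"
          by (simp add: f_def rot_diff)
        also have "\<dots> \<le> 2 * norm (q t z) * norm (x - y)" by (rule norm_rot)
        also have "\<dots> \<le> 2 * B * norm (x - y)"
          using B[OF that] by (intro mult_right_mono) auto
        finally show ?thesis .
      qed
      then show ?thesis by blast
    qed
    obtain X where X: "continuous_on ?A (\<lambda>(t, z). X t z)" "\<And>z. z \<in> {0..Z} \<Longrightarrow> X 0 z = 0"
      "\<And>t z. t \<ge> 0 \<Longrightarrow> z \<in> {0..Z} \<Longrightarrow> ((\<lambda>s. X s z) has_vector_derivative f t z (X t z)) (at t within {0..})"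
      by (rule lipschitz_ode_solution[OF compact_Icc c1 c2, of 0]) (rule that)
    have "?C X \<and> (Suc n = 0 \<longrightarrow> X = rho)" using X(1) by simp
    moreover have "?N R X" using X(2,3) unfolding f_def by blast
    ultimately show "\<exists>y. (?C y \<and> (Suc n = 0 \<longrightarrow> y = rho)) \<and> ?N R y" by blast
  qed
  then obtain R where R': "\<And>n. (?C (R n) \<and> (n = 0 \<longrightarrow> R n = rho)) \<and> ?N (R n) (R (Suc n))" by blast
  have R: "\<And>n. ?C (R n)" "R 0 = rho" "\<And>n. ?N (R n) (R (Suc n))"
    using R' by blast+
  have "mb_hierarchy q0 q P D Z R"
  proof
    show "0 \<le> Z" by (rule Z)
    show "R 0 = rho" by (rule R(2))
    show "continuous_on ({0..} \<times> {0..Z}) (\<lambda>(t, z). R j t z)" for j by (rule R(1))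
    show "R (Suc j) 0 z = 0" if "z \<in> {0..Z}" for j z using R(3)[of j] that by blast
    show "((\<lambda>s. R (Suc j) s z) has_vector_derivative rot (q t z) (R (Suc j) t z) + shift (R j t z)) (at t within {0..})"
      if "t \<ge> 0" "z \<in> {0..Z}" for j t z using R(3)[of j] that by blast
  qed
  then show thesis by (rule that)
qed

section \<open>Growth of the coefficients and their evolution in z\<close>

context mb_hierarchy
begin

lemma R_t_sub: "t \<in> {0..T} \<Longrightarrow> z \<in> {0..Z} \<Longrightarrow>
   ((\<lambda>s. R (Suc j) s z) has_vector_derivative rot (q t z) (R (Suc j) t z) + shift (R j t z)) (at t within {0..T})"
  by (rule has_vector_derivative_within_subset[OF R_t]) auto

text \<open>The rotation term drops out, so the norm grows at most at the rate
  \<open>2 * norm (R j t z)\<close>. Geometric growth in j is the form in which this bound later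
  starts the comparison arguments.\<close>

lemma norm_R: "t \<ge> 0 \<Longrightarrow> z \<in> {0..Z} \<Longrightarrow> norm (R j t z) \<le> (2 * t) ^ j"
proof (induction j arbitrary: t)
  case 0 then show ?case using norm_rho[of z t] by (simp add: R_0)
next
  case (Suc j)
  have "norm (R (Suc j) t z) \<le> norm (R (Suc j) 0 z) + (2 * t) ^ Suc j - (2 * 0) ^ Suc j"
  proof (rule norm_growth_bound[where g' = "\<lambda>t. 2 * (real (Suc j) * (2 * t) ^ j)"
        and x' = "\<lambda>t. rot (q t z) (R (Suc j) t z) + shift (R j t z)"])
    fix s assume s: "s \<in> {0..t}"
    show "((\<lambda>s. R (Suc j) s z) has_vector_derivative rot (q s z) (R (Suc j) s z) + shift (R j s z)) (at s within {0..t})"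
      by (rule R_t_sub[OF s Suc.prems(2)])
    show "((\<lambda>t. (2 * t) ^ Suc j) has_real_derivative 2 * (real (Suc j) * (2 * s) ^ j)) (at s within {0..t})"
      by (rule derivative_eq_intros refl | simp)+
    show "0 \<le> 2 * (real (Suc j) * (2 * s) ^ j)" using s by simp
    have "norm (shift (R j s z)) \<le> 2 * (2 * s) ^ j"
      using norm_shift[of "R j s z"] Suc.IH[of s] Suc.prems s by auto
    also have "\<dots> \<le> 2 * (real (Suc j) * (2 * s) ^ j)"
      using s by (intro mult_left_mono) (auto intro: mult_right_mono[of 1 "real (Suc j)" "(2 * s) ^ j", simplified])
    finally show "inner (R (Suc j) s z) (rot (q s z) (R (Suc j) s z) + shift (R j s z)) \<le>
        norm (R (Suc j) s z) * (2 * (real (Suc j) * (2 * s) ^ j))"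
      by (simp only: inner_add_right inner_rot add_0_left)
        (rule order_trans[OF norm_cauchy_schwarz mult_left_mono], auto)
  qed (use Suc in auto)
  then show ?case using R_init[OF Suc.prems(2), of j] by simp
qed

lemma q_cont_sub: "continuous_on ({0..} \<times> {0..Z}) (\<lambda>(t, z). q t z)"
  and P_cont_sub: "continuous_on ({0..} \<times> {0..Z}) (\<lambda>(t, z). P t z)"
  by (rule continuous_on_subset[OF q_cont] continuous_on_subset[OF P_cont], auto)+

lemma R_deriv: "t \<ge> 0 \<Longrightarrow> z \<in> {0..Z} \<Longrightarrow>
    ((\<lambda>s. R j s z) has_vector_derivative
      rot (q t z) (R j t z) + (case j of 0 \<Rightarrow> 0 | Suc i \<Rightarrow> shift (R i t z))) (at t within {0..})"
  using R_t[of t z] rho_t[of z t] by (cases j) (auto simp: R_0 intro: has_vector_derivative_at_within)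

lemma R_init': "z \<in> {0..Z} \<Longrightarrow> R j 0 z = R j 0 0"
  using R_init[of z] R_init[of 0] Z by (cases j) (auto simp: R_0 rho_0)

text \<open>The difference of the two sides solves a linear Volterra equation with zero data.\<close>

lemma R_integral_eq:
  "t \<ge> 0 \<Longrightarrow> z \<in> {0..Z} \<Longrightarrow> R j t z = R j t 0 + integral {0..z} (\<lambda>y. cr (R 0 t y) (R (Suc j) t y))"
proof (induction j arbitrary: t z rule: less_induct)
  case (less j)
  note IH = less.IH and t = less.prems(1) and z = less.prems(2)
  define G where "G j t y = cr (R 0 t y) (R (Suc j) t y)" for j t y
  define V where "V j t z = R j t 0 + integral {0..z} (G j t)" for j t z
  define E where "E t z = R j t z - V j t z" for t z
  define sh where "sh j t z = (case j of 0 \<Rightarrow> 0 | Suc i \<Rightarrow> shift (R i t z))" for j t z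
  have sec: "continuous_on {0..z} (\<lambda>y. Q t y)"
    if "continuous_on ({0..} \<times> {0..Z}) (\<lambda>(t, z). Q t z)" "t \<ge> 0" "z \<le> Z" for Q :: "real \<Rightarrow> real \<Rightarrow> 'x::topological_space" and t z
  proof -
    have "continuous_on {0..z} (\<lambda>s. (t, s))" "(\<lambda>s. (t, s)) ` {0..z} \<subseteq> {0..} \<times> {0..Z}"
      using that by (auto intro!: continuous_intros)
    from continuous_on_compose2[OF that(1) this] show ?thesis by simp
  qed
  have G_cont: "continuous_on ({0..} \<times> {0..Z}) (\<lambda>(t, z). G j t z)" for j
    unfolding G_def split_def
    by (intro continuous_intros R_cont[unfolded split_def])
  have G_int: "G j t integrable_on {0..z}" if "t \<ge> 0" "z \<le> Z" for j t z
    by (rule integrable_continuous_real[OF sec[OF G_cont that]])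
  have V_z: "((\<lambda>z. V j t z) has_vector_derivative G j t z) (at z within {0..Z})" if "t \<ge> 0" "z \<in> {0..Z}" for j t z
    unfolding V_def using integral_has_vector_derivative[OF sec[OF G_cont that(1) order_refl] that(2)]
    by (auto intro!: derivative_eq_intros)
  have V_cont: "continuous_on {0..z} (V j t)" if "t \<ge> 0" "z \<le> Z" for j t z
    using that by (intro continuous_on_vector_derivative[of _ _ "G j t"] has_vector_derivative_within_subset[OF V_z]) auto
  have q_sec: "continuous_on {0..z} (q t)" and P_sec: "continuous_on {0..z} (P t)"
    and R_sec: "continuous_on {0..z} (R j t)" if "t \<ge> 0" "z \<le> Z" for j t z
    using sec[OF q_cont_sub that] sec[OF P_cont_sub that] sec[OF R_cont that] by auto
  \<comment> \<open>The t-derivative of \<open>G j\<close>, rewritten by the Jacobi identity. The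
    middle term with \<open>P\<close> is the one that the equation \<open>q_z = - P\<close> has to
    balance.\<close>
  define H where "H t y = rot (q t y) (G j t y) - rot (P t y) (R j t y) + shift (cr (R 0 t y) (R j t y))" for t y
  have G_t: "((\<lambda>s. G j s y) has_vector_derivative H t y) (at t within {0..})" if ty: "t \<ge> 0" "y \<in> {0..Z}" for t y
  proof -
    have r: "((\<lambda>s. R 0 s y) has_vector_derivative rot (q t y) (R 0 t y)) (at t within {0..})"
      using R_deriv[OF ty, of 0] by simp
    have "cr (R 0 t y) (rot (q t y) (R (Suc j) t y) + shift (R j t y)) + cr (rot (q t y) (R 0 t y)) (R (Suc j) t y) = H t y"
      using rot_cr_jacobi[of "q t y" "R 0 t y" "R (Suc j) t y" "R j t y"]
      by (simp add: H_def G_def R_0 rho_def add.commute)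
    with vderiv_cr[OF r R_t[OF ty], of j] show ?thesis unfolding G_def by simp
  qed
  have H_cont: "continuous_on ({0..} \<times> {0..Z}) (\<lambda>(t, z). H t z)"
    unfolding H_def split_def
    by (intro continuous_intros R_cont[unfolded split_def] G_cont[unfolded split_def]
        q_cont_sub[unfolded split_def] P_cont_sub[unfolded split_def])
  have V_t: "((\<lambda>s. V j s z) has_vector_derivative
      rot (q t z) (V j t z) + sh j t z - integral {0..z} (\<lambda>y. rot (P t y) (E t y))) (at t within {0..})"
    if tz: "t \<ge> 0" "z \<in> {0..Z}" for t z
  proof -
    have z0: "0 \<in> {0..Z}" and zZ: "z \<le> Z" using Z tz by auto
    have "((\<lambda>s. integral (cbox 0 z) (G j s)) has_vector_derivative integral (cbox 0 z) (H t)) (at t within {0..})"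
    proof (rule leibniz_rule_vector_derivative)
      show "((\<lambda>x. G j x y) has_vector_derivative H x y) (at x within {0..})"
        if "x \<in> {0..}" "y \<in> cbox 0 z" for x y using G_t[of x y] that zZ by auto
      show "G j x integrable_on cbox 0 z" if "x \<in> {0..}" for x
        using G_int[of x z] that zZ by simp
      show "continuous_on ({0..} \<times> cbox 0 z) (\<lambda>(x, t). H x t)"
        by (rule continuous_on_subset[OF H_cont]) (use zZ in auto)
    qed (use tz in auto)
    then have "((\<lambda>s. V j s z) has_vector_derivative rot (q t 0) (R j t 0) + sh j t 0 + integral {0..z} (H t)) (at t within {0..})"
      unfolding V_def using R_deriv[OF tz(1) z0, of j] by (auto simp: sh_def intro!: derivative_eq_intros)
    moreover have "rot (q t 0) (R j t 0) + sh j t 0 + integral {0..z} (H t) =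
       rot (q t z) (V j t z) + sh j t z - integral {0..z} (\<lambda>y. rot (P t y) (E t y))"
    proof -
      \<comment> \<open>Integration by parts in y: differentiating \<open>q\<close> produces
        \<open>- P\<close>, so the term \<open>rot (P t y) (V j t y)\<close> appears. Together with
        \<open>rot (P t y) (R j t y)\<close> in \<open>H\<close> it leaves only the difference
        \<open>E\<close>.\<close>
      have ftc: "((\<lambda>y. rot (q t y) (G j t y) + rot (- P t y) (V j t y)) has_integral
          rot (q t z) (V j t z) - rot (q t 0) (V j t 0)) {0..z}"
      proof (rule fundamental_theorem_of_calculus)
        fix y assume y: "y \<in> {0..z}"
        show "((\<lambda>y. rot (q t y) (V j t y)) has_vector_derivative rot (q t y) (G j t y) + rot (- P t y) (V j t y)) (at y within {0..z})"
          using y tz by (intro vderiv_rot has_vector_derivative_within_subset[OF q_z] has_vector_derivative_within_subset[OF V_z]) auto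
      qed (use tz in auto)
      \<comment> \<open>For \<open>j = Suc i\<close> this is the induction hypothesis for
        \<open>i\<close> under \<open>shift\<close>. For \<open>j = 0\<close> the integrand is zero,
        a vector commuting with itself.\<close>
      have s: "((\<lambda>y. shift (cr (R 0 t y) (R j t y))) has_integral sh j t z - sh j t 0) {0..z}"
      proof (cases j)
        case 0 then show ?thesis by (simp add: sh_def)
      next
        case (Suc i)
        have "((\<lambda>y. shift (G i t y)) has_integral shift (integral {0..z} (G i t))) {0..z}"
          by (rule has_integral_linear[OF integrable_integral[OF G_int[OF tz(1) zZ]] bounded_linear_shift, unfolded o_def])
        moreover have "integral {0..z} (G i t) = R i t z - R i t 0"
          using IH[of i t z] tz by (simp add: Suc G_def cong: integral_cong)
        moreover have "shift (a - b) = shift a - shift b" for a b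
          by (simp add: shift_def algebra_simps)
        ultimately show ?thesis by (simp add: Suc sh_def G_def)
      qed
      have "((\<lambda>y. rot (P t y) (E t y)) has_integral integral {0..z} (\<lambda>y. rot (P t y) (E t y))) {0..z}"
        unfolding E_def
        by (intro integrable_integral integrable_continuous_real continuous_intros P_sec R_sec V_cont tz zZ)
      from has_integral_diff[OF has_integral_add[OF ftc s] this]
      have "(H t has_integral (rot (q t z) (V j t z) - rot (q t 0) (V j t 0) + (sh j t z - sh j t 0)) -
          integral {0..z} (\<lambda>y. rot (P t y) (E t y))) {0..z}"
        by (rule has_integral_eq[rotated]) (simp add: H_def E_def rot_diff rot_minus_left)
      from integral_unique[OF this] show ?thesis by (simp add: V_def)
    qed
    ultimately show ?thesis by simp
  qed
  have E_t: "((\<lambda>s. E s z) has_vector_derivative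
      rot (q t z) (E t z) + integral {0..z} (\<lambda>y. rot (P t y) (E t y))) (at t within {0..})"
    if tz: "t \<ge> 0" "z \<in> {0..Z}" for t z
    using has_vector_derivative_diff[OF R_deriv[OF tz, of j] V_t[OF tz]]
    unfolding E_def by (simp add: sh_def rot_diff algebra_simps)
  have E_0: "E 0 z = 0" if "z \<in> {0..Z}" for z
  proof -
    have "G j 0 y = 0" if "y \<in> {0..z}" for y
      using R_init[of y j] that \<open>z \<in> {0..Z}\<close> by (simp add: G_def)
    then have "integral {0..z} (G j 0) = 0"
      using integral_cong[of "{0..z}" "G j 0" "\<lambda>_. 0"] by simp
    then show ?thesis using R_init'[OF that, of j] by (simp add: E_def V_def)
  qed
  \<comment> \<open>A bound for \<open>E\<close> on \<open>{0..t}\<close> and \<open>{0..Z}\<close>,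
    read off from \<open>norm_R\<close>. As \<open>norm (P x y) \<le> 1\<close>, each pass through
    the Volterra equation gains a factor \<open>2 * Z * s\<close> over the next integer, and the
    limit forces \<open>E = 0\<close>.\<close>
  define K where "K = 2 * (2 * t) ^ j + Z * (2 * t) ^ Suc j"
  have bound: "norm (E s z) \<le> K * ((2 * Z * s) ^ n / fact n)" if "s \<in> {0..t}" "z \<in> {0..Z}" for n s z
    using that
  proof (induction n arbitrary: s z)
    case 0
    have z0: "0 \<in> {0..Z}" using Z by simp
    have pw: "(2 * s) ^ k \<le> (2 * t) ^ k" for k using 0 by (intro power_mono) auto
    have "norm (integral {0..z} (G j s)) \<le> (2 * t) ^ Suc j * measure lborel {0..z}"
    proof (rule has_integral_bound_real[OF _ finite.emptyI integrable_integral[OF G_int]])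
      fix y assume y: "y \<in> {0..z} - {}"
      have "norm (G j s y) \<le> norm (R 0 s y) * norm (R (Suc j) s y)"
        unfolding G_def by (rule norm_cr)
      also have "\<dots> \<le> 1 * (2 * s) ^ Suc j"
        using norm_R[of s y 0] norm_R[of s y "Suc j"] 0 y by (intro mult_mono) auto
      also have "\<dots> = (2 * s) ^ Suc j" by (rule mult_1)
      also have "\<dots> \<le> (2 * t) ^ Suc j" by (rule pw)
      finally show "norm (G j s y) \<le> (2 * t) ^ Suc j" .
    qed (use 0 t in auto)
    also have "\<dots> \<le> Z * (2 * t) ^ Suc j"
      using 0 t by (simp add: mult.commute mult_right_mono)
    finally have i: "norm (integral {0..z} (G j s)) \<le> Z * (2 * t) ^ Suc j" .
    have "norm (E s z) \<le> norm (R j s z) + (norm (R j s 0) + norm (integral {0..z} (G j s)))"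
      unfolding E_def V_def
      using norm_triangle_ineq4[of "R j s z" "R j s 0 + integral {0..z} (G j s)"]
        norm_triangle_ineq[of "R j s 0" "integral {0..z} (G j s)"] by linarith
    moreover have "norm (R j s z) \<le> (2 * t) ^ j" "norm (R j s 0) \<le> (2 * t) ^ j"
      using order_trans[OF norm_R pw] 0 z0 by auto
    ultimately have "norm (E s z) \<le> K" using i unfolding K_def by linarith
    then show ?case by simp
  next
    case (Suc n)
    let ?g = "\<lambda>s. K * ((2 * Z * s) ^ Suc n / fact (Suc n))"
    let ?g' = "\<lambda>s. 2 * Z * (K * ((2 * Z * s) ^ n / fact n))"
    have "norm (E s z) \<le> norm (E 0 z) + ?g s - ?g 0"
    proof (rule norm_growth_bound[where g' = ?g'])
      show "0 \<le> s" using Suc by simp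
      fix x assume x: "x \<in> {0..s}"
      show "((\<lambda>s. E s z) has_vector_derivative
          rot (q x z) (E x z) + integral {0..z} (\<lambda>y. rot (P x y) (E x y))) (at x within {0..s})"
        by (rule has_vector_derivative_within_subset[OF E_t]) (use x Suc in auto)
      show "(?g has_real_derivative ?g' x) (at x within {0..s})"
        by (rule derivative_eq_intros refl | simp)+
      let ?B = "2 * (K * ((2 * Z * x) ^ n / fact n))"
      have B: "norm (rot (P x y) (E x y)) \<le> ?B" if "y \<in> {0..z}" for y
      proof -
        have "norm (rot (P x y) (E x y)) \<le> 2 * norm (P x y) * norm (E x y)" by (rule norm_rot)
        also have "\<dots> \<le> 2 * 1 * (K * ((2 * Z * x) ^ n / fact n))"
          using norm_P[of y x] Suc.IH[of x y] that x Suc.prems by (intro mult_mono) auto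
        finally show ?thesis by simp
      qed
      have B0: "0 \<le> ?B" using order_trans[OF norm_ge_zero B[of 0]] Suc.prems by simp
      have "?g' x = ?B * Z" by simp
      then show "0 \<le> ?g' x" using mult_nonneg_nonneg[OF B0 Z] by linarith
      have "norm (integral {0..z} (\<lambda>y. rot (P x y) (E x y))) \<le> ?B * measure lborel {0..z}"
        by (rule has_integral_bound_real[OF B0 finite.emptyI integrable_integral[OF integrable_continuous_real] B])
          (use x Suc.prems in \<open>auto simp: E_def intro!: continuous_intros P_sec R_sec V_cont\<close>)
      also have "\<dots> \<le> ?B * Z" using Suc.prems B0 by (intro mult_left_mono) auto
      also have "\<dots> = ?g' x" by simp
      finally have "norm (integral {0..z} (\<lambda>y. rot (P x y) (E x y))) \<le> ?g' x" .
      then show "inner (E x z) (rot (q x z) (E x z) + integral {0..z} (\<lambda>y. rot (P x y) (E x y))) \<le> norm (E x z) * ?g' x"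
        by (simp only: inner_add_right inner_rot add_0_left)
          (rule order_trans[OF norm_cauchy_schwarz mult_left_mono], auto)
    qed
    then show ?case using E_0[OF Suc.prems(2)] by simp
  qed
  have "(\<lambda>n. K * ((2 * Z * t) ^ n / fact n)) \<longlonglongrightarrow> K * 0"
    using summable_LIMSEQ_zero[OF summable_exp[of "2 * Z * t"]]
    by (intro tendsto_mult tendsto_const) (simp add: divide_inverse mult.commute)
  moreover have "\<exists>N. \<forall>n\<ge>N. norm (E t z) \<le> K * ((2 * Z * t) ^ n / fact n)"
    using bound[of t z] t z by auto
  ultimately have "norm (E t z) \<le> K * 0" by (rule LIMSEQ_le_const)
  then show ?case
    by (simp add: E_def V_def G_def cong: integral_cong)
qed

lemma R_z:
  assumes t: "t \<ge> 0" and z: "z \<in> {0..Z}"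
  shows "((\<lambda>y. R j t y) has_vector_derivative cr (R 0 t z) (R (Suc j) t z)) (at z within {0..Z})"
proof -
  have m: "continuous_on {0..Z} (\<lambda>s. (t, s))" "(\<lambda>s. (t, s)) ` {0..Z} \<subseteq> {0..} \<times> {0..Z}"
    using t by (auto intro!: continuous_intros)
  have "continuous_on {0..Z} (\<lambda>y. R i t y)" for i
    using continuous_on_compose2[OF R_cont[of i] m] by simp
  then have "continuous_on {0..Z} (\<lambda>y. cr (R 0 t y) (R (Suc j) t y))"
    by (intro continuous_intros)
  from integral_has_vector_derivative[OF this z]
  have "((\<lambda>z. R j t 0 + integral {0..z} (\<lambda>y. cr (R 0 t y) (R (Suc j) t y))) has_vector_derivative
      cr (R 0 t z) (R (Suc j) t z)) (at z within {0..Z})"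
    by (auto intro!: derivative_eq_intros)
  then show ?thesis
    by (rule has_vector_derivative_transform[OF z R_integral_eq[OF t], rotated])
qed

end

section \<open>Comparison with the linear hierarchy\<close>

text \<open>The bound in the conclusion is a supersolution of the scalar hierarchy with derivative
  equal to the next entry plus \<open>\<kappa> * \<gamma> ^ Suc j\<close>. An infinite hierarchy has
  no last member at which a comparison could begin; instead the a priori bound is fed in at depth n,
  and its effect \<open>(\<theta> * y) ^ n / fact n\<close> tends to 0. Hence \<open>A\<close> and
  \<open>\<theta>\<close> leave no trace in the conclusion.\<close>

lemma hierarchy_comparison:
  fixes x :: "nat \<Rightarrow> real \<Rightarrow> 'a::real_inner"
  assumes deriv: "\<And>j y. y \<in> {0..Z} \<Longrightarrow> ((x j) has_vector_derivative x' j y) (at y within {0..Z})"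
    and le: "\<And>j y. y \<in> {0..Z} \<Longrightarrow> norm (x' j y) \<le> norm (x (Suc j) y) + \<kappa> * \<gamma> ^ Suc j"
    and init: "\<And>j. norm (x j 0) \<le> \<beta> * \<gamma> ^ j"
    and apriori: "\<And>j y. y \<in> {0..Z} \<Longrightarrow> norm (x j y) \<le> A * \<theta> ^ j"
    and nn: "0 \<le> \<beta>" "0 \<le> \<kappa>" "0 \<le> \<gamma>" "0 \<le> A" "0 \<le> \<theta>" and y: "y \<in> {0..Z}"
  shows "norm (x j y) \<le> \<gamma> ^ j * (\<beta> + \<kappa> * \<gamma> * y) * exp (\<gamma> * y)"
proof -
  define b where "b j y = \<gamma> ^ j * (\<beta> + \<kappa> * \<gamma> * y) * exp (\<gamma> * y)" for j y
  have main: "norm (x j y) \<le> b j y + A * \<theta> ^ j * ((\<theta> * y) ^ n / fact n)" if "y \<in> {0..Z}" for n j y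
    using that
  proof (induction n arbitrary: j y)
    case 0
    have "0 \<le> b j y" unfolding b_def using nn 0 by (intro mult_nonneg_nonneg) auto
    then show ?case using apriori[OF 0, of j] by simp
  next
    case (Suc n)
    let ?g = "\<lambda>y. b j y + A * \<theta> ^ j * ((\<theta> * y) ^ Suc n / fact (Suc n))"
    let ?g' = "\<lambda>y. \<gamma> * b j y + \<gamma> ^ j * (\<kappa> * \<gamma>) * exp (\<gamma> * y) + A * \<theta> ^ j * (\<theta> * ((\<theta> * y) ^ n / fact n))"
    have "norm (x j y) \<le> norm (x j 0) + ?g y - ?g 0"
    proof (rule norm_growth_bound[where g' = ?g'])
      show "0 \<le> y" using Suc by simp
      fix s assume s: "s \<in> {0..y}"
      then have s': "s \<in> {0..Z}" using Suc by auto
      show "((x j) has_vector_derivative x' j s) (at s within {0..y})"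
        by (rule has_vector_derivative_within_subset[OF deriv[OF s']]) (use Suc in auto)
      have "((\<lambda>y. A * \<theta> ^ j * ((\<theta> * y) ^ Suc n / fact (Suc n))) has_real_derivative
          A * \<theta> ^ j * (\<theta> * ((\<theta> * s) ^ n / fact n))) (at s within {0..y})"
        by (rule derivative_eq_intros refl | simp)+
      moreover have "(b j has_real_derivative \<gamma> * b j s + \<gamma> ^ j * (\<kappa> * \<gamma>) * exp (\<gamma> * s)) (at s within {0..y})"
        unfolding b_def by (rule derivative_eq_intros refl)+ (simp add: algebra_simps)
      ultimately show "(?g has_real_derivative ?g' s) (at s within {0..y})"
        by (rule DERIV_add[rotated])
      have "norm (x' j s) \<le> b (Suc j) s + A * \<theta> ^ Suc j * ((\<theta> * s) ^ n / fact n) + \<kappa> * \<gamma> ^ Suc j * 1"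
        using le[OF s', of j] Suc.IH[OF s', of "Suc j"] by simp
      also have "\<dots> \<le> b (Suc j) s + A * \<theta> ^ Suc j * ((\<theta> * s) ^ n / fact n) + \<kappa> * \<gamma> ^ Suc j * exp (\<gamma> * s)"
        using nn s by (intro add_left_mono mult_left_mono) auto
      also have "\<dots> = ?g' s" by (simp add: b_def algebra_simps)
      finally have B: "norm (x' j s) \<le> ?g' s" .
      then show "0 \<le> ?g' s" using norm_ge_zero order_trans by blast
      show "inner (x j s) (x' j s) \<le> norm (x j s) * ?g' s"
        by (rule order_trans[OF norm_cauchy_schwarz mult_left_mono[OF B norm_ge_zero]])
    qed
    then show ?case using init[of j] by (simp add: b_def mult.commute)
  qed
  have "(\<lambda>n. b j y + A * \<theta> ^ j * ((\<theta> * y) ^ n / fact n)) \<longlonglongrightarrow> b j y + A * \<theta> ^ j * 0"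
    using summable_LIMSEQ_zero[OF summable_exp[of "\<theta> * y"]]
    by (intro tendsto_add tendsto_mult tendsto_const) (simp add: divide_inverse mult.commute)
  moreover have "\<exists>N. \<forall>n\<ge>N. norm (x j y) \<le> b j y + A * \<theta> ^ j * ((\<theta> * y) ^ n / fact n)"
    using main[OF y, of j] by blast
  ultimately have "norm (x j y) \<le> b j y + A * \<theta> ^ j * 0" by (rule LIMSEQ_le_const)
  then show ?thesis by (simp add: b_def)
qed

text \<open>Entry j of exp(- \<open>\<i>\<close> y S) applied to c, where S is the left shift of
  sequences: the solution of the linear hierarchy with data c.\<close>

definition exp_series :: "(nat \<Rightarrow> complex) \<Rightarrow> nat \<Rightarrow> real \<Rightarrow> complex" where
  "exp_series c j y = (\<Sum>k. c (j + k) / fact k * (- \<i> * of_real y) ^ k)"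

context
  fixes c :: "nat \<Rightarrow> complex" and A a :: real
  assumes c_le: "\<And>n. norm (c n) \<le> A * a ^ n" and a_nn: "a \<ge> 0"
begin

lemma exp_series_bound_term: "norm (c (j + k) / fact k * w ^ k) \<le> A * a ^ j * ((a * norm w) ^ k / fact k)"
proof -
  have "norm (c (j + k) / fact k * w ^ k) = norm (c (j + k)) * (norm w ^ k / fact k)"
    by (simp add: norm_mult norm_divide norm_power)
  also have "\<dots> \<le> A * a ^ (j + k) * (norm w ^ k / fact k)"
    by (intro mult_right_mono c_le) auto
  finally show ?thesis by (simp add: power_add power_mult_distrib)
qed

lemma exp_series_summable_bound: "summable (\<lambda>k. A * a ^ j * ((a * norm w) ^ k / fact k))" for w :: complex
  using summable_mult[OF summable_exp[of "a * norm w"], of "A * a ^ j"] by (simp add: divide_inverse mult.commute)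

lemma exp_series_summable: "summable (\<lambda>k. c (j + k) / fact k * w ^ k)"
  by (rule summable_comparison_test'[OF exp_series_summable_bound exp_series_bound_term])

lemma norm_exp_series: assumes "0 \<le> y" shows "norm (exp_series c j y) \<le> A * exp (a * y) * a ^ j"
proof -
  have "norm (exp_series c j y) \<le> (\<Sum>k. A * a ^ j * ((a * norm (- \<i> * of_real y)) ^ k / fact k))"
    unfolding exp_series_def
    by (rule norm_suminf_le[OF exp_series_bound_term exp_series_summable_bound])
  also have "\<dots> = A * a ^ j * (\<Sum>k. (a * y) ^ k / fact k)"
    using assms summable_exp[of "a * y"] by (subst suminf_mult) (simp_all add: norm_mult divide_inverse mult.commute)
  also have "(\<Sum>k. (a * y) ^ k / fact k) = exp (a * y)"
    by (simp add: exp_def divide_inverse mult.commute)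
  finally show ?thesis by (simp add: algebra_simps)
qed

lemma exp_series_deriv:
  "(exp_series c j has_vector_derivative - \<i> * exp_series c (Suc j) y) (at y within S)"
proof -
  define F where "F w = (\<Sum>k. (c (j + k) / fact k) * w ^ k)" for w
  have d: "diffs (\<lambda>k. c (j + k) / fact k) = (\<lambda>k. c (Suc j + k) / fact k)"
    by (rule ext) (simp add: diffs_def field_simps del: of_nat_Suc)
  have "DERIV F w :> (\<Sum>k. diffs (\<lambda>k. c (j + k) / fact k) k * w ^ k)" for w
    unfolding F_def by (rule termdiffs_strong_converges_everywhere[OF exp_series_summable])
  then have "(F has_field_derivative exp_series c (Suc j) y) (at (- \<i> * of_real y))"
    unfolding d by (simp add: exp_series_def)
  moreover have "((\<lambda>y. - \<i> * of_real y) has_vector_derivative - \<i>) (at y within S)"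
    by (auto intro!: derivative_eq_intros)
  ultimately have "((F \<circ> (\<lambda>y. - \<i> * of_real y)) has_vector_derivative (- \<i>) * exp_series c (Suc j) y) (at y within S)"
    by (intro field_vector_diff_chain_within[OF _ has_field_derivative_at_within])
  moreover have "F \<circ> (\<lambda>y. - \<i> * of_real y) = exp_series c j"
    by (auto simp: F_def exp_series_def)
  ultimately show ?thesis by simp
qed

end

context mb_hierarchy
begin

text \<open>Deviation from the vacuum, for which \<open>R 0\<close> is \<open>(0, 1)\<close> and all
  higher coefficients are zero.\<close>

definition eps :: "nat \<Rightarrow> real \<Rightarrow> real \<Rightarrow> complex \<times> real" where
  "eps j t z = (if j = 0 then R 0 t z - (0, 1) else R j t z)"

lemma eps_Suc [simp]: "eps (Suc j) = R (Suc j)"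
  by (simp add: eps_def fun_eq_iff)

lemma norm_eps_apriori:
  assumes "t \<ge> 0" "z \<in> {0..Z}" shows "norm (eps j t z) \<le> 2 * (1 + 2 * t) ^ j"
proof (cases j)
  case 0
  have "norm (R 0 t z - (0, 1)) \<le> norm (R 0 t z) + norm (0::complex, 1::real)" by (rule norm_triangle_ineq4)
  then show ?thesis using norm_R[OF assms, of 0] 0 by (simp add: eps_def norm_Pair)
next
  case (Suc i)
  have "norm (R j t z) \<le> (2 * t) ^ j" by (rule norm_R[OF assms])
  also have "\<dots> \<le> (1 + 2 * t) ^ j" using assms by (intro power_mono) auto
  also have "\<dots> \<le> 2 * (1 + 2 * t) ^ j" using assms by simp
  finally show ?thesis using Suc by simp
qed

text \<open>Since \<open>R 0\<close> has norm 1, the derivative of each deviation is at most the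
  next deviation. The comparison therefore applies without a source, even though the equation is
  nonlinear.\<close>

lemma eps_bound:
  assumes t: "t \<ge> 0" and Y: "Y \<le> Z" and nn: "0 \<le> B" "0 \<le> \<gamma>"
    and init: "\<And>k. norm (eps k t 0) \<le> B * \<gamma> ^ k" and y: "y \<in> {0..Y}"
  shows "norm (eps j t y) \<le> \<gamma> ^ j * B * exp (\<gamma> * y)"
proof -
  have "norm (eps j t y) \<le> \<gamma> ^ j * (B + 0 * \<gamma> * y) * exp (\<gamma> * y)"
  proof (rule hierarchy_comparison[where x' = "\<lambda>j z. cr (R 0 t z) (R (Suc j) t z)" and A = 2 and \<theta> = "1 + 2 * t" and Z = Y])
    fix j z assume z: "z \<in> {0..Y}"
    then have z': "z \<in> {0..Z}" using Y by auto
    have "((\<lambda>y. R j t y - (if j = 0 then (0, 1) else 0)) has_vector_derivative cr (R 0 t z) (R (Suc j) t z)) (at z within {0..Y})"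
      using has_vector_derivative_within_subset[OF R_z[OF t z'], of "{0..Y}"] Y by (auto intro!: derivative_eq_intros)
    moreover have "(\<lambda>y. R j t y - (if j = 0 then (0, 1) else 0)) = eps j t"
      by (auto simp: eps_def fun_eq_iff)
    ultimately show "((\<lambda>z. eps j t z) has_vector_derivative cr (R 0 t z) (R (Suc j) t z)) (at z within {0..Y})"
      by simp
    show "norm (cr (R 0 t z) (R (Suc j) t z)) \<le> norm (eps (Suc j) t z) + 0 * \<gamma> ^ Suc j"
      using norm_cr[of "R 0 t z" "R (Suc j) t z"] norm_rho[of z t] z' t by (simp add: R_0)
    show "norm (eps j t z) \<le> 2 * (1 + 2 * t) ^ j"
      by (rule norm_eps_apriori[OF t z'])
  qed (use nn init y t in auto)
  then show ?thesis by simp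
qed

text \<open>Splitting \<open>R 0 = (0, 1) + eps 0\<close> separates the linear equation from a
  product of two deviations. \<open>eps_bound\<close> controls both factors up to \<open>Y\<close>,
  and the square of that bound becomes the source in the comparison.\<close>

lemma P_exp_series_bound:
  assumes t: "t \<ge> 0" and Y: "0 \<le> Y" "Y \<le> Z" and nn: "0 \<le> B" "0 \<le> \<beta>" "0 \<le> \<gamma>" "0 \<le> A" "0 \<le> a"
    and init: "\<And>k. norm (eps k t 0) \<le> B * \<gamma> ^ k"
    and err: "\<And>k. norm (fst (R k t 0) - c k) \<le> \<beta> * \<gamma> ^ k"
    and c: "\<And>n. norm (c n) \<le> A * a ^ n" and y: "y \<in> {0..Y}"
  shows "norm (P t y - exp_series c 0 y) \<le> (\<beta> + (B * exp (\<gamma> * Y))\<^sup>2 * \<gamma> * y) * exp (\<gamma> * y)"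
proof -
  define x where "x j y = fst (R j t y) - exp_series c j y" for j y
  define x' where "x' j y = fst (cr (R 0 t y) (R (Suc j) t y)) - (- \<i> * exp_series c (Suc j) y)" for j y
  have eb: "norm (eps j t z) \<le> \<gamma> ^ j * (B * exp (\<gamma> * Y))" if "z \<in> {0..Y}" for j z
  proof -
    have "norm (eps j t z) \<le> \<gamma> ^ j * B * exp (\<gamma> * z)" by (rule eps_bound[OF t Y(2) nn(1,3) init that])
    also have "\<dots> \<le> \<gamma> ^ j * B * exp (\<gamma> * Y)"
      using that nn by (intro mult_left_mono) (auto intro: mult_left_mono)
    finally show ?thesis by (simp add: mult.assoc)
  qed
  have "norm (x 0 y) \<le> \<gamma> ^ 0 * (\<beta> + (B * exp (\<gamma> * Y))\<^sup>2 * \<gamma> * y) * exp (\<gamma> * y)"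
  proof (rule hierarchy_comparison[where x' = x' and A = "2 + A * exp (a * Y)" and \<theta> = "1 + 2 * t + a" and Z = Y])
    fix j z assume z: "z \<in> {0..Y}"
    then have z': "z \<in> {0..Z}" using Y by auto
    have "((\<lambda>y. fst (R j t y)) has_vector_derivative fst (cr (R 0 t z) (R (Suc j) t z))) (at z within {0..Y})"
      using Y by (intro bounded_linear.has_vector_derivative[OF bounded_linear_fst]
          has_vector_derivative_within_subset[OF R_z[OF t z']]) auto
    from has_vector_derivative_diff[OF this exp_series_deriv[OF c nn(5)]]
    show "(x j has_vector_derivative x' j z) (at z within {0..Y})"
      unfolding x_def x'_def .
    have "x' j z = - \<i> * x (Suc j) z + fst (cr (eps 0 t z) (eps (Suc j) t z))"
      by (simp add: x'_def x_def eps_def cr_def algebra_simps)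
    also have "norm \<dots> \<le> norm (x (Suc j) z) + norm (eps 0 t z) * norm (eps (Suc j) t z)"
    proof -
      have "norm (fst (cr (eps 0 t z) (eps (Suc j) t z))) \<le> norm (eps 0 t z) * norm (eps (Suc j) t z)"
        using norm_fst_le[of "fst (cr (eps 0 t z) (eps (Suc j) t z))" "snd (cr (eps 0 t z) (eps (Suc j) t z))"]
          norm_cr[of "eps 0 t z" "eps (Suc j) t z"] by simp
      then show ?thesis
        using norm_triangle_ineq[of "- \<i> * x (Suc j) z" "fst (cr (eps 0 t z) (eps (Suc j) t z))"]
        by (simp add: norm_mult)
    qed
    also have "\<dots> \<le> norm (x (Suc j) z) + (\<gamma> ^ 0 * (B * exp (\<gamma> * Y))) * (\<gamma> ^ Suc j * (B * exp (\<gamma> * Y)))"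
      using nn by (intro add_left_mono mult_mono eb z) auto
    also have "\<dots> = norm (x (Suc j) z) + (B * exp (\<gamma> * Y))\<^sup>2 * \<gamma> ^ Suc j"
      by (simp add: power2_eq_square algebra_simps)
    finally show "norm (x' j z) \<le> norm (x (Suc j) z) + (B * exp (\<gamma> * Y))\<^sup>2 * \<gamma> ^ Suc j" .
    have "norm (fst (R j t z)) \<le> norm (R j t z)"
      using norm_fst_le[of "fst (R j t z)" "snd (R j t z)"] by simp
    also have "\<dots> \<le> (2 * t) ^ j" by (rule norm_R[OF t z'])
    also have "\<dots> \<le> (1 + 2 * t + a) ^ j" using t nn by (intro power_mono) auto
    finally have 1: "norm (fst (R j t z)) \<le> 2 * (1 + 2 * t + a) ^ j"
      using t nn by (smt (verit) zero_le_power)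
    have "norm (exp_series c j z) \<le> A * exp (a * z) * a ^ j"
      using z by (intro norm_exp_series c nn) auto
    also have "\<dots> \<le> A * exp (a * Y) * (1 + 2 * t + a) ^ j"
      using z t nn by (intro mult_mono power_mono) (auto intro: mult_left_mono)
    finally show "norm (x j z) \<le> (2 + A * exp (a * Y)) * (1 + 2 * t + a) ^ j"
      unfolding x_def using 1 norm_triangle_ineq4[of "fst (R j t z)" "exp_series c j z"]
      by (simp add: distrib_right)
  next
    show "norm (x j 0) \<le> \<beta> * \<gamma> ^ j" for j
    proof -
      have "exp_series c j 0 = c j"
        using powser_zero[of "\<lambda>k. c (j + k) / fact k"] by (simp add: exp_series_def)
      then show ?thesis using err[of j] by (simp add: x_def)
    qed
  qed (use nn y t in auto)
  then show ?thesis by (simp add: x_def R_0 rho_def)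
qed

end

section \<open>Smoothness and Taylor remainders\<close>

text \<open>Existence of n successive derivatives without naming them. This form is closed under
  products, conjugates and inverses by induction, with no formula for higher derivatives; the link
  to \<open>vderiv_iter\<close> comes afterwards.\<close>

fun times_differentiable :: "nat \<Rightarrow> (real \<Rightarrow> complex) \<Rightarrow> bool" where
  "times_differentiable 0 f \<longleftrightarrow> True"
| "times_differentiable (Suc n) f \<longleftrightarrow>
     (\<exists>f'. (\<forall>x. (f has_vector_derivative f' x) (at x)) \<and> times_differentiable n f')"

lemma times_differentiable_SucI:
  "(\<And>x. (f has_vector_derivative f' x) (at x)) \<Longrightarrow> times_differentiable n f' \<Longrightarrow> times_differentiable (Suc n) f"
  unfolding times_differentiable.simps by (rule exI[of _ f']) simp

lemma times_differentiable_SucE: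
  assumes "times_differentiable (Suc n) f"
  obtains f' where "\<And>x. (f has_vector_derivative f' x) (at x)" "times_differentiable n f'"
proof -
  from assms have "\<exists>f'. (\<forall>x. (f has_vector_derivative f' x) (at x)) \<and> times_differentiable n f'"
    by simp
  then show thesis
    by (elim exE conjE) (rule that, erule spec)
qed

declare times_differentiable.simps(2) [simp del]

lemma times_differentiable_SucD: "times_differentiable (Suc n) f \<Longrightarrow> times_differentiable n f"
proof (induction n arbitrary: f)
  case (Suc n)
  from Suc.prems obtain f' where f': "\<And>x. (f has_vector_derivative f' x) (at x)" "times_differentiable (Suc n) f'"
    by (rule times_differentiable_SucE) (rule that)
  show ?case by (rule times_differentiable_SucI[OF f'(1) Suc.IH[OF f'(2)]])
qed simp

lemma times_differentiable_const: "times_differentiable n (\<lambda>_. c)"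
proof (induction n arbitrary: c)
  case (Suc n)
  show ?case by (rule times_differentiable_SucI[OF has_vector_derivative_const Suc])
qed simp

lemma times_differentiable_add:
  "times_differentiable n f \<Longrightarrow> times_differentiable n g \<Longrightarrow> times_differentiable n (\<lambda>x. f x + g x)"
proof (induction n arbitrary: f g)
  case (Suc n)
  from Suc.prems(1) obtain f' where f: "\<And>x. (f has_vector_derivative f' x) (at x)" "times_differentiable n f'"
    by (rule times_differentiable_SucE) (rule that)
  from Suc.prems(2) obtain g' where g: "\<And>x. (g has_vector_derivative g' x) (at x)" "times_differentiable n g'"
    by (rule times_differentiable_SucE) (rule that)
  show ?case
    by (rule times_differentiable_SucI[OF has_vector_derivative_add[OF f(1) g(1)] Suc.IH[OF f(2) g(2)]])
qed simp

lemma times_differentiable_mult: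
  "times_differentiable n f \<Longrightarrow> times_differentiable n g \<Longrightarrow> times_differentiable n (\<lambda>x. f x * g x)"
proof (induction n arbitrary: f g)
  case (Suc n)
  from Suc.prems(1) obtain f' where f: "\<And>x. (f has_vector_derivative f' x) (at x)" "times_differentiable n f'"
    by (rule times_differentiable_SucE) (rule that)
  from Suc.prems(2) obtain g' where g: "\<And>x. (g has_vector_derivative g' x) (at x)" "times_differentiable n g'"
    by (rule times_differentiable_SucE) (rule that)
  have "times_differentiable n (\<lambda>x. f x * g' x + f' x * g x)"
    by (rule times_differentiable_add[OF Suc.IH[OF times_differentiable_SucD[OF Suc.prems(1)] g(2)]
          Suc.IH[OF f(2) times_differentiable_SucD[OF Suc.prems(2)]]])
  then show ?case
    by (rule times_differentiable_SucI[OF has_vector_derivative_mult[OF f(1) g(1)]])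
qed simp

lemma times_differentiable_cnj: "times_differentiable n f \<Longrightarrow> times_differentiable n (\<lambda>x. cnj (f x))"
proof (induction n arbitrary: f)
  case (Suc n)
  from Suc.prems obtain f' where f: "\<And>x. (f has_vector_derivative f' x) (at x)" "times_differentiable n f'"
    by (rule times_differentiable_SucE) (rule that)
  show ?case
    by (rule times_differentiable_SucI[OF bounded_linear.has_vector_derivative[OF bounded_linear_cnj f(1)] Suc.IH[OF f(2)]])
qed simp

lemma times_differentiable_inverse:
  "times_differentiable n f \<Longrightarrow> (\<And>x. f x \<noteq> 0) \<Longrightarrow> times_differentiable n (\<lambda>x. inverse (f x))"
proof (induction n)
  case (Suc n)
  from Suc.prems(1) obtain f' where f: "\<And>x. (f has_vector_derivative f' x) (at x)" "times_differentiable n f'"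
    by (rule times_differentiable_SucE) (rule that)
  have i: "times_differentiable n (\<lambda>x. inverse (f x))"
    by (rule Suc.IH[OF times_differentiable_SucD[OF Suc.prems(1)] Suc.prems(2)])
  have d: "((\<lambda>x. inverse (f x)) has_vector_derivative (-1) * (f' x * (inverse (f x) * inverse (f x)))) (at x)" for x
  proof -
    have "(inverse has_field_derivative - (inverse (f x) ^ Suc (Suc 0))) (at (f x))"
      by (rule DERIV_inverse[OF Suc.prems(2)])
    from field_vector_diff_chain_at[OF f(1) this] show ?thesis
      by (simp add: o_def)
  qed
  have "times_differentiable n (\<lambda>x. (-1) * (f' x * (inverse (f x) * inverse (f x))))"
    by (rule times_differentiable_mult[OF times_differentiable_const
          times_differentiable_mult[OF f(2) times_differentiable_mult[OF i i]]])
  then show ?case by (rule times_differentiable_SucI[OF d])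
qed simp

lemma times_differentiable_vderiv:
  assumes "times_differentiable (Suc n) f"
  shows "(f has_vector_derivative vderiv_iter 1 f x) (at x)" "times_differentiable n (vderiv_iter 1 f)"
proof -
  from assms obtain f' where d: "\<And>x. (f has_vector_derivative f' x) (at x)" "times_differentiable n f'"
    by (rule times_differentiable_SucE) (rule that)
  have "f' = vderiv_iter 1 f"
    using vector_derivative_at[OF d(1)] by (simp add: vderiv_iter_def fun_eq_iff)
  then show "(f has_vector_derivative vderiv_iter 1 f x) (at x)" "times_differentiable n (vderiv_iter 1 f)"
    using d by simp_all
qed

lemma vderiv_iter_Suc: "vderiv_iter (Suc n) f x = vector_derivative (vderiv_iter n f) (at x)"
  by (simp add: vderiv_iter_def)

lemma times_differentiable_vderiv_iter:
  assumes "times_differentiable (m + n) f"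
  shows "times_differentiable n (vderiv_iter m f)"
  using assms
proof (induction m arbitrary: n)
  case 0 then show ?case by (simp add: vderiv_iter_def)
next
  case (Suc m)
  have *: "times_differentiable (Suc n) (vderiv_iter m f)"
    by (rule Suc.IH) (use Suc.prems in simp)
  have "vderiv_iter 1 (vderiv_iter m f) = vderiv_iter (Suc m) f"
    by (simp add: vderiv_iter_def)
  with times_differentiable_vderiv(2)[OF *] show ?case by simp
qed

lemma has_vderiv_iter:
  assumes "times_differentiable (Suc m) f"
  shows "(vderiv_iter m f has_vector_derivative vderiv_iter (Suc m) f x) (at x within S)"
proof -
  have "times_differentiable (Suc 0) (vderiv_iter m f)"
    by (rule times_differentiable_vderiv_iter) (use assms in simp)
  then obtain f' where f': "(vderiv_iter m f has_vector_derivative f' x) (at x)"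
    by (rule times_differentiable_SucE) (rule that)
  show ?thesis
    using f' unfolding vderiv_iter_Suc vector_derivative_at[OF f'] by (rule has_vector_derivative_at_within)
qed

text \<open>Taylor's formula with integral remainder, on the right of 0 only: the expansion will be
  evaluated along positive points that tend to 0.\<close>

lemma norm_taylor_remainder_le:
  fixes f :: "real \<Rightarrow> complex"
  assumes f: "\<And>n. times_differentiable n f" and low: "\<And>m. m < M \<Longrightarrow> vderiv_iter m f 0 = 0"
  obtains K where "\<And>x. 0 \<le> x \<Longrightarrow> x \<le> 1 \<Longrightarrow> norm (f x - of_real (x ^ M / fact M) * vderiv_iter M f 0) \<le> K * x ^ Suc M"
proof -
  have d: "(vderiv_iter m f has_vector_derivative vderiv_iter (Suc m) f x) (at x within S)" for m x S
    by (rule has_vderiv_iter[OF f])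
  have "continuous_on {0..1} (vderiv_iter (Suc M) f)"
    by (rule continuous_on_vector_derivative[OF d])
  then have "bounded (vderiv_iter (Suc M) f ` {0..1})"
    by (intro compact_imp_bounded compact_continuous_image) auto
  then obtain K where K: "\<And>x. x \<in> {0..1} \<Longrightarrow> norm (vderiv_iter (Suc M) f x) \<le> K"
    unfolding bounded_iff by blast
  show ?thesis
  proof (rule that[of K])
    fix x :: real assume x: "0 \<le> x" "x \<le> 1"
    have T: "((\<lambda>s. ((x - s) ^ (Suc M - 1) / fact (Suc M - 1)) *\<^sub>R vderiv_iter (Suc M) f s) has_integral
       f x - (\<Sum>i<Suc M. ((x - 0) ^ i / fact i) *\<^sub>R vderiv_iter i f 0)) {0..x}"
      by (rule Taylor_has_integral[where Df = "\<lambda>i. vderiv_iter i f"])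
        (use x in \<open>simp_all add: d vderiv_iter_def[of 0]\<close>)
    have "(\<Sum>i<Suc M. ((x - 0) ^ i / fact i) *\<^sub>R vderiv_iter i f 0) = of_real (x ^ M / fact M) * vderiv_iter M f 0"
      using low by (simp add: scaleR_conv_of_real)
    with T have T': "((\<lambda>s. ((x - s) ^ M / fact M) *\<^sub>R vderiv_iter (Suc M) f s) has_integral
       f x - of_real (x ^ M / fact M) * vderiv_iter M f 0) {0..x}" by simp
    have K0: "0 \<le> K" using order_trans[OF norm_ge_zero K[of 0]] by simp
    have "norm (f x - of_real (x ^ M / fact M) * vderiv_iter M f 0) \<le> (K * x ^ M) * Henstock_Kurzweil_Integration.content {0..x}"
    proof (rule has_integral_bound_real[OF _ finite.emptyI T'])
      fix s assume s: "s \<in> {0..x} - {}"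
      have "norm (((x - s) ^ M / fact M) *\<^sub>R vderiv_iter (Suc M) f s) = (x - s) ^ M / fact M * norm (vderiv_iter (Suc M) f s)"
        using s by simp
      also have "\<dots> \<le> x ^ M / 1 * K"
        using s x K0 by (intro mult_mono frac_le power_mono K) auto
      also have "\<dots> = K * x ^ M" by simp
      finally show "norm (((x - s) ^ M / fact M) *\<^sub>R vderiv_iter (Suc M) f s) \<le> K * x ^ M" .
    qed (use x K0 in auto)
    then show "norm (f x - of_real (x ^ M / fact M) * vderiv_iter M f 0) \<le> K * x ^ Suc M"
      using x by (simp add: mult_ac)
  qed
qed

text \<open>Limits of entire functions that converge rapidly on shrinking strips are smooth on the line,
  by Cauchy's inequality on discs of radius \<open>1/(m+1)\<close>.\<close>

lemma strip_limit_times_differentiable: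
  fixes F :: "nat \<Rightarrow> complex \<Rightarrow> complex" and g :: "real \<Rightarrow> complex"
  assumes hol: "\<And>m. F m holomorphic_on UNIV"
    and C: "\<And>k m w. \<bar>Im w\<bar> \<le> 1 / (real m + 1) \<Longrightarrow> norm (F (Suc m) w - F m w) * (1 + real m) ^ k \<le> C k"
    and lim: "\<And>x. (\<lambda>m. F m (of_real x)) \<longlonglongrightarrow> g x"
  shows "times_differentiable n g"
proof -
  define D where "D k m x = (deriv ^^ k) (F m) (of_real x)" for k m and x :: real
  \<comment> \<open>Of the \<open>k + 2\<close> orders of decay, k pay for the radius
    \<open>1 / (m + 1)\<close> in Cauchy's inequality for the k-th derivative, and the remaining two
    make the bounds summable.\<close>
  define M where "M k m = fact k * C (k + 2) * (1 / (1 + real m) ^ 2)" for k m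
  have step: "norm (D k (Suc m) x - D k m x) \<le> M k m" for k m x
  proof -
    define r where "r = 1 / (real m + 1)"
    have r: "r > 0" by (simp add: r_def)
    have "norm ((deriv ^^ k) (\<lambda>w. F (Suc m) w - F m w) (of_real x)) \<le> fact k * (C (k + 2) / (1 + real m) ^ (k + 2)) / r ^ k"
    proof (rule Cauchy_inequality[OF _ _ r])
      fix w :: complex assume w: "norm (of_real x - w) = r"
      have "\<bar>Im w\<bar> \<le> 1 / (real m + 1)"
        using abs_Im_le_cmod[of "of_real x - w"] w by (simp add: r_def)
      from C[OF this, of "k + 2"] show "norm (F (Suc m) w - F m w) \<le> C (k + 2) / (1 + real m) ^ (k + 2)"
        by (subst pos_le_divide_eq) auto
    qed (auto intro!: holomorphic_on_diff holomorphic_on_imp_continuous_on intro: holomorphic_on_subset[OF hol])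
    also have "fact k * (C (k + 2) / (1 + real m) ^ (k + 2)) / r ^ k = M k m"
    proof -
      define x where "x = 1 + real m"
      have x: "x \<noteq> 0" by (simp add: x_def)
      then show ?thesis
        unfolding M_def r_def add.commute[of "real m"] x_def[symmetric]
        by (simp add: power_add power_one_over field_simps power2_eq_square)
    qed
    also have "(deriv ^^ k) (\<lambda>w. F (Suc m) w - F m w) (of_real x) = D k (Suc m) x - D k m x"
      unfolding D_def by (rule higher_deriv_diff[OF hol hol]) auto
    finally show ?thesis .
  qed
  have sM: "summable (M k)" for k
  proof -
    have "summable (\<lambda>m. 1 / (real (Suc m)) ^ 2)"
      using inverse_power_summable[of 2, where 'a = real] summable_Suc_iff[of "\<lambda>n. inverse (real n ^ 2)"]
      by (simp add: inverse_eq_divide)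
    then show ?thesis unfolding M_def by (intro summable_mult) (simp add: add.commute)
  qed
  have "\<exists>G. uniform_limit UNIV (D k) G sequentially" for k
  proof -
    have "uniform_limit UNIV (\<lambda>n x. \<Sum>i<n. D k (Suc i) x - D k i x) (\<lambda>x. suminf (\<lambda>i. D k (Suc i) x - D k i x)) sequentially"
      by (rule Weierstrass_m_test[OF step sM])
    moreover have "uniform_limit UNIV (\<lambda>n. D k 0) (D k 0) sequentially" by (rule uniform_limit_const)
    ultimately have "uniform_limit UNIV (\<lambda>n x. D k 0 x + (\<Sum>i<n. D k (Suc i) x - D k i x))
        (\<lambda>x. D k 0 x + suminf (\<lambda>i. D k (Suc i) x - D k i x)) sequentially"
      by (intro uniform_limit_add)
    moreover have "D k 0 x + (\<Sum>i<n. D k (Suc i) x - D k i x) = D k n x" for n x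
      using sum_lessThan_telescope[of "\<lambda>i. D k i x" n] by simp
    ultimately show ?thesis by auto
  qed
  then obtain G where G: "\<And>k. uniform_limit UNIV (D k) (G k) sequentially" by metis
  have G0: "G 0 = g"
  proof
    fix x
    have "(\<lambda>m. D 0 m x) \<longlonglongrightarrow> G 0 x" by (rule tendsto_uniform_limitI[OF G]) simp
    with lim[of x] show "G 0 x = g x" by (auto simp: D_def intro: LIMSEQ_unique)
  qed
  have dG: "(G k has_vector_derivative G (Suc k) x) (at x)" for k x
  proof -
    have "\<exists>h. \<forall>x\<in>UNIV. (\<lambda>m. D k m x) \<longlonglongrightarrow> h x \<and> (h has_derivative (\<lambda>y. y *\<^sub>R G (Suc k) x)) (at x within UNIV)"
    proof (rule has_derivative_sequence[where f' = "\<lambda>m x y. y *\<^sub>R D (Suc k) m x" and ?x0.0 = 0])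
      show "(D k m has_derivative (\<lambda>y. y *\<^sub>R D (Suc k) m x)) (at x within UNIV)" for m x
      proof -
        have "((deriv ^^ k) (F m) has_field_derivative (deriv ^^ (Suc k)) (F m) (of_real x)) (at (of_real x))"
          by (rule has_field_derivative_higher_deriv[OF hol]) auto
        moreover have "((\<lambda>x. of_real x :: complex) has_vector_derivative 1) (at x)"
          by (auto intro!: derivative_eq_intros)
        ultimately have "(((deriv ^^ k) (F m) \<circ> of_real) has_vector_derivative 1 * (deriv ^^ (Suc k)) (F m) (of_real x)) (at x)"
          by (intro field_vector_diff_chain_at)
        then show ?thesis by (simp add: D_def[abs_def] o_def has_vector_derivative_def)
      qed
      fix e :: real assume "e > 0"
      from uniform_limitD[OF G[of "Suc k"] this]
      show "\<forall>\<^sub>F m in sequentially. \<forall>x\<in>UNIV. \<forall>h. norm (h *\<^sub>R D (Suc k) m x - h *\<^sub>R G (Suc k) x) \<le> e * norm h"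
      proof eventually_elim
        case (elim m)
        show ?case
        proof (intro ballI allI)
          fix x h :: real
          have "norm (D (Suc k) m x - G (Suc k) x) \<le> e" using elim by (simp add: dist_norm less_imp_le)
          then have "norm h * norm (D (Suc k) m x - G (Suc k) x) \<le> norm h * e" by (rule mult_left_mono) simp
          then show "norm (h *\<^sub>R D (Suc k) m x - h *\<^sub>R G (Suc k) x) \<le> e * norm h"
            by (simp add: scaleR_diff_right[symmetric] mult.commute)
        qed
      qed
    next
      show "(\<lambda>m. D k m 0) \<longlonglongrightarrow> G k 0" by (rule tendsto_uniform_limitI[OF G]) simp
    qed auto
    then obtain h where h: "\<And>x. (\<lambda>m. D k m x) \<longlonglongrightarrow> h x" "\<And>x. (h has_derivative (\<lambda>y. y *\<^sub>R G (Suc k) x)) (at x)"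
      by auto
    have "h = G k"
      using h(1) tendsto_uniform_limitI[OF G[of k]] by (auto intro: LIMSEQ_unique)
    with h(2) show ?thesis by (simp add: has_vector_derivative_def)
  qed
  have "times_differentiable n (G k)" for n k
    by (induction n arbitrary: k) (auto intro: times_differentiable_SucI[OF dG])
  from this[of n 0] show ?thesis by (simp add: G0)
qed

text \<open>Integrating costs two orders: one factor \<open>1 / (1 + x)\<^sup>2\<close> is kept to
  have an integrable majorant with antiderivative \<open>- 1 / (1 + x)\<close>. The constants are
  explicit so that bounds uniform in the spectral parameter yield uniform convergence.\<close>

lemma rapid_limit:
  fixes f :: "real \<Rightarrow> 'a::euclidean_space"
  assumes f: "\<And>t. t \<ge> 0 \<Longrightarrow> (f has_vector_derivative f' t) (at t within {0..})"
    and K: "\<And>n t. t \<ge> 0 \<Longrightarrow> norm (f' t) * (1 + t) ^ n \<le> K n"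
  obtains l where "(f \<longlongrightarrow> l) at_top" "\<And>n t. t \<ge> 0 \<Longrightarrow> norm (f t - l) * (1 + t) ^ n \<le> K (n + 2)"
proof -
  have diff: "norm (f s - f t) * (1 + t) ^ n \<le> K (n + 2)" if ts: "0 \<le> t" "t \<le> s" for t s n
  proof -
    define c where "c = K (n + 2) / (1 + t) ^ n"
    have K0: "0 \<le> K m" for m
      using order_trans[OF norm_ge_zero K[of 0 m, simplified]] by simp
    have c0: "c \<ge> 0" using K0 ts by (simp add: c_def)
    have "norm (f s - f t) \<le> norm (f t - f t) + (- c / (1 + s)) - (- c / (1 + t))"
    proof (rule norm_growth_bound[OF ts(2), where x = "\<lambda>s. f s - f t" and x' = f' and g' = "\<lambda>x. c / (1 + x) ^ 2"])
      fix x assume x: "x \<in> {t..s}"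
      have "((\<lambda>s. f s - f t) has_vector_derivative f' x - 0) (at x within {t..s})"
        by (intro has_vector_derivative_diff has_vector_derivative_const has_vector_derivative_within_subset[OF f])
          (use x ts in auto)
      then show "((\<lambda>s. f s - f t) has_vector_derivative f' x) (at x within {t..s})" by simp
      show "((\<lambda>x. - c / (1 + x)) has_real_derivative c / (1 + x)\<^sup>2) (at x within {t..s})"
        using x ts by (auto intro!: derivative_eq_intros simp: power2_eq_square)
      show "0 \<le> c / (1 + x)\<^sup>2" using c0 by simp
      have "norm (f' x) \<le> K (n + 2) / (1 + x) ^ (n + 2)"
        using K[of x "n + 2"] x ts by (subst pos_le_divide_eq) auto
      also have "\<dots> = K (n + 2) / (1 + x) ^ n / (1 + x)\<^sup>2" by (simp add: power_add power2_eq_square)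
      also have "\<dots> \<le> c / (1 + x)\<^sup>2"
        unfolding c_def using x ts K0 by (intro divide_right_mono divide_left_mono power_mono) auto
      finally have b: "norm (f' x) \<le> c / (1 + x)\<^sup>2" .
      show "inner (f x - f t) (f' x) \<le> norm (f x - f t) * (c / (1 + x)\<^sup>2)"
        by (rule order_trans[OF norm_cauchy_schwarz mult_left_mono[OF b norm_ge_zero]])
    qed
    also have "\<dots> \<le> c / (1 + t)" using c0 ts by simp
    also have "\<dots> \<le> c" using c0 ts by (simp add: divide_le_eq mult_le_cancel_left1)
    finally show ?thesis using ts by (simp add: c_def pos_le_divide_eq)
  qed
  have K0: "0 \<le> K m" for m
    using order_trans[OF norm_ge_zero K[of 0 m, simplified]] by simp
  have "Cauchy (\<lambda>m. f (real m))"
  proof (rule CauchyI)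
    fix e :: real assume e: "e > 0"
    obtain N :: nat where N: "real N > 2 * K 3 / e" using reals_Archimedean2 by blast
    have c: "norm (f (real m) - f (real N)) < e / 2" if "m \<ge> N" for m
    proof -
      have a: "norm (f (real m) - f (real N)) * (1 + real N) \<le> K 3"
        using diff[of "real N" "real m" 1] that by (simp add: numeral_3_eq_3)
      have "K 3 < e / 2 * (1 + real N)" using N e K0[of 3] by (simp add: field_simps)
      with a have "norm (f (real m) - f (real N)) * (1 + real N) < e / 2 * (1 + real N)" by linarith
      then show ?thesis by (simp add: mult_less_cancel_right)
    qed
    show "\<exists>M. \<forall>m\<ge>M. \<forall>n\<ge>M. norm (f (real m) - f (real n)) < e"
    proof (intro exI[of _ N] allI impI)
      fix m n assume "N \<le> m" "N \<le> n"
      from c[OF this(1)] c[OF this(2)] show "norm (f (real m) - f (real n)) < e"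
        using norm_triangle_ineq4[of "f (real m) - f (real N)" "f (real n) - f (real N)"] by simp
    qed
  qed
  then obtain l where l: "(\<lambda>m. f (real m)) \<longlonglongrightarrow> l"
    using convergent_eq_Cauchy by blast
  have bound: "norm (f t - l) * (1 + t) ^ n \<le> K (n + 2)" if t: "t \<ge> 0" for t n
  proof -
    have "(\<lambda>m. norm (f (real m) - f t) * (1 + t) ^ n) \<longlonglongrightarrow> norm (l - f t) * (1 + t) ^ n"
      by (intro tendsto_intros l)
    moreover have "\<exists>N. \<forall>m\<ge>N. norm (f (real m) - f t) * (1 + t) ^ n \<le> K (n + 2)"
    proof (intro exI allI impI)
      fix m assume "nat \<lceil>t\<rceil> \<le> m"
      then have "t \<le> real m" by linarith
      then show "norm (f (real m) - f t) * (1 + t) ^ n \<le> K (n + 2)" by (rule diff[OF t])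
    qed
    ultimately have "norm (l - f t) * (1 + t) ^ n \<le> K (n + 2)" by (rule LIMSEQ_le_const2)
    then show ?thesis by (simp add: norm_minus_commute)
  qed
  have "(f \<longlongrightarrow> l) at_top"
  proof (rule Lim_null_comparison[of "\<lambda>t. f t - l" "\<lambda>t. K 3 / (1 + t)" at_top, unfolded LIM_zero_iff])
    show "\<forall>\<^sub>F t in at_top. norm (f t - l) \<le> K 3 / (1 + t)"
      using eventually_ge_at_top[of 0]
    proof eventually_elim
      case (elim t)
      from bound[OF this, of 1] elim show ?case by (simp add: pos_le_divide_eq numeral_3_eq_3)
    qed
    have "filterlim (\<lambda>t. 1 + t) at_top (at_top :: real filter)"
      by (rule filterlim_tendsto_add_at_top[OF tendsto_const filterlim_ident])
    then show "((\<lambda>t. K 3 / (1 + t)) \<longlongrightarrow> 0) at_top"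
      by (intro tendsto_divide_0[OF tendsto_const] filterlim_at_top_imp_at_infinity)
  qed
  then show thesis using that bound by blast
qed

text \<open>A quadratic remainder is exactly what perturbing the differential equation in the
  spectral parameter provides.\<close>

lemma has_field_derivative_of_quadratic_bound:
  fixes f :: "complex \<Rightarrow> complex"
  assumes "\<And>h. norm h \<le> 1 \<Longrightarrow> norm (f (x + h) - f x - h * D) \<le> C * (norm h)\<^sup>2"
  shows "(f has_field_derivative D) (at x)"
  unfolding DERIV_def
proof (rule Lim_null_comparison[where g = "\<lambda>h. C * norm h" and f = "\<lambda>h. (f (x + h) - f x) / h - D", unfolded LIM_zero_iff])
  have "eventually (\<lambda>h::complex. h \<in> ball 0 1 - {0}) (at 0)"
    by (rule eventually_at_in_open) auto
  then show "\<forall>\<^sub>F h in at 0. norm ((f (x + h) - f x) / h - D) \<le> C * norm h"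
  proof eventually_elim
    case (elim h)
    then have h: "h \<noteq> 0" "norm h \<le> 1" by auto
    have "norm ((f (x + h) - f x) / h - D) = norm (f (x + h) - f x - h * D) / norm h"
      using h by (simp add: norm_divide[symmetric] diff_divide_distrib)
    also have "\<dots> \<le> C * (norm h)\<^sup>2 / norm h"
      using assms[OF h(2)] by (rule divide_right_mono) simp
    finally show ?case using h by (simp add: power2_eq_square)
  qed
  show "((\<lambda>h. C * norm h) \<longlongrightarrow> 0) (at (0::complex))"
    by (auto intro!: tendsto_eq_intros)
qed

section \<open>The Zakharov-Shabat system\<close>

text \<open>The Zakharov-Shabat matrix plus \<open>\<i> * \<xi>\<close> times the identity. The
  diagonal becomes \<open>2 * \<i> * \<xi>\<close> and 0, so solutions do not grow when
  \<open>Im \<xi> \<ge> 0\<close>.\<close>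

definition zs_rhs :: "complex \<Rightarrow> complex \<Rightarrow> complex \<times> complex \<Rightarrow> complex \<times> complex" where
  "zs_rhs q \<xi> x = (2 * \<i> * \<xi> * fst x + q * snd x, - cnj q * fst x)"

lemma inner_zs_rhs: "inner x (zs_rhs q \<xi> x) = - 2 * Im \<xi> * (norm (fst x))\<^sup>2"
  by (cases x) (simp add: zs_rhs_def inner_complex_def cmod_power2, simp add: algebra_simps power2_eq_square)

lemma inner_zs_rhs_le: "inner x (zs_rhs q \<xi> x) \<le> 2 * max 0 (- Im \<xi>) * (norm x)\<^sup>2"
proof -
  have "(norm (fst x))\<^sup>2 \<le> (norm x)\<^sup>2"
    using norm_fst_le[of "fst x" "snd x"] by (intro power_mono) auto
  then have "(- Im \<xi>) * (norm (fst x))\<^sup>2 \<le> max 0 (- Im \<xi>) * (norm x)\<^sup>2"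
    by (intro mult_mono) auto
  then show ?thesis unfolding inner_zs_rhs by linarith
qed

lemma zs_rhs_diff: "zs_rhs q \<xi> (x - y) = zs_rhs q \<xi> x - zs_rhs q \<xi> y"
  by (simp add: zs_rhs_def algebra_simps)

lemma norm_zs_rhs: "norm (zs_rhs q \<xi> x) \<le> (2 * norm \<xi> + 2 * norm q) * norm x"
proof -
  have f: "norm (fst x) \<le> norm x" and s: "norm (snd x) \<le> norm x"
    using norm_fst_le[of "fst x" "snd x"] norm_snd_le[of "snd x" "fst x"] by auto
  have "norm (zs_rhs q \<xi> x) \<le> norm (2 * \<i> * \<xi> * fst x + q * snd x) + norm (- cnj q * fst x)"
    unfolding zs_rhs_def by (rule norm_Pair_le)
  also have "\<dots> \<le> norm (2 * \<i> * \<xi> * fst x) + norm (q * snd x) + norm (- cnj q * fst x)"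
    by (intro add_right_mono norm_triangle_ineq)
  also have "\<dots> = 2 * norm \<xi> * norm (fst x) + norm q * norm (snd x) + norm q * norm (fst x)"
    by (simp add: norm_mult)
  also have "\<dots> \<le> 2 * norm \<xi> * norm x + norm q * norm x + norm q * norm x"
    by (intro add_mono mult_left_mono f s) auto
  finally show ?thesis by (simp add: algebra_simps)
qed

section \<open>Solutions on the half-line: existence, growth, analyticity in the spectral
  parameter\<close>

locale half_line_pulse =
  fixes q0 :: "real \<Rightarrow> complex"
  assumes schwartz: "schwartz q0" and support: "\<And>t. t < 0 \<Longrightarrow> q0 t = 0"
begin

lemma rapid_vderiv_iter: "\<exists>K. \<forall>n t. t \<ge> 0 \<longrightarrow> norm (vderiv_iter m q0 t) * (1 + t) ^ n \<le> K n"
proof -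
  let ?f = "vderiv_iter m q0"
  have "\<exists>B. \<forall>t. norm (t ^ k *\<^sub>R ?f t) \<le> B" for k
  proof -
    have "bounded (range (\<lambda>t. t ^ k *\<^sub>R ?f t))"
      using schwartz unfolding schwartz_def by blast
    then show ?thesis unfolding bounded_iff by blast
  qed
  then obtain B where B: "\<And>k t. norm (t ^ k *\<^sub>R ?f t) \<le> B k" by metis
  have "norm (?f t) * (1 + t) ^ n \<le> 2 ^ n * (B 0 + B n)" if t: "t \<ge> 0" for n t
  proof -
    have "(1 + t) ^ n \<le> 2 ^ n * (1 + t ^ n)"
    proof (cases "t \<le> 1")
      case True
      then have "(1 + t) ^ n \<le> 2 ^ n" using t by (intro power_mono) auto
      then show ?thesis using t by (simp add: distrib_left add_increasing2)
    next
      case False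
      then have "(1 + t) ^ n \<le> (2 * t) ^ n" using t by (intro power_mono) auto
      then show ?thesis using t by (simp add: distrib_left power_mult_distrib add_increasing)
    qed
    then have "norm (?f t) * (1 + t) ^ n \<le> norm (?f t) * (2 ^ n * (1 + t ^ n))"
      by (rule mult_left_mono) simp
    also have "\<dots> = 2 ^ n * (norm (t ^ 0 *\<^sub>R ?f t) + norm (t ^ n *\<^sub>R ?f t))"
      using t by (simp add: algebra_simps)
    also have "\<dots> \<le> 2 ^ n * (B 0 + B n)"
      by (intro mult_left_mono add_mono B) simp
    finally show ?thesis .
  qed
  then show ?thesis by (intro exI[of _ "\<lambda>n. 2 ^ n * (B 0 + B n)"]) blast
qed

definition qK :: "nat \<Rightarrow> real" where
  "qK = (SOME K. \<forall>n t. t \<ge> 0 \<longrightarrow> norm (q0 t) * (1 + t) ^ n \<le> K n)"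

lemma qK: "t \<ge> 0 \<Longrightarrow> norm (q0 t) * (1 + t) ^ n \<le> qK n"
proof -
  have "\<exists>K. \<forall>n t. t \<ge> 0 \<longrightarrow> norm (q0 t) * (1 + t) ^ n \<le> K n"
    using rapid_vderiv_iter[of 0] by (simp add: vderiv_iter_def)
  from someI_ex[OF this] have "\<forall>n t. t \<ge> 0 \<longrightarrow> norm (q0 t) * (1 + t) ^ n \<le> qK n"
    unfolding qK_def .
  then show "t \<ge> 0 \<Longrightarrow> norm (q0 t) * (1 + t) ^ n \<le> qK n" by blast
qed

lemma qK_nonneg: "0 \<le> qK n"
  using order_trans[OF _ qK[of 0 n]] by simp

lemma q0_deriv: "(q0 has_vector_derivative vderiv_iter 1 q0 t) (at t within S)"
proof -
  have "vderiv_iter 0 q0 differentiable (at t)"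
    using schwartz unfolding schwartz_def by blast
  then have "(q0 has_vector_derivative vector_derivative q0 (at t)) (at t)"
    by (simp add: vderiv_iter_def vector_derivative_works)
  then show ?thesis by (auto simp: vderiv_iter_def intro: has_vector_derivative_at_within)
qed

lemma q0_cont: "continuous_on S q0"
  by (rule continuous_on_vector_derivative[OF q0_deriv])

text \<open>Continuity together with vanishing for negative times. This removes a boundary term in
  the decay estimate for large \<open>\<xi>\<close> and lets the solutions be continued through
  \<open>t = 0\<close>.\<close>

lemma q0_0: "q0 0 = 0"
proof -
  have "(q0 \<longlongrightarrow> q0 0) (at_left 0)"
    using q0_cont[of UNIV] by (simp add: continuous_on_def filterlim_at_split)
  moreover have "(q0 \<longlongrightarrow> 0) (at_left 0)"
    by (rule tendsto_eventually) (auto simp: eventually_at_left_field support intro!: exI[of _ "-1"])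
  ultimately show ?thesis using tendsto_unique[OF trivial_limit_at_left_real] by metis
qed

text \<open>The source \<open>g\<close> serves the equation for the derivative with respect to
  \<open>\<xi>\<close>. The parameter of the general existence result is the single point 0.\<close>

lemma zs_exists:
  assumes g: "continuous_on {0..} g"
  obtains X where "X 0 = x0" "\<And>t. t \<ge> 0 \<Longrightarrow> (X has_vector_derivative zs_rhs (q0 t) \<xi> (X t) + g t) (at t within {0..})"
proof -
  let ?S = "{0::real}"
  let ?B = "{0..} \<times> ?S \<times> (UNIV :: (complex \<times> complex) set)"
  define f where "f t (p::real) x = zs_rhs (q0 t) \<xi> x + g t" for t p x
  have "continuous_on ?B (\<lambda>w. q0 (fst w))"
    by (rule continuous_on_compose2[OF q0_cont[of UNIV]]) (auto intro!: continuous_intros)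
  moreover have "continuous_on ?B (\<lambda>w. g (fst w))"
    by (rule continuous_on_compose2[OF g]) (auto intro!: continuous_intros)
  ultimately have c1: "continuous_on ?B (\<lambda>(t, p, x). f t p x)"
    unfolding f_def zs_rhs_def split_def by (intro continuous_intros)
  have c2: "\<exists>L. \<forall>t\<in>{0..T}. \<forall>p\<in>?S. \<forall>x y. norm (f t p x - f t p y) \<le> L * norm (x - y)" for T
  proof -
    have "norm (f t p x - f t p y) \<le> (2 * norm \<xi> + 2 * qK 0) * norm (x - y)" if "t \<in> {0..T}" for t p x y
    proof -
      have "norm (f t p x - f t p y) = norm (zs_rhs (q0 t) \<xi> (x - y))"
        by (simp add: f_def zs_rhs_diff)
      also have "\<dots> \<le> (2 * norm \<xi> + 2 * norm (q0 t)) * norm (x - y)" by (rule norm_zs_rhs)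
      also have "\<dots> \<le> (2 * norm \<xi> + 2 * qK 0) * norm (x - y)"
        using qK[of t 0] that by (intro mult_right_mono) auto
      finally show ?thesis .
    qed
    then show ?thesis by blast
  qed
  obtain X where X: "\<And>p. p \<in> ?S \<Longrightarrow> X 0 p = x0"
    "\<And>t p. t \<ge> 0 \<Longrightarrow> p \<in> ?S \<Longrightarrow> ((\<lambda>s. X s p) has_vector_derivative f t p (X t p)) (at t within {0..})"
    by (rule lipschitz_ode_solution[OF _ c1 c2, of x0]) (auto intro: that)
  show thesis
  proof (rule that[of "\<lambda>s. X s 0"])
    show "X 0 0 = x0" using X(1)[of 0] by simp
    show "((\<lambda>s. X s 0) has_vector_derivative zs_rhs (q0 t) \<xi> (X t 0) + g t) (at t within {0..})" if "t \<ge> 0" for t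
      using X(2)[OF that, of 0] by (simp add: f_def)
  qed
qed

text \<open>\<open>zs \<xi> t\<close> is \<open>exp (\<i> \<xi> t)\<close> times the second column of the solution of the Zakharov-Shabat system
  that equals the identity at \<open>t = 0\<close>.\<close>

definition zs :: "complex \<Rightarrow> real \<Rightarrow> complex \<times> complex" where
  "zs \<xi> = (SOME X. X 0 = (0, 1) \<and>
     (\<forall>t\<ge>0. (X has_vector_derivative zs_rhs (q0 t) \<xi> (X t)) (at t within {0..})))"

lemma zs_spec: "zs \<xi> 0 = (0, 1) \<and>
   (\<forall>t\<ge>0. (zs \<xi> has_vector_derivative zs_rhs (q0 t) \<xi> (zs \<xi> t)) (at t within {0..}))"
proof -
  obtain X where X: "X 0 = (0, 1)" "\<And>t. t \<ge> 0 \<Longrightarrow> (X has_vector_derivative zs_rhs (q0 t) \<xi> (X t) + 0) (at t within {0..})"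
    by (rule zs_exists[of "\<lambda>_. 0" "(0, 1)" \<xi>]) (auto intro: that)
  show ?thesis
    unfolding zs_def by (rule someI[of _ X]) (use X in auto)
qed

lemma zs_0: "zs \<xi> 0 = (0, 1)"
  using zs_spec by blast

lemma zs_deriv: "t \<ge> 0 \<Longrightarrow> (zs \<xi> has_vector_derivative zs_rhs (q0 t) \<xi> (zs \<xi> t)) (at t within {0..})"
  using zs_spec by blast

lemma zs_deriv_sub: "t \<in> {a..b} \<Longrightarrow> a \<ge> 0 \<Longrightarrow> (zs \<xi> has_vector_derivative zs_rhs (q0 t) \<xi> (zs \<xi> t)) (at t within {a..b})"
  by (rule has_vector_derivative_within_subset[OF zs_deriv]) auto

lemma zs_cont: "continuous_on {0..} (zs \<xi>)"
  by (rule continuous_on_vector_derivative[OF zs_deriv]) auto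

lemma norm_zs: assumes t: "t \<ge> 0" shows "norm (zs \<xi> t) \<le> exp (2 * max 0 (- Im \<xi>) * t)"
proof -
  have "norm (zs \<xi> t) \<le> (norm (zs \<xi> 0) + 0 * t) * exp (2 * max 0 (- Im \<xi>) * t)"
  proof (rule gronwall_norm[OF t _ _ zs_deriv_sub])
    fix s
    show "inner (zs \<xi> s) (zs_rhs (q0 s) \<xi> (zs \<xi> s)) \<le> norm (zs \<xi> s) * (2 * max 0 (- Im \<xi>) * norm (zs \<xi> s) + 0)"
      using inner_zs_rhs_le[of "zs \<xi> s" "q0 s" \<xi>] by (simp add: power2_eq_square algebra_simps)
  qed auto
  then show ?thesis by (simp add: zs_0 norm_Pair)
qed

lemma norm_zs_upper: "t \<ge> 0 \<Longrightarrow> Im \<xi> \<ge> 0 \<Longrightarrow> norm (zs \<xi> t) \<le> 1"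
  using norm_zs[of t \<xi>] by (simp add: max_absorb1)

lemma norm_zs_abs: assumes "t \<ge> 0" "\<bar>Im \<xi>\<bar> \<le> B" shows "norm (zs \<xi> t) \<le> exp (2 * B * t)"
proof -
  have "2 * max 0 (- Im \<xi>) * t \<le> 2 * B * t"
    using assms by (intro mult_right_mono) auto
  with norm_zs[OF assms(1), of \<xi>] show ?thesis by (meson exp_le_cancel_iff order_trans)
qed

text \<open>The candidate derivative \<open>D\<close> is the value at \<open>T\<close> of the
  solution of the variational equation. The first difference obeys the same equation with a source
  of order h, hence is of order h; after subtracting the candidate the source is h times that
  difference, of order h squared.\<close>

lemma zs_differentiable:
  assumes T: "T \<ge> 0"
  obtains D C where "\<And>h. norm h \<le> 1 \<Longrightarrow>
    norm (zs (\<xi> + h) T - zs \<xi> T - (h * fst D, h * snd D)) \<le> C * (norm h)\<^sup>2"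
proof -
  have gc: "continuous_on {0..} (\<lambda>t. (2 * \<i> * fst (zs \<xi> t), 0 :: complex))"
    by (intro continuous_intros zs_cont)
  obtain Y where Y0: "Y 0 = 0" and Y: "\<And>t. t \<ge> 0 \<Longrightarrow>
      (Y has_vector_derivative zs_rhs (q0 t) \<xi> (Y t) + (2 * \<i> * fst (zs \<xi> t), 0)) (at t within {0..})"
    by (rule zs_exists[OF gc, of 0 \<xi>]) (rule that)
  define L where "L = 2 * max 0 (- Im \<xi>)"
  have L0: "L \<ge> 0" by (simp add: L_def)
  \<comment> \<open>Bounds the perturbed solution on \<open>{0..T}\<close> for all
    \<open>norm h \<le> 1\<close> at once; the summand 1 covers the shift of the imaginary
    part.\<close>
  define E where "E = exp (2 * (\<bar>Im \<xi>\<bar> + 1) * T)"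
  have E0: "E \<ge> 0" by (simp add: E_def)
  define C1 where "C1 = 2 * E * T * exp (L * T)"
  have C10: "C1 \<ge> 0" using E0 T by (simp add: C1_def)
  have gr: "norm (x S) \<le> K * S * exp (L * S)"
    if S: "0 \<le> S" and K: "0 \<le> K" and x0: "x 0 = 0"
      and x: "\<And>t. t \<in> {0..S} \<Longrightarrow> (x has_vector_derivative zs_rhs (q0 t) \<xi> (x t) + (g t, 0)) (at t within {0..S})"
      and g: "\<And>t. t \<in> {0..S} \<Longrightarrow> norm (g t) \<le> K" for x g K S
  proof -
    have "norm (x S) \<le> (norm (x 0) + K * S) * exp (L * S)"
    proof (rule gronwall_norm[OF S L0 K x])
      fix t assume t: "t \<in> {0..S}"
      have "inner (x t) (g t, 0) \<le> norm (x t) * norm (g t)"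
        using norm_cauchy_schwarz[of "x t" "(g t, 0)"] by (simp add: norm_Pair)
      also have "\<dots> \<le> norm (x t) * K" by (intro mult_left_mono g t) simp
      finally show "inner (x t) (zs_rhs (q0 t) \<xi> (x t) + (g t, 0)) \<le> norm (x t) * (L * norm (x t) + K)"
        using inner_zs_rhs_le[of "x t" "q0 t" \<xi>]
        by (simp add: inner_add_right L_def power2_eq_square algebra_simps)
    qed
    then show ?thesis by (simp add: x0)
  qed
  have "norm (zs (\<xi> + h) T - zs \<xi> T - (h * fst (Y T), h * snd (Y T))) \<le> (2 * C1 * T * exp (L * T)) * (norm h)\<^sup>2"
    if h: "norm h \<le> 1" for h
  proof -
    define e where "e s = zs (\<xi> + h) s - zs \<xi> s" for s
    have e': "(e has_vector_derivative zs_rhs (q0 t) \<xi> (e t) + (2 * \<i> * h * fst (zs (\<xi> + h) t), 0)) (at t within {0..S})"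
      if "t \<in> {0..S}" for t S
    proof -
      have "zs_rhs (q0 t) (\<xi> + h) (zs (\<xi> + h) t) - zs_rhs (q0 t) \<xi> (zs \<xi> t) =
          zs_rhs (q0 t) \<xi> (e t) + (2 * \<i> * h * fst (zs (\<xi> + h) t), 0)"
        by (simp add: e_def zs_rhs_def algebra_simps)
      with has_vector_derivative_diff[OF zs_deriv_sub[OF that order_refl] zs_deriv_sub[OF that order_refl], of "\<xi> + h" \<xi>]
      show ?thesis by (simp add: e_def[abs_def])
    qed
    have e0: "e 0 = 0" by (simp add: e_def zs_0)
    have eb: "norm (e s) \<le> C1 * norm h" if s: "s \<in> {0..T}" for s
    proof -
      have "norm (e s) \<le> (2 * norm h * E) * s * exp (L * s)"
      proof (rule gr[OF _ _ e0 e'])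
        fix t assume t: "t \<in> {0..s}"
        have "norm (zs (\<xi> + h) t) \<le> exp (2 * (\<bar>Im \<xi>\<bar> + 1) * t)"
          using t h abs_Im_le_cmod[of h] by (intro norm_zs_abs) auto
        also have "\<dots> \<le> E" unfolding E_def using t s by (auto intro!: mult_left_mono)
        finally have "norm (fst (zs (\<xi> + h) t)) \<le> E"
          using norm_fst_le[of "fst (zs (\<xi> + h) t)" "snd (zs (\<xi> + h) t)"] by simp
        then show "norm (2 * \<i> * h * fst (zs (\<xi> + h) t)) \<le> 2 * norm h * E"
          by (simp add: norm_mult mult_left_mono)
      qed (use s E0 in auto)
      also have "\<dots> \<le> (2 * norm h * E) * T * exp (L * T)"
        using s E0 L0 by (intro mult_mono) (auto intro: mult_left_mono)
      finally show ?thesis by (simp add: C1_def algebra_simps)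
    qed
    define d where "d s = e s - (h * fst (Y s), h * snd (Y s))" for s
    have hY: "((\<lambda>s. (h * fst (Y s), h * snd (Y s))) has_vector_derivative
        (h * fst (zs_rhs (q0 t) \<xi> (Y t) + (2 * \<i> * fst (zs \<xi> t), 0)), h * snd (zs_rhs (q0 t) \<xi> (Y t) + (2 * \<i> * fst (zs \<xi> t), 0)))) (at t within {0..T})"
      if "t \<in> {0..T}" for t
    proof -
      have "bounded_linear (\<lambda>x::complex \<times> complex. (h * fst x, h * snd x))"
        by (intro bounded_linear_intros)
      from bounded_linear.has_vector_derivative[OF this has_vector_derivative_within_subset[OF Y]]
      show ?thesis using that by auto
    qed
    have d': "(d has_vector_derivative zs_rhs (q0 t) \<xi> (d t) + (2 * \<i> * h * fst (e t), 0)) (at t within {0..T})"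
      if "t \<in> {0..T}" for t
    proof -
      have "zs_rhs (q0 t) \<xi> (e t) + (2 * \<i> * h * fst (zs (\<xi> + h) t), 0) -
         (h * fst (zs_rhs (q0 t) \<xi> (Y t) + (2 * \<i> * fst (zs \<xi> t), 0)), h * snd (zs_rhs (q0 t) \<xi> (Y t) + (2 * \<i> * fst (zs \<xi> t), 0)))
         = zs_rhs (q0 t) \<xi> (d t) + (2 * \<i> * h * fst (e t), 0)"
        by (simp add: e_def d_def zs_rhs_def algebra_simps)
      with has_vector_derivative_diff[OF e'[OF that] hY[OF that]]
      show ?thesis by (simp only: d_def[abs_def])
    qed
    have "norm (d T) \<le> (2 * norm h * (C1 * norm h)) * T * exp (L * T)"
    proof (rule gr[OF T _ _ d'])
      show "d 0 = 0" by (simp add: d_def e0 Y0 zero_prod_def)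
      fix t assume t: "t \<in> {0..T}"
      have "norm (fst (e t)) \<le> C1 * norm h"
        using eb[OF t] norm_fst_le[of "fst (e t)" "snd (e t)"] by simp
      then show "norm (2 * \<i> * h * fst (e t)) \<le> 2 * norm h * (C1 * norm h)"
        by (simp add: norm_mult mult_left_mono)
    qed (use C10 in auto)
    then show ?thesis by (simp add: d_def e_def power2_eq_square algebra_simps)
  qed
  then show thesis by (rule that)
qed

lemma zs_holomorphic:
  assumes T: "T \<ge> 0"
  shows "(\<lambda>\<xi>. fst (zs \<xi> T)) holomorphic_on S" "(\<lambda>\<xi>. snd (zs \<xi> T)) holomorphic_on S"
proof -
  have "\<exists>a. ((\<lambda>\<xi>. fst (zs \<xi> T)) has_field_derivative a) (at \<xi>) \<and> (\<exists>b. ((\<lambda>\<xi>. snd (zs \<xi> T)) has_field_derivative b) (at \<xi>))" for \<xi>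
  proof -
    obtain D C where DC: "\<And>h. norm h \<le> 1 \<Longrightarrow>
        norm (zs (\<xi> + h) T - zs \<xi> T - (h * fst D, h * snd D)) \<le> C * (norm h)\<^sup>2"
      using zs_differentiable[OF T, of \<xi>] by blast
    have "norm (fst (zs (\<xi> + h) T) - fst (zs \<xi> T) - h * fst D) \<le> C * (norm h)\<^sup>2"
      and "norm (snd (zs (\<xi> + h) T) - snd (zs \<xi> T) - h * snd D) \<le> C * (norm h)\<^sup>2" if "norm h \<le> 1" for h
    proof -
      let ?u = "fst (zs (\<xi> + h) T) - fst (zs \<xi> T) - h * fst D"
      let ?v = "snd (zs (\<xi> + h) T) - snd (zs \<xi> T) - h * snd D"
      have "zs (\<xi> + h) T - zs \<xi> T - (h * fst D, h * snd D) = (?u, ?v)"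
        by (simp add: prod_eq_iff)
      with DC[OF that] have "norm (?u, ?v) \<le> C * (norm h)\<^sup>2" by simp
      then show "norm ?u \<le> C * (norm h)\<^sup>2" "norm ?v \<le> C * (norm h)\<^sup>2"
        using norm_fst_le[of ?u ?v] norm_snd_le[of ?v ?u] by linarith+
    qed
    then show ?thesis
      by (intro exI conjI has_field_derivative_of_quadratic_bound) blast+
  qed
  then show "(\<lambda>\<xi>. fst (zs \<xi> T)) holomorphic_on S" "(\<lambda>\<xi>. snd (zs \<xi> T)) holomorphic_on S"
    unfolding holomorphic_on_def field_differentiable_def by (blast intro: has_field_derivative_at_within)+
qed

end

text \<open>Extended by 0 to the lower half-plane, the difference is continuous and holomorphic off
  the real line, hence entire. It vanishes on an open set, hence everywhere.\<close>

lemma upper_half_plane_extension_unique: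
  assumes F: "continuous_on {w. Im w \<ge> 0} F" "F analytic_on {w. Im w > 0}"
    and G: "continuous_on {w. Im w \<ge> 0} G" "G analytic_on {w. Im w > 0}"
    and eq: "\<And>x. F (complex_of_real x) = G (of_real x)" and w: "Im w \<ge> 0"
  shows "F w = G w"
proof -
  define h where "h w = (if Im w \<ge> 0 then F w - G w else 0)" for w
  have "continuous_on ({w. Im w \<ge> 0} \<union> {w. Im w \<le> 0}) h"
    unfolding h_def
  proof (rule continuous_on_cases)
    show "closed {w. Im w \<ge> 0}" "closed {w. Im w \<le> 0}"
      by (simp_all add: closed_halfspace_Im_ge closed_halfspace_Im_le)
    show "continuous_on {w. Im w \<ge> 0} (\<lambda>w. F w - G w)" by (intro continuous_intros F G)
    show "\<forall>w. w \<in> {w. Im w \<ge> 0} \<and> \<not> Im w \<ge> 0 \<or> w \<in> {w. Im w \<le> 0} \<and> Im w \<ge> 0 \<longrightarrow> F w - G w = 0"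
    proof (intro allI impI)
      fix w assume "w \<in> {w. Im w \<ge> 0} \<and> \<not> Im w \<ge> 0 \<or> w \<in> {w. Im w \<le> 0} \<and> Im w \<ge> 0"
      then have "w = of_real (Re w)" by (auto simp: complex_eq_iff)
      then show "F w - G w = 0" using eq[of "Re w"] by simp
    qed
  qed simp
  moreover have "{w. Im w \<ge> 0} \<union> {w. Im w \<le> 0} = UNIV" by auto
  ultimately have hc: "continuous_on UNIV h" by simp
  have "h holomorphic_on UNIV"
  proof (rule holomorphic_on_paste_across_line[of _ "\<i>" _ 0])
    have "(\<lambda>w. F w - G w) holomorphic_on {w. Im w > 0}"
      using F(2) G(2) by (intro holomorphic_on_diff analytic_imp_holomorphic)
    then show "h holomorphic_on UNIV \<inter> {z. 0 < \<i> \<bullet> z}"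
      by (rule holomorphic_transform[THEN holomorphic_on_subset]) (auto simp: h_def inner_complex_def)
    show "h holomorphic_on UNIV \<inter> {z. \<i> \<bullet> z < 0}"
      by (rule holomorphic_transform[of "\<lambda>_. 0"]) (auto simp: h_def inner_complex_def)
  qed (auto simp: hc)
  moreover have h_neg: "h z = 0" if "Im z < 0" for z using that by (simp add: h_def)
  ultimately have "h w = 0"
    using analytic_continuation_open[of "{w. Im w < 0}" UNIV h "\<lambda>_. 0" w]
      open_halfspace_Im_lt[of 0] exI[of "\<lambda>w. Im w < 0" "- \<i>"] h_neg
    by (simp add: connected_UNIV)
  then show ?thesis using w by (simp add: h_def)
qed

section \<open>Two by two matrices and uniqueness of the Jost solution\<close>

definition mat2 :: "complex \<times> complex \<times> complex \<times> complex \<Rightarrow> complex^2^2" where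
  "mat2 x = (case x of (a, b, c, d) \<Rightarrow> vector [vector [a, b], vector [c, d]])"

lemma bounded_linear_mat2: "bounded_linear mat2"
proof -
  have "linear mat2"
    by (rule linearI) (auto simp: mat2_def vec_eq_iff forall_2)
  then show ?thesis by (simp add: linear_conv_bounded_linear)
qed

lemma mat2_nth [simp]:
  "mat2 (a, b, c, d) $ 1 $ 1 = a" "mat2 (a, b, c, d) $ 1 $ 2 = b"
  "mat2 (a, b, c, d) $ 2 $ 1 = c" "mat2 (a, b, c, d) $ 2 $ 2 = d"
  by (simp_all add: mat2_def)

lemma mat2_cases: "A = mat2 (A $ 1 $ 1, A $ 1 $ 2, A $ 2 $ 1, A $ 2 $ 2)"
  by (simp add: mat2_def vec_eq_iff forall_2)

lemma mat2_mult: "mat2 (a, b, c, d) ** mat2 (a', b', c', d') =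
    mat2 (a * a' + b * c', a * b' + b * d', c * a' + d * c', c * b' + d * d')"
  by (simp add: vec_eq_iff forall_2 matrix_matrix_mult_def sum_2)

lemma zs_matrix_mat2: "zs_matrix q0 \<xi> t = mat2 (\<i> * of_real \<xi>, q0 t, - cnj (q0 t), - (\<i> * of_real \<xi>))"
  by (simp add: zs_matrix_def mat2_def)

lemma exp_sigma3_mat2: "exp_sigma3 w = mat2 (exp w, 0, 0, exp (- w))"
  by (simp add: exp_sigma3_def mat2_def)

lemma matrix_diff_ldistrib:
  fixes A :: "'a::ring_1 ^ 'n ^ 'm"
  shows "A ** (B - C) = A ** B - A ** C"
  using matrix_add_ldistrib[of A "B - C" C] by (simp add: algebra_simps)

text \<open>For real \<open>\<xi>\<close> the system is skew-Hermitian, so each column of the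
  difference of two solutions has constant length. As this difference tends to 0 at infinity, the
  length is 0.\<close>

lemma is_jost_plus_unique:
  assumes "is_jost_plus q0 \<xi> \<phi>" "is_jost_plus q0 \<xi> \<psi>"
  shows "\<phi> = \<psi>"
proof
  fix t
  define \<delta> where "\<delta> s = \<phi> s - \<psi> s" for s
  define x where "x j s = (\<delta> s $ 1 $ j, \<delta> s $ 2 $ j)" for j s
  have lim: "(\<delta> \<longlongrightarrow> 0) at_top"
  proof -
    have "((\<lambda>t. (\<phi> t - exp_sigma3 (\<i> * complex_of_real (\<xi> * t))) - (\<psi> t - exp_sigma3 (\<i> * complex_of_real (\<xi> * t)))) \<longlongrightarrow> 0 - 0) at_top"
      using assms unfolding is_jost_plus_def by (intro tendsto_diff) auto
    then show ?thesis by (simp add: \<delta>_def[abs_def])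
  qed
  have bl: "bounded_linear (\<lambda>A::complex^2^2. (A $ 1 $ j, A $ 2 $ j))" for j
    by (intro bounded_linear_Pair bounded_linear_compose[OF bounded_linear_vec_nth bounded_linear_vec_nth])
  have d: "(\<delta> has_vector_derivative zs_matrix q0 \<xi> s ** \<delta> s) (at s)" for s
  proof -
    have "(\<delta> has_vector_derivative zs_matrix q0 \<xi> s ** \<phi> s - zs_matrix q0 \<xi> s ** \<psi> s) (at s)"
      unfolding \<delta>_def using assms unfolding is_jost_plus_def by (intro has_vector_derivative_diff) auto
    then show ?thesis by (simp add: \<delta>_def matrix_diff_ldistrib)
  qed
  have x': "(x j has_vector_derivative
      (\<i> * of_real \<xi> * fst (x j s) + q0 s * snd (x j s), - cnj (q0 s) * fst (x j s) - \<i> * of_real \<xi> * snd (x j s))) (at s)" for j s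
  proof -
    have "((zs_matrix q0 \<xi> s ** \<delta> s) $ 1 $ j, (zs_matrix q0 \<xi> s ** \<delta> s) $ 2 $ j) =
      (\<i> * of_real \<xi> * fst (x j s) + q0 s * snd (x j s), - cnj (q0 s) * fst (x j s) - \<i> * of_real \<xi> * snd (x j s))"
      by (simp add: zs_matrix_mat2 matrix_matrix_mult_def sum_2 x_def)
    with bounded_linear.has_vector_derivative[OF bl d, of j s] show ?thesis
      by (simp add: x_def[abs_def])
  qed
  define x' where "x' j s = (\<i> * of_real \<xi> * fst (x j s) + q0 s * snd (x j s), - cnj (q0 s) * fst (x j s) - \<i> * of_real \<xi> * snd (x j s))" for j s
  note dx = has_vector_derivative_at_within[OF x'[folded x'_def]]
  have "inner (x j s) (x' j s) = 0" for j s
    by (cases "x j s") (simp add: x'_def inner_complex_def algebra_simps)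
  moreover have "((\<lambda>s. inner (x j s) (x j s)) has_vector_derivative inner (x j s) (x' j s) + inner (x' j s) (x j s)) (at s within {a..b})" for j s a b
    by (rule bounded_bilinear.has_vector_derivative[OF bounded_bilinear_inner dx dx])
  ultimately have "((\<lambda>s. inner (x j s) (x j s)) has_vector_derivative 0) (at s within {a..b})" for j s a b
    by (simp add: inner_commute)
  then have c: "inner (x j b) (x j b) = inner (x j a) (x j a)" if "a \<le> b" for j a b
    by (intro zero_vector_derivative_imp_eq[OF that])
  have x0: "x j t = 0" for j
  proof -
    have "((\<lambda>s. inner (x j s) (x j s)) \<longlongrightarrow> inner (0::complex \<times> complex) 0) at_top"
    proof (intro tendsto_inner)
      have "((\<lambda>s. (\<delta> s $ 1 $ j, \<delta> s $ 2 $ j)) \<longlongrightarrow> ((0::complex^2^2) $ 1 $ j, (0::complex^2^2) $ 2 $ j)) at_top"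
        by (rule bounded_linear.tendsto[OF bl lim])
      then show "(x j \<longlongrightarrow> 0) at_top" "(x j \<longlongrightarrow> 0) at_top" by (simp_all add: x_def[abs_def] zero_prod_def)
    qed
    moreover have "((\<lambda>s. inner (x j s) (x j s)) \<longlongrightarrow> inner (x j t) (x j t)) at_top"
      by (rule tendsto_eventually) (use c in \<open>auto simp: eventually_at_top_linorder\<close>)
    ultimately have "inner (x j t) (x j t) = inner (0::complex \<times> complex) 0"
      using tendsto_unique[OF trivial_limit_at_top_linorder] by metis
    then show ?thesis by simp
  qed
  have "\<delta> t $ i $ j = 0" for i j
    using x0[of j] exhaust_2[of i] by (auto simp: x_def zero_prod_def)
  then show "\<phi> t = \<psi> t" by (simp add: \<delta>_def vec_eq_iff)
qed

section \<open>Limits as t tends to infinity: the scattering coefficients\<close>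

context half_line_pulse
begin

lemma fst_zs_deriv: "t \<in> {a..b} \<Longrightarrow> a \<ge> 0 \<Longrightarrow>
    ((\<lambda>t. fst (zs \<xi> t)) has_vector_derivative 2 * \<i> * \<xi> * fst (zs \<xi> t) + q0 t * snd (zs \<xi> t)) (at t within {a..b})"
  and snd_zs_deriv: "t \<in> {a..b} \<Longrightarrow> a \<ge> 0 \<Longrightarrow>
    ((\<lambda>t. snd (zs \<xi> t)) has_vector_derivative - cnj (q0 t) * fst (zs \<xi> t)) (at t within {a..b})"
  using bounded_linear.has_vector_derivative[OF bounded_linear_fst zs_deriv_sub[of t a b \<xi>]]
    bounded_linear.has_vector_derivative[OF bounded_linear_snd zs_deriv_sub[of t a b \<xi>]]
  by (simp_all add: zs_rhs_def)

lemma snd_zs_deriv': "t \<ge> 0 \<Longrightarrow>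
    ((\<lambda>t. snd (zs \<xi> t)) has_vector_derivative - cnj (q0 t) * fst (zs \<xi> t)) (at t within {0..})"
  using bounded_linear.has_vector_derivative[OF bounded_linear_snd zs_deriv[of t \<xi>]]
  by (simp add: zs_rhs_def)

lemma norm_fst_zs_le: "norm (fst (zs \<xi> t)) \<le> norm (zs \<xi> t)" and norm_snd_zs_le: "norm (snd (zs \<xi> t)) \<le> norm (zs \<xi> t)"
  using norm_fst_le[of "fst (zs \<xi> t)" "snd (zs \<xi> t)"] norm_snd_le[of "snd (zs \<xi> t)" "fst (zs \<xi> t)"] by simp_all

text \<open>The first component does not converge for nonzero real \<open>\<xi>\<close> in general;
  dividing out its free oscillation leaves a function whose derivative decays like
  \<open>q0\<close>.\<close>

definition osc :: "complex \<Rightarrow> real \<Rightarrow> complex" where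
  "osc \<xi> t = exp (- (2 * \<i> * \<xi> * of_real t)) * fst (zs \<xi> t)"

lemma osc_deriv: assumes "t \<ge> 0"
  shows "(osc \<xi> has_vector_derivative exp (- (2 * \<i> * \<xi> * of_real t)) * (q0 t * snd (zs \<xi> t))) (at t within {0..})"
proof -
  have e: "((\<lambda>t. exp (- (2 * \<i> * \<xi> * of_real t))) has_vector_derivative - (2 * \<i> * \<xi>) * exp (- (2 * \<i> * \<xi> * of_real t))) (at t within {0..})"
  proof -
    have "((\<lambda>w. exp (- (2 * \<i> * \<xi> * w))) has_field_derivative - (2 * \<i> * \<xi>) * exp (- (2 * \<i> * \<xi> * of_real t))) (at (of_real t) within of_real ` {0..})"
      by (auto intro!: derivative_eq_intros)
    moreover have "((\<lambda>t. of_real t :: complex) has_vector_derivative 1) (at t within {0..})"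
      by (auto intro!: derivative_eq_intros)
    ultimately show ?thesis
      using field_vector_diff_chain_within by (fastforce simp: o_def)
  qed
  have "((\<lambda>t. fst (zs \<xi> t)) has_vector_derivative 2 * \<i> * \<xi> * fst (zs \<xi> t) + q0 t * snd (zs \<xi> t)) (at t within {0..})"
    using bounded_linear.has_vector_derivative[OF bounded_linear_fst zs_deriv[OF assms, of \<xi>]]
    by (simp add: zs_rhs_def)
  from has_vector_derivative_mult[OF e this] show ?thesis
    unfolding osc_def by (simp add: algebra_simps)
qed

text \<open>\<open>sa\<close> turns out to be \<open>S11\<close> on the closed upper half-plane.
  With the conjugate in \<open>sb\<close>, the pair \<open>(sa \<xi>, sb \<xi>)\<close> is the first
  column of the Jost solution at \<open>t = 0\<close>.\<close>

definition sa :: "complex \<Rightarrow> complex" where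
  "sa \<xi> = Lim at_top (\<lambda>t. snd (zs \<xi> t))"

definition sb :: "real \<Rightarrow> complex" where
  "sb x = cnj (Lim at_top (osc (of_real x)))"

text \<open>The derivative is at most \<open>norm (q0 t)\<close>, because the solution has norm at
  most 1 here. The rate does not depend on \<open>\<xi>\<close>, which makes \<open>sa\<close>
  continuous up to the real line and holomorphic above it.\<close>

lemma snd_zs_limit:
  assumes "Im \<xi> \<ge> 0"
  shows "((\<lambda>t. snd (zs \<xi> t)) \<longlongrightarrow> sa \<xi>) at_top"
    and "t \<ge> 0 \<Longrightarrow> norm (snd (zs \<xi> t) - sa \<xi>) * (1 + t) ^ n \<le> qK (n + 2)"
proof -
  have b: "norm (- cnj (q0 t) * fst (zs \<xi> t)) * (1 + t) ^ n \<le> qK n" if t: "t \<ge> 0" for n t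
  proof -
    have "norm (- cnj (q0 t) * fst (zs \<xi> t)) \<le> norm (q0 t) * 1"
      using norm_zs_upper[OF t assms] norm_fst_zs_le[of \<xi> t] by (simp add: norm_mult mult_left_le)
    then have "norm (- cnj (q0 t) * fst (zs \<xi> t)) * (1 + t) ^ n \<le> norm (q0 t) * (1 + t) ^ n"
      using t by (intro mult_right_mono) auto
    then show ?thesis using qK[OF t, of n] by linarith
  qed
  obtain l where l: "((\<lambda>t. snd (zs \<xi> t)) \<longlongrightarrow> l) at_top"
    and l2: "\<And>n t. t \<ge> 0 \<Longrightarrow> norm (snd (zs \<xi> t) - l) * (1 + t) ^ n \<le> qK (n + 2)"
    by (rule rapid_limit[OF snd_zs_deriv' b], assumption, assumption, rule that)
  have "sa \<xi> = l" unfolding sa_def by (rule tendsto_Lim[OF _ l]) simp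
  with l l2 show "((\<lambda>t. snd (zs \<xi> t)) \<longlongrightarrow> sa \<xi>) at_top"
    "t \<ge> 0 \<Longrightarrow> norm (snd (zs \<xi> t) - sa \<xi>) * (1 + t) ^ n \<le> qK (n + 2)" by auto
qed

lemma osc_limit:
  shows "(osc (of_real x) \<longlongrightarrow> cnj (sb x)) at_top"
    and "t \<ge> 0 \<Longrightarrow> norm (osc (of_real x) t - cnj (sb x)) * (1 + t) ^ n \<le> qK (n + 2)"
proof -
  let ?f' = "\<lambda>t. exp (- (2 * \<i> * of_real x * of_real t)) * (q0 t * snd (zs (of_real x) t))"
  have b: "norm (?f' t) * (1 + t) ^ n \<le> qK n" if t: "t \<ge> 0" for n t
  proof -
    have "norm (?f' t) \<le> norm (q0 t) * 1"
      using norm_zs_upper[OF t, of "of_real x"] norm_snd_zs_le[of "of_real x" t] by (simp add: norm_mult mult_left_le)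
    then have "norm (?f' t) * (1 + t) ^ n \<le> norm (q0 t) * (1 + t) ^ n"
      using t by (intro mult_right_mono) auto
    then show ?thesis using qK[OF t, of n] by linarith
  qed
  obtain l where l: "(osc (of_real x) \<longlongrightarrow> l) at_top"
    and l2: "\<And>n t. t \<ge> 0 \<Longrightarrow> norm (osc (of_real x) t - l) * (1 + t) ^ n \<le> qK (n + 2)"
    by (rule rapid_limit[OF osc_deriv b], assumption, assumption, rule that)
  have "Lim at_top (osc (of_real x)) = l" by (rule tendsto_Lim[OF _ l]) simp
  then have "cnj (sb x) = l" by (simp add: sb_def)
  with l l2 show "(osc (of_real x) \<longlongrightarrow> cnj (sb x)) at_top"
    "t \<ge> 0 \<Longrightarrow> norm (osc (of_real x) t - cnj (sb x)) * (1 + t) ^ n \<le> qK (n + 2)" by auto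
qed

lemma norm_zs_real: assumes "t \<ge> 0" shows "(norm (fst (zs (of_real x) t)))\<^sup>2 + (norm (snd (zs (of_real x) t)))\<^sup>2 = 1"
proof -
  let ?f = "zs (of_real x)"
  have i: "inner (?f s) (zs_rhs (q0 s) (of_real x) (?f s)) = 0" for s
    by (simp add: inner_zs_rhs)
  have "((\<lambda>s. inner (?f s) (?f s)) has_vector_derivative 0) (at s within {0..t})" if s: "s \<in> {0..t}" for s
    using bounded_bilinear.has_vector_derivative[OF bounded_bilinear_inner zs_deriv_sub[OF s order_refl] zs_deriv_sub[OF s order_refl], of "of_real x" "of_real x"] i[of s]
    by (simp add: inner_commute)
  from zero_vector_derivative_imp_eq[OF assms this]
  have "inner (?f t) (?f t) = 1" by (simp add: zs_0)
  then show ?thesis by (cases "?f t") (simp add: power2_norm_eq_inner)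
qed

lemma norm_osc_real: "norm (osc (of_real x) t) = norm (fst (zs (of_real x) t))"
  by (simp add: osc_def norm_mult)

lemma sa_sb: "(norm (sa (of_real x)))\<^sup>2 + (norm (sb x))\<^sup>2 = 1"
proof -
  have "((\<lambda>t. (norm (snd (zs (of_real x) t)))\<^sup>2 + (norm (osc (of_real x) t))\<^sup>2) \<longlongrightarrow>
      (norm (sa (of_real x)))\<^sup>2 + (norm (cnj (sb x)))\<^sup>2) at_top"
    by (intro tendsto_intros snd_zs_limit osc_limit) simp
  moreover have "((\<lambda>t. (norm (snd (zs (of_real x) t)))\<^sup>2 + (norm (osc (of_real x) t))\<^sup>2) \<longlongrightarrow> 1) at_top"
    by (rule tendsto_eventually)
      (use norm_zs_real[of _ x] in \<open>auto simp: eventually_at_top_linorder norm_osc_real add.commute intro!: exI[of _ 0]\<close>)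
  ultimately show ?thesis using tendsto_unique[OF trivial_limit_at_top_linorder] by fastforce
qed

lemma sa_uniform_limit: "uniform_limit {w. Im w \<ge> 0} (\<lambda>m w. snd (zs w (real m))) sa sequentially"
proof (rule uniform_limitI)
  fix e :: real assume e: "e > 0"
  obtain N :: nat where N: "real N > qK 3 / e" using reals_Archimedean2 by blast
  show "\<forall>\<^sub>F m in sequentially. \<forall>w\<in>{w. Im w \<ge> 0}. dist (snd (zs w (real m))) (sa w) < e"
    using eventually_ge_at_top[of N]
  proof eventually_elim
    case (elim m)
    show ?case
    proof
      fix w assume "w \<in> {w. Im w \<ge> 0}"
      then have "norm (snd (zs w (real m)) - sa w) * (1 + real m) \<le> qK 3"
        using snd_zs_limit(2)[of w "real m" 1] by (simp add: numeral_3_eq_3)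
      also have "\<dots> < e * (1 + real m)"
      proof -
        have "qK 3 < e * real N" using N e by (simp add: pos_divide_less_eq mult.commute)
        also have "\<dots> \<le> e * (1 + real m)" using elim e by (intro mult_left_mono) auto
        finally show ?thesis .
      qed
      finally have "norm (snd (zs w (real m)) - sa w) < e"
        by (simp add: mult_less_cancel_right)
      then show "dist (snd (zs w (real m))) (sa w) < e" by (simp add: dist_norm)
    qed
  qed
qed

lemma sa_cont: "continuous_on {w. Im w \<ge> 0} sa"
  by (rule uniform_limit_theorem[OF _ sa_uniform_limit])
    (auto intro!: always_eventually holomorphic_on_imp_continuous_on zs_holomorphic)

lemma sa_holomorphic: "sa holomorphic_on {w. Im w > 0}"
proof (rule holomorphic_uniform_sequence[where f = "\<lambda>m w. snd (zs w (real m))"])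
  show op: "open {w. Im w > 0}" by (rule open_halfspace_Im_gt)
  show "(\<lambda>w. snd (zs w (real m))) holomorphic_on {w. Im w > 0}" for m by (rule zs_holomorphic) simp
  fix w assume "w \<in> {w. Im w > 0}"
  then obtain d where d: "d > 0" "cball w d \<subseteq> {w. Im w > 0}" using op open_contains_cball by blast
  then have "cball w d \<subseteq> {w. Im w \<ge> 0}" by auto
  from uniform_limit_on_subset[OF sa_uniform_limit this] d
  show "\<exists>d>0. cball w d \<subseteq> {w. Im w > 0} \<and> uniform_limit (cball w d) (\<lambda>m w. snd (zs w (real m))) sa sequentially"
    by blast
qed

text \<open>Over one unit of time the increment inherits the rapid decay of the pulse, provided the
  other factor is bounded by a constant on the strip.\<close>

lemma strip_increment:
  assumes f: "\<And>t. t \<in> {real m..real (Suc m)} \<Longrightarrow> (f has_vector_derivative f' t) (at t within {real m..real (Suc m)})"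
    and b: "\<And>t. t \<in> {real m..real (Suc m)} \<Longrightarrow> norm (f' t) \<le> norm (q0 t) * c" and c: "c \<ge> 0"
  shows "norm (f (real (Suc m)) - f (real m) :: complex) * (1 + real m) ^ k \<le> qK k * c"
proof -
  define B where "B = qK k * c / (1 + real m) ^ k"
  have "norm (f (real (Suc m)) - f (real m)) \<le> norm (f (real m) - f (real m)) + B * real (Suc m) - B * real m"
  proof (rule norm_growth_bound[where x = "\<lambda>t. f t - f (real m)" and x' = f' and g' = "\<lambda>_. B"])
    fix t assume t: "t \<in> {real m..real (Suc m)}"
    then have t0: "t \<ge> 0" by simp
    show "((\<lambda>t. f t - f (real m)) has_vector_derivative f' t) (at t within {real m..real (Suc m)})"
      using has_vector_derivative_diff[OF f[OF t] has_vector_derivative_const] by simp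
    show "((\<lambda>t. B * t) has_real_derivative B) (at t within {real m..real (Suc m)})"
      by (auto intro!: derivative_eq_intros)
    show "0 \<le> B" using qK_nonneg c by (simp add: B_def)
    have "norm (q0 t) \<le> qK k / (1 + t) ^ k"
      using qK[OF t0, of k] t0 by (subst pos_le_divide_eq) auto
    also have "\<dots> \<le> qK k / (1 + real m) ^ k"
      using t qK_nonneg by (intro divide_left_mono power_mono) auto
    finally have "norm (f' t) \<le> qK k / (1 + real m) ^ k * c"
      using b[OF t] c by (meson mult_right_mono order_trans)
    then have "norm (f' t) \<le> B" by (simp add: B_def)
    then show "inner (f t - f (real m)) (f' t) \<le> norm (f t - f (real m)) * B"
      by (intro order_trans[OF norm_cauchy_schwarz mult_left_mono]) auto
  qed simp
  then have "norm (f (real (Suc m)) - f (real m)) \<le> B" by (simp add: algebra_simps)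
  then show ?thesis by (simp add: B_def pos_le_divide_eq)
qed

text \<open>This fixes the width of the strips: below the real line the growth rate is at most
  \<open>2 * \<bar>Im w\<bar>\<close>, so up to time m + 1 the exponent stays below 2.\<close>

lemma norm_zs_strip:
  assumes "\<bar>Im w\<bar> \<le> 1 / (real m + 1)" "0 \<le> t" "t \<le> real (Suc m)" shows "norm (zs w t) \<le> exp 2"
proof -
  have "2 * (1 / (real m + 1)) * t \<le> 2 * (1 / (real m + 1)) * (real m + 1)"
    using assms by (intro mult_left_mono) auto
  also have "2 * (1 / (real m + 1)) * (real m + 1) = 2" by (simp add: divide_simps)
  finally have "2 * (1 / (real m + 1)) * t \<le> 2" .
  then show ?thesis using norm_zs_abs[OF assms(2,1)] by (meson exp_le_cancel_iff order_trans)
qed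

lemma sa_times_differentiable: "times_differentiable n (\<lambda>x. sa (of_real x))"
proof (rule strip_limit_times_differentiable[where F = "\<lambda>m w. snd (zs w (real m))" and C = "\<lambda>k. qK k * exp 2"])
  show "(\<lambda>w. snd (zs w (real m))) holomorphic_on UNIV" for m by (rule zs_holomorphic) simp
  show "(\<lambda>m. snd (zs (of_real x) (real m))) \<longlonglongrightarrow> sa (of_real x)" for x
    by (rule tendsto_uniform_limitI[OF sa_uniform_limit]) simp
  fix k m and w :: complex assume w: "\<bar>Im w\<bar> \<le> 1 / (real m + 1)"
  show "norm (snd (zs w (real (Suc m))) - snd (zs w (real m))) * (1 + real m) ^ k \<le> qK k * exp 2"
  proof (rule strip_increment)
    fix t assume t: "t \<in> {real m..real (Suc m)}"
    show "((\<lambda>t. snd (zs w t)) has_vector_derivative - cnj (q0 t) * fst (zs w t)) (at t within {real m..real (Suc m)})"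
      by (rule snd_zs_deriv[OF t]) simp
    have "norm (fst (zs w t)) \<le> exp 2"
      using norm_zs_strip[OF w, of t] t norm_fst_zs_le[of w t] by simp
    then show "norm (- cnj (q0 t) * fst (zs w t)) \<le> norm (q0 t) * exp 2"
      by (simp add: norm_mult mult_left_mono)
  qed simp
qed

lemma sb_times_differentiable: "times_differentiable n sb"
proof -
  have "times_differentiable n (\<lambda>x. cnj (sb x))"
  proof (rule strip_limit_times_differentiable[where F = "\<lambda>m w. osc w (real m)" and C = "\<lambda>k. qK k * (exp 2 * exp 2)"])
    show "(\<lambda>w. osc w (real m)) holomorphic_on UNIV" for m
      unfolding osc_def by (intro holomorphic_intros zs_holomorphic) simp
    show "(\<lambda>m. osc (of_real x) (real m)) \<longlonglongrightarrow> cnj (sb x)" for x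
      by (rule filterlim_compose[OF osc_limit(1) filterlim_real_sequentially])
    fix k m and w :: complex assume w: "\<bar>Im w\<bar> \<le> 1 / (real m + 1)"
    show "norm (osc w (real (Suc m)) - osc w (real m)) * (1 + real m) ^ k \<le> qK k * (exp 2 * exp 2)"
    proof (rule strip_increment)
      fix t assume t: "t \<in> {real m..real (Suc m)}"
      show "(osc w has_vector_derivative exp (- (2 * \<i> * w * of_real t)) * (q0 t * snd (zs w t))) (at t within {real m..real (Suc m)})"
        by (rule has_vector_derivative_within_subset[OF osc_deriv]) (use t in auto)
      have s: "norm (snd (zs w t)) \<le> exp 2"
        using norm_zs_strip[OF w, of t] t norm_snd_zs_le[of w t] by simp
      have "Im w * t \<le> 1 / (real m + 1) * (real m + 1)"
        using w t by (intro mult_mono) auto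
      then have e: "norm (exp (- (2 * \<i> * w * of_real t))) \<le> exp 2" by simp
      have "norm (exp (- (2 * \<i> * w * of_real t)) * (q0 t * snd (zs w t))) =
         norm (q0 t) * (norm (exp (- (2 * \<i> * w * of_real t))) * norm (snd (zs w t)))"
        by (simp add: norm_mult)
      also have "\<dots> \<le> norm (q0 t) * (exp 2 * exp 2)"
        by (intro mult_left_mono mult_mono e s) auto
      finally show "norm (exp (- (2 * \<i> * w * of_real t)) * (q0 t * snd (zs w t))) \<le> norm (q0 t) * (exp 2 * exp 2)" .
    qed simp
  qed
  from times_differentiable_cnj[OF this] show ?thesis by simp
qed

end

section \<open>Recovering a phase from a modulus\<close>

abbreviation closed_uhp :: "complex set" where
  "closed_uhp \<equiv> {w. Im w \<ge> 0}"

lemma convex_closed_uhp: "convex closed_uhp"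
  using convex_halfspace_Im_ge[of 0] by simp

lemma interior_closed_uhp: "interior closed_uhp \<subseteq> {w. Im w > 0}"
proof -
  have "closed_uhp = {w. \<i> \<bullet> w \<ge> 0}" by (simp add: inner_complex_def)
  then show ?thesis using interior_halfspace_ge[of "\<i>" 0] by (auto simp: inner_complex_def)
qed

lemma Ln_eq_of_exp_eq:
  assumes "exp x = exp y" "\<bar>Im (x - y)\<bar> < 2 * pi" shows "x = (y::complex)"
proof -
  obtain n :: int where n: "x = y + (of_int (2 * n) * pi) * \<i>"
    using assms(1) by (auto simp: exp_eq)
  then have "\<bar>of_int (2 * n) * pi\<bar> < 2 * pi" using assms(2) by simp
  then have "\<bar>real_of_int n\<bar> < 1" by (simp add: abs_mult)
  then have "n = 0" by linarith
  then show ?thesis using n by simp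
qed

text \<open>A continuous logarithm exists because the half-plane is contractible. Near infinity
  \<open>a\<close> is close to 1, so it differs from \<open>Ln \<circ> a\<close> by a constant with
  exponential 1; subtracting that constant gives the branch that decays at infinity.\<close>

lemma uhp_logarithm:
  assumes cont: "continuous_on closed_uhp a" and hol: "a holomorphic_on {w. Im w > 0}"
    and nz: "\<And>w. Im w \<ge> 0 \<Longrightarrow> a w \<noteq> 0"
    and K: "\<And>w. Im w \<ge> 0 \<Longrightarrow> w \<noteq> 0 \<Longrightarrow> norm (a w - 1) \<le> K / norm w"
  obtains L R0 where "continuous_on closed_uhp L" "\<And>w. Im w \<ge> 0 \<Longrightarrow> a w = exp (L w)"
    "\<And>w. Im w > 0 \<Longrightarrow> L field_differentiable (at w)"
    "\<And>w. Im w \<ge> 0 \<Longrightarrow> norm w > R0 \<Longrightarrow> norm (L w) \<le> 2 * K / norm w" "R0 > 0"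
proof -
  obtain L1 where L1: "continuous_on closed_uhp L1" "\<And>w. w \<in> closed_uhp \<Longrightarrow> a w = exp (L1 w)"
    by (rule continuous_logarithm_on_contractible[OF cont convex_imp_contractible[OF convex_closed_uhp]])
      (use nz in auto)
  have K0: "K \<ge> 0" using order_trans[OF norm_ge_zero K[of 1]] by simp
  \<comment> \<open>Beyond this radius \<open>K / norm w < 1 / 2\<close>, so \<open>a\<close> stays
    within 1/2 of 1 and the principal logarithm is continuous and linearly bounded.\<close>
  define R0 where "R0 = 2 * K + 1"
  define S where "S = {w. Im w \<ge> 0 \<and> norm w > R0}"
  have small: "norm (a w - 1) < 1 / 2" "norm (Ln (a w)) \<le> 2 * K / norm w" if "w \<in> S" for w
  proof -
    have w: "norm w > R0" "Im w \<ge> 0" "w \<noteq> 0" using that K0 by (auto simp: S_def R0_def)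
    have "norm (a w - 1) \<le> K / norm w" using K w by blast
    moreover have "K / norm w < 1 / 2" using w K0 by (simp add: R0_def field_simps)
    ultimately show *: "norm (a w - 1) < 1 / 2" by linarith
    have "norm (Ln (1 + (a w - 1))) \<le> 2 * norm (a w - 1)" by (rule norm_Ln_le[OF *])
    also have "\<dots> \<le> 2 * (K / norm w)" using K[OF w(2,3)] by simp
    finally show "norm (Ln (a w)) \<le> 2 * K / norm w" by simp
  qed
  define f where "f w = L1 w - Ln (a w)" for w
  \<comment> \<open>On \<open>S\<close> the difference of the two logarithms takes values in the
    multiples of \<open>2 * pi * \<i>\<close>; connectedness makes it constant. \<open>S\<close> is
    the polar image of a product of two intervals.\<close>
  have "connected S"
  proof -
    have "S = (\<lambda>(r, t). rcis r t) ` ({R0<..} \<times> {0..pi})"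
    proof (intro equalityI subsetI)
      fix w assume w: "w \<in> S"
      have "w = rcis (norm w) (Arg w)" by (simp add: rcis_cmod_Arg)
      moreover have "Arg w \<in> {0..pi}" using w Arg_less_0[of w] Arg_bounded[of w] by (auto simp: S_def)
      ultimately show "w \<in> (\<lambda>(r, t). rcis r t) ` ({R0<..} \<times> {0..pi})"
        using w by (intro image_eqI[of _ _ "(norm w, Arg w)"]) (auto simp: S_def)
    next
      fix w assume "w \<in> (\<lambda>(r, t). rcis r t) ` ({R0<..} \<times> {0..pi})"
      then obtain r t where w: "w = rcis r t" "r > R0" "0 \<le> t" "t \<le> pi" by auto
      have "r > 0" using w K0 by (simp add: R0_def)
      then show "w \<in> S" using w sin_ge_zero[of t] by (simp add: S_def rcis_def norm_mult)
    qed
    moreover have "continuous_on ({R0<..} \<times> {0..pi}) (\<lambda>(r, t). rcis r t)"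
      unfolding split_def rcis_def cis_conv_exp by (intro continuous_intros)
    moreover have "connected ({R0<..} \<times> {0..pi})"
      by (intro connected_Times convex_connected) auto
    ultimately show ?thesis using connected_continuous_image by metis
  qed
  moreover have "continuous_on S f"
    unfolding f_def
  proof (intro continuous_on_diff continuous_on_Ln')
    have S: "S \<subseteq> closed_uhp" by (auto simp: S_def)
    show "continuous_on S L1" "continuous_on S a" using continuous_on_subset[OF _ S] L1 cont by auto
    fix w assume "w \<in> S"
    from small(1)[OF this] have "\<bar>Re (a w - 1)\<bar> < 1 / 2" using abs_Re_le_cmod le_less_trans by blast
    then have "Re (a w) > 0" by (simp only: minus_complex.simps one_complex.simps)
    then show "a w \<notin> \<real>\<^sub>\<le>\<^sub>0" by (auto simp: complex_nonpos_Reals_iff)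
  qed
  moreover have "\<exists>e>0. \<forall>y. y \<in> S \<and> f y \<noteq> f x \<longrightarrow> e \<le> norm (f y - f x)" if x: "x \<in> S" for x
  proof (intro exI[of _ "2 * pi"] conjI allI impI)
    fix y assume y: "y \<in> S \<and> f y \<noteq> f x"
    have e: "exp (f z) = 1" if "z \<in> S" for z
      using that L1(2)[of z] nz[of z] by (auto simp: f_def exp_diff S_def)
    show "2 * pi \<le> norm (f y - f x)"
    proof (rule ccontr)
      assume "\<not> 2 * pi \<le> norm (f y - f x)"
      then have "\<bar>Im (f y - f x)\<bar> < 2 * pi" using abs_Im_le_cmod[of "f y - f x"] by linarith
      with Ln_eq_of_exp_eq[of "f y" "f x"] e x y show False by auto
    qed
  qed simp
  ultimately have "f constant_on S" by (rule continuous_discrete_range_constant)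
  then obtain c where c: "\<And>w. w \<in> S \<Longrightarrow> f w = c" unfolding constant_on_def by blast
  define L where "L w = L1 w - c" for w
  have cL: "continuous_on closed_uhp L" unfolding L_def by (intro continuous_intros L1)
  have "complex_of_real (R0 + 1) \<in> S"
    unfolding S_def mem_Collect_eq norm_of_real Im_complex_of_real using K0 by (simp add: R0_def)
  from c[OF this] L1(2)[of "of_real (R0 + 1)"] nz[of "of_real (R0 + 1)"] have ec: "exp c = 1"
    by (auto simp: f_def exp_diff)
  have eL: "a w = exp (L w)" if "Im w \<ge> 0" for w
    using L1(2)[of w] that ec by (simp add: L_def exp_diff)
  \<comment> \<open>By continuity \<open>L v - L w\<close> remains in the strip where
    \<open>Ln\<close> inverts \<open>exp\<close>, so near \<open>w\<close> the function
    \<open>L\<close> is a constant plus \<open>Ln (a v / a w)\<close>.\<close>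
  have dL: "L field_differentiable (at w)" if w: "Im w > 0" for w
  proof -
    have op: "open {w. Im w > 0}" by (rule open_halfspace_Im_gt)
    have "isCont L w"
    proof -
      have "continuous_on {w. Im w > 0} L" by (rule continuous_on_subset[OF cL]) auto
      then show ?thesis using continuous_on_eq_continuous_at[OF op] w by blast
    qed
    then have "((\<lambda>v. L v - L w) \<longlongrightarrow> L w - L w) (nhds w)"
      by (intro tendsto_intros) (simp add: continuous_at tendsto_at_iff_tendsto_nhds)
    then have ev1: "eventually (\<lambda>v. norm (L v - L w) < 1) (nhds w)"
      using tendstoD[of "\<lambda>v. L v - L w" 0 "nhds w" 1] by (simp add: dist_norm)
    have ev2: "eventually (\<lambda>v. Im v > 0) (nhds w)"
      using eventually_nhds_in_open[OF op, of w] w by simp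
    from ev1 ev2 have ev: "eventually (\<lambda>v. L v = L w + Ln (a v / a w)) (nhds w)"
    proof eventually_elim
      case (elim v)
      have i: "\<bar>Im (L v - L w)\<bar> < 1" using abs_Im_le_cmod[of "L v - L w"] elim by linarith
      have "Ln (exp (L v - L w)) = L v - L w"
        by (rule Ln_exp) (use i pi_gt3 in linarith)+
      then show ?case using eL[of v] eL[of w] elim w by (simp add: exp_diff)
    qed
    have "a field_differentiable (at w)"
      using hol op w by (simp add: holomorphic_on_open field_differentiable_def)
    then obtain a' where a': "(a has_field_derivative a') (at w)" by (auto simp: field_differentiable_def)
    have "((\<lambda>v. a v / a w) has_field_derivative a' / a w) (at w)"
      using a' by (rule DERIV_cdivide)
    moreover have "(Ln has_field_derivative inverse (a w / a w)) (at (a w / a w))"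
      using nz[of w] w by (intro has_field_derivative_Ln) auto
    ultimately have "((\<lambda>v. L w + Ln (a v / a w)) has_field_derivative 0 + inverse (a w / a w) * (a' / a w)) (at w)"
      by (intro DERIV_add DERIV_const DERIV_chain2[of Ln])
    then have "(L has_field_derivative 0 + inverse (a w / a w) * (a' / a w)) (at w)"
      by (subst DERIV_cong_ev[OF refl ev refl])
    then show ?thesis by (auto simp: field_differentiable_def)
  qed
  show thesis
  proof (rule that[OF cL eL dL])
    show "R0 > 0" using K0 by (simp add: R0_def)
    fix w assume w: "Im w \<ge> 0" "norm w > R0"
    then have S: "w \<in> S" by (simp add: S_def)
    from c[OF S, symmetric] have "L w = Ln (a w)" by (simp add: f_def L_def)
    with small(2)[OF S] show "norm (L w) \<le> 2 * K / norm w" by simp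
  qed
qed

lemma continuous_on_difference_quotient:
  assumes L: "continuous_on S L" and d: "(L has_field_derivative D) (at p)"
  shows "continuous_on S (\<lambda>w. if w = p then D else (L w - L p) / (w - p))"
  unfolding continuous_on_def
proof
  fix x assume x: "x \<in> S"
  let ?F = "\<lambda>w. if w = p then D else (L w - L p) / (w - p)"
  show "(?F \<longlongrightarrow> ?F x) (at x within S)"
  proof (cases "x = p")
    case True
    have "((\<lambda>w. (L w - L p) / (w - p)) \<longlongrightarrow> D) (at p within S)"
      using d unfolding has_field_derivative_iff by (rule tendsto_within_subset) simp
    moreover have "\<forall>\<^sub>F w in at p within S. (L w - L p) / (w - p) = ?F w"
      by (auto simp: eventually_at_filter)
    ultimately show ?thesis using True by (auto intro: Lim_transform_eventually)
  next
    case False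
    have "((\<lambda>w. (L w - L p) / (w - p)) \<longlongrightarrow> (L x - L p) / (x - p)) (at x within S)"
      using L x False unfolding continuous_on_def by (intro tendsto_intros) auto
    moreover have "\<forall>\<^sub>F w in at x within S. (L w - L p) / (w - p) = ?F w"
      using eventually_neq_at_within[of p x S] by eventually_elim simp
    ultimately show ?thesis using False by (auto intro: Lim_transform_eventually)
  qed
qed

text \<open>Cauchy's theorem on the upper half disc for \<open>(L w - L (\<i> \<epsilon>)) 2 w / (w\<^sup>2 + \<epsilon>\<^sup>2)\<close>, whose kernel
  regularises \<open>2 / w\<close>.\<close>

lemma half_disc_identity:
  assumes cont: "continuous_on closed_uhp L"
    and d: "\<And>w. Im w > 0 \<Longrightarrow> L field_differentiable (at w)"
    and e: "0 < \<epsilon>" "\<epsilon> < R"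
  shows "integral {-R..R} (\<lambda>x. Re (L (of_real x)) * (2 * x / (x\<^sup>2 + \<epsilon>\<^sup>2))) =
    - Re (integral {0..pi} (\<lambda>t. (L (R * cis t) - L (\<i> * \<epsilon>)) * (2 * \<i>) * ((R * cis t)\<^sup>2 / ((R * cis t)\<^sup>2 + (complex_of_real \<epsilon>)\<^sup>2))))"
    (is "?J = - Re (integral _ ?A)")
proof -
  define p where "p = \<i> * complex_of_real \<epsilon>"
  have Ip: "Im p > 0" using e by (simp add: p_def)
  \<comment> \<open>At \<open>p\<close> the quotient has a removable singularity, filled in by the
    derivative; the zero \<open>- p\<close> of the other denominator lies below the real line. So
    \<open>F\<close> satisfies Cauchy's theorem on the half disc, with \<open>p\<close> as
    exceptional point.\<close>
  define F where "F w = (if w = p then deriv L p else (L w - L p) / (w - p)) * (2 * w / (w + p))" for w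
  have dp: "(L has_field_derivative deriv L p) (at p)"
    using d[OF Ip] by (simp add: field_differentiable_derivI)
  have wp: "w + p \<noteq> 0" if "Im w \<ge> 0" for w
    using that Ip by (auto simp: complex_eq_iff)
  have Fc: "continuous_on closed_uhp F"
    unfolding F_def using wp
    by (intro continuous_intros continuous_on_difference_quotient[OF cont dp]) auto
  have Fd: "F field_differentiable (at w)" if w: "w \<in> interior closed_uhp - {p}" for w
  proof -
    have w': "Im w > 0" "w \<noteq> p" using w interior_closed_uhp by auto
    have "(\<lambda>w. (L w - L p) / (w - p) * (2 * w / (w + p))) field_differentiable (at w)"
      using d[OF w'(1)] w' wp[of w] by (intro derivative_intros) auto
    moreover have "eventually (\<lambda>v. v \<in> - {p}) (nhds w)"
      using w' by (intro eventually_nhds_in_open) auto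
    then have "eventually (\<lambda>v. (L v - L p) / (v - p) * (2 * v / (v + p)) = F v) (nhds w)"
      by eventually_elim (simp add: F_def)
    note ev = this
    from calculation obtain f' where "((\<lambda>w. (L w - L p) / (w - p) * (2 * w / (w + p))) has_field_derivative f') (at w)"
      unfolding field_differentiable_def by blast
    then have "(F has_field_derivative f') (at w)"
      by (rule DERIV_cong_ev[OF refl ev refl, THEN iffD1])
    then show ?thesis unfolding field_differentiable_def by blast
  qed
  let ?l = "linepath (of_real (-R)) (of_real R) :: real \<Rightarrow> complex"
  let ?c = "part_circlepath 0 R 0 pi"
  have R: "R > 0" using e by simp
  have li: "path_image ?l \<subseteq> closed_uhp"
    by (auto simp: path_image_linepath closed_segment_def)
  have ci: "path_image ?c \<subseteq> closed_uhp"
    using R by (auto simp: path_image_part_circlepath Im_exp sin_ge_zero)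
  have "(F has_contour_integral 0) (?l +++ ?c)"
  proof (rule Cauchy_theorem_convex[OF Fc convex_closed_uhp _ Fd, of "{p}"])
    show "valid_path (?l +++ ?c)"
      by (intro valid_path_join) auto
    show "path_image (?l +++ ?c) \<subseteq> closed_uhp"
      using li ci by (subst path_image_join) auto
  qed auto
  moreover have lI: "F contour_integrable_on ?l"
    by (rule contour_integrable_continuous_linepath) (use continuous_on_subset[OF Fc li] in simp)
  moreover have cI: "F contour_integrable_on ?c"
    by (rule contour_integrable_continuous_part_circlepath) (rule continuous_on_subset[OF Fc ci])
  ultimately have sum0: "contour_integral ?l F + contour_integral ?c F = 0"
    using has_contour_integral_join[OF has_contour_integral_integral[OF lI] has_contour_integral_integral[OF cI]]
      contour_integral_unique by fastforce
  have F_line: "F (of_real x) = (L (of_real x) - L p) * of_real (2 * x / (x\<^sup>2 + \<epsilon>\<^sup>2))" for x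
  proof -
    have ne: "complex_of_real x \<noteq> p" using Ip by (auto simp: complex_eq_iff)
    have "(of_real x - p) * (of_real x + p) = of_real (x\<^sup>2 + \<epsilon>\<^sup>2)"
      by (simp add: p_def algebra_simps power2_eq_square)
    then show ?thesis using ne by (simp add: F_def)
  qed
  have "((\<lambda>x. F (of_real x)) has_integral contour_integral ?l F) {-R..R}"
    using has_contour_integral_linepath_Reals_iff[of "of_real (-R)" "of_real R" F "contour_integral ?l F"]
      has_contour_integral_integral[OF lI] R by simp
  from has_integral_linear[OF this bounded_linear_Re]
  have h1: "((\<lambda>x. (Re (L (of_real x)) - Re (L p)) * (2 * x / (x\<^sup>2 + \<epsilon>\<^sup>2))) has_integral Re (contour_integral ?l F)) {-R..R}"
    by (simp add: o_def F_line)
  have pos: "x\<^sup>2 + \<epsilon>\<^sup>2 > 0" for x using e by (simp add: add_nonneg_pos)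
  \<comment> \<open>The kernel is odd, so subtracting the constant \<open>L p\<close> does not
    change the integral along the real segment.\<close>
  have "((\<lambda>x. 2 * x / (x\<^sup>2 + \<epsilon>\<^sup>2)) has_integral ln (R\<^sup>2 + \<epsilon>\<^sup>2) - ln ((-R)\<^sup>2 + \<epsilon>\<^sup>2)) {-R..R}"
  proof (rule fundamental_theorem_of_calculus)
    fix x assume "x \<in> {-R..R}"
    have "((\<lambda>x. ln (x\<^sup>2 + \<epsilon>\<^sup>2)) has_real_derivative 2 * x / (x\<^sup>2 + \<epsilon>\<^sup>2)) (at x within {-R..R})"
      by (rule derivative_eq_intros refl pos | simp)+
    then show "((\<lambda>x. ln (x\<^sup>2 + \<epsilon>\<^sup>2)) has_vector_derivative 2 * x / (x\<^sup>2 + \<epsilon>\<^sup>2)) (at x within {-R..R})"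
      by (simp add: has_real_derivative_iff_has_vector_derivative)
  qed (use R in simp)
  then have h2: "((\<lambda>x. Re (L p) * (2 * x / (x\<^sup>2 + \<epsilon>\<^sup>2))) has_integral Re (L p) * 0) {-R..R}"
    by (intro has_integral_mult_right) simp
  have "((\<lambda>x. (Re (L (of_real x)) - Re (L p)) * (2 * x / (x\<^sup>2 + \<epsilon>\<^sup>2)) + Re (L p) * (2 * x / (x\<^sup>2 + \<epsilon>\<^sup>2))) has_integral
      Re (contour_integral ?l F) + Re (L p) * 0) {-R..R}"
    by (rule has_integral_add[OF h1 h2])
  then have "((\<lambda>x. Re (L (of_real x)) * (2 * x / (x\<^sup>2 + \<epsilon>\<^sup>2))) has_integral Re (contour_integral ?l F)) {-R..R}"
    by (simp only: left_diff_distrib diff_add_cancel mult_zero_right add_0_right)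
  from integral_unique[OF this] have J: "?J = Re (contour_integral ?l F)" .
  have "contour_integral ?c F = integral {0..pi} (\<lambda>t. F (0 + R * cis t) * R * \<i> * cis t)"
    by (rule contour_integral_part_circlepath_eq) simp
  also have "\<dots> = integral {0..pi} ?A"
  proof (rule integral_cong)
    fix t assume t: "t \<in> {0..pi}"
    let ?w = "R * cis t"
    have n: "norm ?w = R" using R by (simp add: norm_mult)
    have "norm p = \<epsilon>" using e by (simp add: p_def norm_mult)
    then have ne: "?w \<noteq> p" "?w \<noteq> - p" using n e by auto
    have "(?w - p) * (?w + p) = ?w\<^sup>2 + (complex_of_real \<epsilon>)\<^sup>2"
      by (simp add: p_def algebra_simps power2_eq_square)
    moreover have "(?w - p) * (?w + p) \<noteq> 0" using ne by (auto simp: add_eq_0_iff)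
    moreover have "F (0 + ?w) * R * \<i> * cis t = (L ?w - L p) * (2 * \<i>) * (?w\<^sup>2 / ((?w - p) * (?w + p)))"
      using ne by (simp add: F_def power2_eq_square)
    ultimately show "F (0 + ?w) * R * \<i> * cis t = ?A t" by (simp add: p_def)
  qed
  finally show ?thesis using sum0 J by (simp add: add_eq_0_iff2 p_def)
qed

text \<open>The boundary Hilbert transform at one point. In the half disc identity the radius tends
  to infinity and the regularisation to 0 along one sequence. On the arc \<open>L\<close> decays and
  only \<open>- L 0\<close> survives, contributing \<open>- 2 * pi * Im (L 0)\<close>; on the line
  the kernel is dominated by \<open>2 / \<bar>x\<bar>\<close> and tends to
  \<open>2 / x\<close>.\<close>

lemma uhp_imaginary_part_at_0:
  assumes cont: "continuous_on closed_uhp a" and hol: "a holomorphic_on {w. Im w > 0}"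
    and nz: "\<And>w. Im w \<ge> 0 \<Longrightarrow> a w \<noteq> 0"
    and K: "\<And>w. Im w \<ge> 0 \<Longrightarrow> w \<noteq> 0 \<Longrightarrow> norm (a w - 1) \<le> K / norm w"
    and int: "integrable lborel (\<lambda>x. ln (norm (a (of_real x))) / x)"
  obtains l where "a 0 = exp l" "Im l = - (1 / pi) * (LINT x|lborel. ln (norm (a (of_real x))) / x)"
proof -
  obtain L R0 where cL: "continuous_on closed_uhp L" and eL: "\<And>w. Im w \<ge> 0 \<Longrightarrow> a w = exp (L w)"
    and dL: "\<And>w. Im w > 0 \<Longrightarrow> L field_differentiable (at w)"
    and bL: "\<And>w. Im w \<ge> 0 \<Longrightarrow> norm w > R0 \<Longrightarrow> norm (L w) \<le> 2 * K / norm w" and R0: "R0 > 0"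
    by (rule uhp_logarithm[OF cont hol nz K]) (assumption, assumption, assumption, rule that)
  have lnL: "ln (norm (a (of_real x))) = Re (L (of_real x))" for x :: real
    using eL[of "of_real x"] by (simp add: norm_exp_eq_Re)
  \<comment> \<open>The offset 2 gives \<open>R m \<ge> 2\<close> and
    \<open>\<epsilon> m \<le> 1 / 2\<close>, which keeps the denominator on the arc at least 1 in
    modulus.\<close>
  define R where "R m = real m + 2" for m
  define \<epsilon> where "\<epsilon> m = 1 / R m" for m
  have e: "0 < \<epsilon> m" "\<epsilon> m \<le> 1 / 2" "R m \<ge> 2" for m
    by (auto simp: \<epsilon>_def R_def field_simps)
  have Rlim: "filterlim R at_top sequentially"
    unfolding R_def by (rule filterlim_at_top_mono[OF filterlim_real_sequentially]) auto
  have elim: "\<epsilon> \<longlonglongrightarrow> 0"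
    unfolding \<epsilon>_def[abs_def] by (rule tendsto_divide_0[OF tendsto_const filterlim_at_top_imp_at_infinity[OF Rlim]])
  define k where "k m x = 2 * x / (x\<^sup>2 + (\<epsilon> m)\<^sup>2)" for m x
  define A where "A m t = (L (R m * cis t) - L (\<i> * \<epsilon> m)) * (2 * \<i>) * ((R m * cis t)\<^sup>2 / ((R m * cis t)\<^sup>2 + (complex_of_real (\<epsilon> m))\<^sup>2))" for m t
  have id: "integral {- R m..R m} (\<lambda>x. Re (L (of_real x)) * k m x) = - Re (integral {0..pi} (A m))" for m
    unfolding k_def A_def using e[of m] by (intro half_disc_identity cL dL) auto
  have in_uhp: "Im (R m * cis t) \<ge> 0" if "t \<in> {0..pi}" for m t
    using that e(3)[of m] sin_ge_zero[of t] by simp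
  have nw: "norm (R m * cis t) = R m" for m t
    using e(3)[of m] by (simp add: norm_mult)
  have L0lim: "(\<lambda>m. L (\<i> * \<epsilon> m)) \<longlonglongrightarrow> L 0"
  proof (rule continuous_on_tendsto_compose[OF cL])
    show "(\<lambda>m. \<i> * complex_of_real (\<epsilon> m)) \<longlonglongrightarrow> 0"
      using elim by (auto intro!: tendsto_eq_intros)
  qed (use e in \<open>auto intro!: always_eventually less_imp_le\<close>)
  have ratio: "norm ((R m * cis t)\<^sup>2 / ((R m * cis t)\<^sup>2 + (complex_of_real (\<epsilon> m))\<^sup>2)) \<le> 2"
    and ratio1: "norm ((R m * cis t)\<^sup>2 / ((R m * cis t)\<^sup>2 + (complex_of_real (\<epsilon> m))\<^sup>2) - 1) \<le> \<epsilon> m" for m t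
  proof -
    let ?w = "complex_of_real (R m) * cis t"
    have n2: "norm (?w\<^sup>2) = (R m)\<^sup>2" by (simp add: norm_power nw)
    have ne2: "norm ((complex_of_real (\<epsilon> m))\<^sup>2) = (\<epsilon> m)\<^sup>2" by (simp add: norm_power)
    have "(\<epsilon> m)\<^sup>2 \<le> (1 / 2)\<^sup>2" using e[of m] by (intro power_mono) auto
    moreover have "2\<^sup>2 \<le> (R m)\<^sup>2" using e[of m] by (intro power_mono) auto
    moreover have "norm (?w\<^sup>2) - norm ((complex_of_real (\<epsilon> m))\<^sup>2) \<le> norm (?w\<^sup>2 + (complex_of_real (\<epsilon> m))\<^sup>2)"
      by (rule norm_diff_ineq)
    ultimately have lo: "(R m)\<^sup>2 / 2 \<le> norm (?w\<^sup>2 + (complex_of_real (\<epsilon> m))\<^sup>2)" "1 \<le> norm (?w\<^sup>2 + (complex_of_real (\<epsilon> m))\<^sup>2)"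
      unfolding n2 ne2 by (auto simp: power2_eq_square)
    then have nz: "?w\<^sup>2 + (complex_of_real (\<epsilon> m))\<^sup>2 \<noteq> 0" by auto
    show "norm (?w\<^sup>2 / (?w\<^sup>2 + (complex_of_real (\<epsilon> m))\<^sup>2)) \<le> 2"
      unfolding norm_divide using lo nz by (subst pos_divide_le_eq) (auto simp: n2)
    have "?w\<^sup>2 / (?w\<^sup>2 + (complex_of_real (\<epsilon> m))\<^sup>2) - 1 = - ((complex_of_real (\<epsilon> m))\<^sup>2) / (?w\<^sup>2 + (complex_of_real (\<epsilon> m))\<^sup>2)"
      using nz by (simp add: field_simps)
    then have "norm (?w\<^sup>2 / (?w\<^sup>2 + (complex_of_real (\<epsilon> m))\<^sup>2) - 1) = (\<epsilon> m)\<^sup>2 / norm (?w\<^sup>2 + (complex_of_real (\<epsilon> m))\<^sup>2)"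
      by (simp add: norm_divide ne2)
    also have "\<dots> \<le> (\<epsilon> m)\<^sup>2 / 1"
      using lo(2) by (intro divide_left_mono) auto
    also have "\<dots> \<le> \<epsilon> m" using e[of m] by (simp add: power2_eq_square mult_le_cancel_left1)
    finally show "norm (?w\<^sup>2 / (?w\<^sup>2 + (complex_of_real (\<epsilon> m))\<^sup>2) - 1) \<le> \<epsilon> m" .
  qed
  obtain BL where BL: "\<And>w. w \<in> closed_uhp \<Longrightarrow> norm w \<le> R0 + 1 \<Longrightarrow> norm (L w) \<le> BL"
  proof -
    have "compact (closed_uhp \<inter> cball 0 (R0 + 1))"
      by (intro closed_Int_compact compact_cball) (simp add: closed_halfspace_Im_ge)
    then have "bounded (L ` (closed_uhp \<inter> cball 0 (R0 + 1)))"
      by (intro compact_imp_bounded compact_continuous_image continuous_on_subset[OF cL]) auto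
    then obtain B where "\<forall>x\<in>L ` (closed_uhp \<inter> cball 0 (R0 + 1)). norm x \<le> B" unfolding bounded_iff by blast
    then show thesis by (intro that[of B]) auto
  qed
  have K0: "K \<ge> 0" using order_trans[OF norm_ge_zero K[of 1]] by simp
  define B where "B = BL + 2 * K / R0"
  have B: "norm (L w) \<le> B" if "w \<in> closed_uhp" for w
  proof (cases "norm w > R0")
    case True
    have "norm (L w) \<le> 2 * K / norm w" using bL[of w] True that by simp
    also have "\<dots> \<le> 2 * K / R0" using True R0 K0 by (intro divide_left_mono mult_pos_pos) auto
    finally show ?thesis
      using order_trans[OF norm_ge_zero BL[of 0]] R0 by (simp add: B_def)
  next
    case False
    then show ?thesis using BL[OF that] K0 R0 by (simp add: B_def add_increasing2)
  qed
  have B0: "B \<ge> 0" using order_trans[OF norm_ge_zero B[of 0]] by simp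
  have lim1: "(\<lambda>m. integral {0..pi} (A m)) \<longlonglongrightarrow> integral {0..pi} (\<lambda>t. (0 - L 0) * (2 * \<i>) * 1)"
  proof (rule dominated_convergence(2)[where h = "\<lambda>_. 2 * B * 2 * 2"])
    show "A m integrable_on {0..pi}" for m
    proof (rule integrable_continuous_real)
      have "continuous_on {0..pi} (\<lambda>t. L (R m * cis t))"
        by (rule continuous_on_compose2[OF cL]) (use in_uhp in \<open>auto intro!: continuous_intros simp: cis_conv_exp\<close>)
      moreover have "(R m * cis t)\<^sup>2 + (complex_of_real (\<epsilon> m))\<^sup>2 \<noteq> 0" for t
      proof
        assume "(R m * cis t)\<^sup>2 + (complex_of_real (\<epsilon> m))\<^sup>2 = 0"
        with ratio1[of m t] e(2)[of m] show False by simp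
      qed
      moreover have "continuous_on {0..pi} cis" unfolding cis_conv_exp by (intro continuous_intros)
      ultimately show "continuous_on {0..pi} (A m)"
        unfolding A_def by (intro continuous_intros) auto
    qed
    show "(\<lambda>_. 2 * B * 2 * 2) integrable_on {0..pi}" by (rule integrable_const_ivl)
    fix t assume t: "t \<in> {0..pi}"
    show "norm (A m t) \<le> 2 * B * 2 * 2" for m
    proof -
      have "norm (L (R m * cis t) - L (\<i> * \<epsilon> m)) \<le> 2 * B"
        using norm_triangle_ineq4[of "L (R m * cis t)" "L (\<i> * \<epsilon> m)"] B[of "R m * cis t"] B[of "\<i> * \<epsilon> m"]
          in_uhp[OF t, of m] e(1)[of m] by simp
      then show ?thesis
        unfolding A_def norm_mult using ratio[of m t] B0 by (intro mult_mono) auto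
    qed
    have "(\<lambda>m. L (R m * cis t)) \<longlonglongrightarrow> 0"
    proof (rule Lim_null_comparison)
      show "\<forall>\<^sub>F m in sequentially. norm (L (R m * cis t)) \<le> 2 * K / R m"
        using filterlim_at_top_dense[THEN iffD1, OF Rlim, rule_format, of R0]
        by eventually_elim (use bL[OF in_uhp[OF t]] nw in simp)
      show "(\<lambda>m. 2 * K / R m) \<longlonglongrightarrow> 0"
        by (rule tendsto_divide_0[OF tendsto_const filterlim_at_top_imp_at_infinity[OF Rlim]])
    qed
    moreover have "(\<lambda>m. (R m * cis t)\<^sup>2 / ((R m * cis t)\<^sup>2 + (complex_of_real (\<epsilon> m))\<^sup>2)) \<longlonglongrightarrow> 1"
      unfolding LIM_zero_iff[symmetric, of _ 1]
      by (rule Lim_null_comparison[OF _ elim]) (use ratio1 in auto)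
    ultimately show "(\<lambda>m. A m t) \<longlonglongrightarrow> (0 - L 0) * (2 * \<i>) * 1"
      unfolding A_def by (intro tendsto_intros L0lim)
  qed
  have "integral {0..pi} (\<lambda>t. (0 - L 0) * (2 * \<i>) * 1) = - 2 * \<i> * pi * L 0"
    by (simp add: scaleR_conv_of_real)
  with tendsto_minus[OF tendsto_Re[OF lim1]]
  have lim2: "(\<lambda>m. - Re (integral {0..pi} (A m))) \<longlonglongrightarrow> - (2 * pi * Im (L 0))"
    by (simp add: mult_ac)
  define f where "f m x = (if x \<in> {- R m..R m} then Re (L (of_real x)) * k m x else 0)" for m x
  have intL: "integrable lborel (\<lambda>x. Re (L (of_real x)) / x)"
    using int by (simp add: lnL)
  have lim3: "(\<lambda>m. integral UNIV (f m)) \<longlonglongrightarrow> integral UNIV (\<lambda>x. 2 * (Re (L (of_real x)) / x))"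
  proof (rule dominated_convergence(2)[where h = "\<lambda>x. 2 * norm (Re (L (of_real x)) / x)"])
    show "f m integrable_on UNIV" for m
      unfolding f_def integrable_restrict_UNIV
    proof (rule integrable_continuous_real)
      have "continuous_on {- R m..R m} (\<lambda>x. L (of_real x))"
        by (rule continuous_on_compose2[OF cL]) (auto intro!: continuous_intros)
      moreover have "x\<^sup>2 + (\<epsilon> m)\<^sup>2 \<noteq> 0" for x
        using e(1)[of m] add_nonneg_pos[of "x\<^sup>2" "(\<epsilon> m)\<^sup>2"] by simp
      ultimately show "continuous_on {- R m..R m} (\<lambda>x. Re (L (of_real x)) * k m x)"
        unfolding k_def by (intro continuous_intros) auto
    qed
    show "(\<lambda>x. 2 * norm (Re (L (of_real x)) / x)) integrable_on UNIV"
      using has_integral_integral_lborel[OF integrable_mult_right[OF integrable_norm[OF intL], of 2]]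
      by (auto simp: integrable_on_def)
    fix x :: real
    show "norm (f m x) \<le> 2 * norm (Re (L (of_real x)) / x)" for m
    proof (cases "x = 0")
      case False
      have "\<bar>k m x\<bar> \<le> 2 * \<bar>x\<bar> / x\<^sup>2"
        unfolding k_def abs_divide abs_mult using False e(1)[of m]
        by (intro frac_le) auto
      also have "\<dots> = 2 / \<bar>x\<bar>" using False by (simp add: power2_eq_square field_simps abs_mult[symmetric])
      finally have "\<bar>Re (L (of_real x))\<bar> * \<bar>k m x\<bar> \<le> \<bar>Re (L (of_real x))\<bar> * (2 / \<bar>x\<bar>)"
        by (rule mult_left_mono) simp
      then show ?thesis by (simp add: f_def abs_mult mult.commute)
    qed (simp add: f_def k_def)
    show "(\<lambda>m. f m x) \<longlonglongrightarrow> 2 * (Re (L (of_real x)) / x)"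
    proof (cases "x = 0")
      case False
      have "(\<lambda>m. Re (L (of_real x)) * k m x) \<longlonglongrightarrow> Re (L (of_real x)) * (2 * x / (x\<^sup>2 + 0\<^sup>2))"
        unfolding k_def using False by (intro tendsto_intros elim) auto
      moreover have "Re (L (of_real x)) * (2 * x / (x\<^sup>2 + 0\<^sup>2)) = 2 * (Re (L (of_real x)) / x)"
        using False by (simp add: power2_eq_square)
      ultimately have "(\<lambda>m. Re (L (of_real x)) * k m x) \<longlonglongrightarrow> 2 * (Re (L (of_real x)) / x)" by simp
      moreover have "\<forall>\<^sub>F m in sequentially. Re (L (of_real x)) * k m x = f m x"
        using filterlim_at_top_dense[THEN iffD1, OF Rlim, rule_format, of "\<bar>x\<bar>"]
        by eventually_elim (auto simp: f_def)
      ultimately show ?thesis by (rule Lim_transform_eventually)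
    qed (simp add: f_def k_def cong: if_cong)
  qed
  have f_int: "integral UNIV (f m) = - Re (integral {0..pi} (A m))" for m
    using id[of m] unfolding f_def[abs_def] integral_restrict_UNIV .
  have g_int: "integral UNIV (\<lambda>x. 2 * (Re (L (of_real x)) / x)) = 2 * (LINT x|lborel. Re (L (of_real x)) / x)"
    using integral_lborel[OF integrable_mult_right[OF intL, of 2]]
    unfolding integral_mult_right_zero .
  have "- (2 * pi * Im (L 0)) = 2 * (LINT x|lborel. Re (L (of_real x)) / x)"
    using LIMSEQ_unique[OF lim2 lim3[unfolded f_int g_int]] .
  then have "Im (L 0) = - (1 / pi) * (LINT x|lborel. ln (norm (a (of_real x))) / x)"
    by (simp add: lnL field_simps)
  with eL[of 0] show thesis by (intro that) auto
qed

text \<open>Dominated convergence with majorant \<open>norm (f x)\<close>. It applies to the phase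
  because \<open>r 0 = 0\<close> makes the integrand absolutely integrable near 0.\<close>

lemma pv_integral_eq_integral:
  assumes "integrable lborel f"
  shows "pv_integral f = (LINT x|lborel. f x)"
proof -
  have f: "f \<in> borel_measurable lborel" using assms by (rule borel_measurable_integrable)
  have "((\<lambda>\<epsilon>. LINT x:{x. \<bar>x\<bar> > \<epsilon>}|lborel. f x) \<longlongrightarrow> (LINT x|lborel. f x)) (at_right 0)"
  proof (rule tendsto_at_right_sequentially[of 0 1])
    fix S :: "nat \<Rightarrow> real" assume S: "\<And>n. 0 < S n" "S \<longlonglongrightarrow> 0"
    have "(\<lambda>n. LINT x|lborel. indicator {x. \<bar>x\<bar> > S n} x *\<^sub>R f x) \<longlonglongrightarrow> (LINT x|lborel. (if x = 0 then 0 else f x))"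
    proof (rule integral_dominated_convergence[where w = "\<lambda>x. norm (f x)"])
      show "(\<lambda>x. if x = 0 then 0 else f x) \<in> borel_measurable lborel" using f by simp
      show "(\<lambda>x. indicator {x. \<bar>x\<bar> > S n} x *\<^sub>R f x) \<in> borel_measurable lborel" for n
        using f by measurable
      show "integrable lborel (\<lambda>x. norm (f x))" using assms by (rule integrable_norm)
      show "AE x in lborel. (\<lambda>n. indicator {x. \<bar>x\<bar> > S n} x *\<^sub>R f x) \<longlonglongrightarrow> (if x = 0 then 0 else f x)"
      proof (rule AE_I2)
        fix x :: real
        show "(\<lambda>n. indicator {x. \<bar>x\<bar> > S n} x *\<^sub>R f x) \<longlonglongrightarrow> (if x = 0 then 0 else f x)"
        proof (cases "x = 0")
          case True
          have "\<not> 0 > S n" for n using S(1)[of n] by simp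
          with True show ?thesis by simp
        next
          case False
          have "eventually (\<lambda>n. S n < \<bar>x\<bar>) sequentially"
            using order_tendstoD(2)[OF S(2), of "\<bar>x\<bar>"] False by simp
          then have "eventually (\<lambda>n. indicator {x. \<bar>x\<bar> > S n} x *\<^sub>R f x = f x) sequentially"
            by eventually_elim simp
          with False show ?thesis by (simp add: tendsto_eventually)
        qed
      qed
      show "AE x in lborel. norm (indicator {x. \<bar>x\<bar> > S n} x *\<^sub>R f x) \<le> norm (f x)" for n
        by (rule AE_I2) (simp add: indicator_def)
    qed
    moreover have "(LINT x|lborel. (if x = 0 then 0 else f x)) = (LINT x|lborel. f x)"
    proof (rule integral_cong_AE)
      show "AE x in lborel. (if x = 0 then 0 else f x) = f x"
        using AE_lborel_singleton[of "0::real"] by eventually_elim simp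
    qed (use f in auto)
    ultimately show "(\<lambda>n. LINT x:{x. \<bar>x\<bar> > S n}|lborel. f x) \<longlonglongrightarrow> (LINT x|lborel. f x)"
      by (simp add: set_lebesgue_integral_def)
  qed simp
  then show ?thesis unfolding pv_integral_def by (intro tendsto_Lim) auto
qed

lemma integrable_bounded_by_inverse_square:
  fixes f :: "real \<Rightarrow> real"
  assumes "f \<in> borel_measurable lborel" "\<And>x. \<bar>f x\<bar> \<le> C * inverse (1 + x\<^sup>2)"
  shows "integrable lborel f"
proof (rule Bochner_Integration.integrable_bound)
  show "integrable lborel (\<lambda>x. C * inverse (1 + x\<^sup>2))"
  proof (intro integrable_mult_right)
    have "set_integrable lborel (einterval (- \<infinity>) \<infinity>) (\<lambda>x. inverse (1 + x\<^sup>2))"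
    proof (rule interval_integral_FTC_nonneg(1)[where F = arctan and A = "- (pi / 2)" and B = "pi / 2"])
      fix x :: real
      show "DERIV arctan x :> inverse (1 + x\<^sup>2)" by (rule DERIV_arctan)
      have "1 + x\<^sup>2 \<noteq> 0" using add_pos_nonneg[of 1 "x\<^sup>2"] by simp
      then show "isCont (\<lambda>x. inverse (1 + x\<^sup>2)) x" by (intro continuous_intros)
    next
      show "((arctan \<circ> real_of_ereal) \<longlongrightarrow> - (pi / 2)) (at_right (- \<infinity>))"
        "((arctan \<circ> real_of_ereal) \<longlongrightarrow> pi / 2) (at_left \<infinity>)"
        by (simp_all add: ereal_tendsto_simps1 tendsto_arctan_at_bot tendsto_arctan_at_top)
    qed (auto intro!: AE_I2)
    then show "integrable lborel (\<lambda>x::real. inverse (1 + x\<^sup>2))"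
      by (simp add: set_integrable_def einterval_def)
  qed
  show "AE x in lborel. norm (f x) \<le> norm (C * inverse (1 + x\<^sup>2))"
    using assms(2) by (intro AE_I2) (metis abs_ge_self order_trans real_norm_def)
qed (rule assms)

lemma has_vector_derivative_at_of_one_sided:
  assumes "(f has_vector_derivative f') (at (x::real) within {..x})" "(f has_vector_derivative f') (at x within {x..})"
  shows "(f has_vector_derivative f') (at x)"
proof -
  have "(f has_vector_derivative f') (at x within ({..x} \<union> {x..}))"
    using assms unfolding has_vector_derivative_def has_derivative_within
    unfolding at_within_union by (auto intro: filterlim_sup)
  moreover have "{..x} \<union> {x..} = UNIV" by auto
  ultimately show ?thesis by simp
qed

section \<open>Jost solutions and scattering data\<close>

context half_line_pulse
begin

text \<open>One integration by parts against the oscillation, carried out as a change of unknown so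
  that it covers the closed upper half-plane uniformly in t.\<close>

lemma zs_decay:
  obtains K where "K \<ge> 0" "\<And>\<xi> t. Im \<xi> \<ge> 0 \<Longrightarrow> \<xi> \<noteq> 0 \<Longrightarrow> t \<ge> 0 \<Longrightarrow> norm (fst (zs \<xi> t)) \<le> K / norm \<xi>"
proof -
  obtain k1 where k1': "\<forall>n t. t \<ge> 0 \<longrightarrow> norm (vderiv_iter 1 q0 t) * (1 + t) ^ n \<le> k1 n"
    using rapid_vderiv_iter[of 1] by blast
  then have k1: "norm (vderiv_iter 1 q0 t) * (1 + t)\<^sup>2 \<le> k1 2" if "t \<ge> 0" for t
    using that by blast
  define C where "C = k1 2 + qK 0 * qK 2"
  have "0 \<le> k1 2" using order_trans[OF _ k1[of 0]] by simp
  then have C0: "C \<ge> 0" using qK_nonneg by (simp add: C_def)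
  have main: "norm (fst (zs \<xi> t)) \<le> (C + qK 0) / norm \<xi>" if xi: "Im \<xi> \<ge> 0" "\<xi> \<noteq> 0" and t: "t \<ge> 0" for \<xi> t
  proof -
    \<comment> \<open>Chosen to cancel the source \<open>q0 s * snd (zs \<xi> s)\<close>: what
      remains in the equation for \<open>g\<close> is \<open>h\<close>, which has a factor
      \<open>1 / \<xi>\<close> and is integrable in time. The initial value is 0 because
      \<open>q0 0 = 0\<close>.\<close>
    define g where "g s = fst (zs \<xi> s) + q0 s * snd (zs \<xi> s) / (2 * \<i> * \<xi>)" for s
    define h where "h s = (vderiv_iter 1 q0 s * snd (zs \<xi> s) - q0 s * cnj (q0 s) * fst (zs \<xi> s)) / (2 * \<i> * \<xi>)" for s
    define c where "c = C / (2 * norm \<xi>)"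
    have c0: "c \<ge> 0" using C0 by (simp add: c_def)
    have le1: "norm (fst (zs \<xi> s)) \<le> 1" "norm (snd (zs \<xi> s)) \<le> 1" if "s \<ge> 0" for s
      using norm_zs_upper[OF that xi(1)] norm_fst_zs_le[of \<xi> s] norm_snd_zs_le[of \<xi> s] by linarith+
    have "norm (g t) \<le> norm (g 0) + (- c / (1 + t)) - (- c / (1 + 0))"
    proof (rule norm_growth_bound[OF t, where g' = "\<lambda>s. c / (1 + s)\<^sup>2" and x' = "\<lambda>s. 2 * \<i> * \<xi> * g s + h s"])
      fix s assume s: "s \<in> {0..t}"
      have "(g has_vector_derivative 2 * \<i> * \<xi> * fst (zs \<xi> s) + q0 s * snd (zs \<xi> s) +
          (q0 s * (- cnj (q0 s) * fst (zs \<xi> s)) + vderiv_iter 1 q0 s * snd (zs \<xi> s)) / (2 * \<i> * \<xi>)) (at s within {0..t})"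
        unfolding g_def
        by (intro has_vector_derivative_add has_vector_derivative_divide has_vector_derivative_mult
            fst_zs_deriv[OF s order_refl] snd_zs_deriv[OF s order_refl] q0_deriv)
      moreover have "2 * \<i> * \<xi> * fst (zs \<xi> s) + q0 s * snd (zs \<xi> s) +
          (q0 s * (- cnj (q0 s) * fst (zs \<xi> s)) + vderiv_iter 1 q0 s * snd (zs \<xi> s)) / (2 * \<i> * \<xi>) = 2 * \<i> * \<xi> * g s + h s"
        using xi(2) by (simp add: g_def h_def field_simps)
      ultimately show "(g has_vector_derivative 2 * \<i> * \<xi> * g s + h s) (at s within {0..t})" by simp
      show "((\<lambda>x. - c / (1 + x)) has_real_derivative c / (1 + s)\<^sup>2) (at s within {0..t})"
        using s by (auto intro!: derivative_eq_intros simp: power2_eq_square)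
      show "0 \<le> c / (1 + s)\<^sup>2" using c0 by simp
      have s0: "s \<ge> 0" using s by simp
      have p: "(1 + s)\<^sup>2 > 0" using s0 by simp
      have "norm (vderiv_iter 1 q0 s * snd (zs \<xi> s) - q0 s * cnj (q0 s) * fst (zs \<xi> s)) \<le>
          norm (vderiv_iter 1 q0 s) * norm (snd (zs \<xi> s)) + norm (q0 s) * norm (q0 s) * norm (fst (zs \<xi> s))"
        by (rule order_trans[OF norm_triangle_ineq4]) (simp add: norm_mult)
      also have "\<dots> \<le> norm (vderiv_iter 1 q0 s) * 1 + qK 0 * norm (q0 s) * 1"
        using le1[OF s0] qK[OF s0, of 0] qK_nonneg by (intro add_mono mult_mono) auto
      also have "\<dots> \<le> k1 2 / (1 + s)\<^sup>2 + qK 0 * (qK 2 / (1 + s)\<^sup>2)"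
      proof -
        have "norm (vderiv_iter 1 q0 s) \<le> k1 2 / (1 + s)\<^sup>2" "norm (q0 s) \<le> qK 2 / (1 + s)\<^sup>2"
          using k1[OF s0] qK[OF s0, of 2] p by (simp_all only: pos_le_divide_eq)
        then show ?thesis using qK_nonneg[of 0]
          unfolding mult_1_right by (intro add_mono mult_left_mono)
      qed
      also have "\<dots> = C / (1 + s)\<^sup>2" by (simp add: C_def add_divide_distrib)
      finally have "norm (vderiv_iter 1 q0 s * snd (zs \<xi> s) - q0 s * cnj (q0 s) * fst (zs \<xi> s)) / (2 * norm \<xi>) \<le>
          C / (1 + s)\<^sup>2 / (2 * norm \<xi>)"
        by (rule divide_right_mono) simp
      then have "norm (h s) \<le> C / (1 + s)\<^sup>2 / (2 * norm \<xi>)"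
        unfolding h_def norm_divide by (simp only: norm_mult norm_ii norm_numeral mult_1_right)
      also have "\<dots> = c / (1 + s)\<^sup>2" by (simp add: c_def)
      finally have hb: "norm (h s) \<le> c / (1 + s)\<^sup>2" .
      have "inner (g s) (2 * \<i> * \<xi> * g s) = - 2 * Im \<xi> * (norm (g s))\<^sup>2"
        unfolding inner_complex_def cmod_power2 by (simp add: algebra_simps power2_eq_square)
      then have "inner (g s) (2 * \<i> * \<xi> * g s) \<le> 0" using xi(1) by simp
      moreover have "inner (g s) (h s) \<le> norm (g s) * (c / (1 + s)\<^sup>2)"
        by (rule order_trans[OF norm_cauchy_schwarz mult_left_mono[OF hb norm_ge_zero]])
      ultimately show "inner (g s) (2 * \<i> * \<xi> * g s + h s) \<le> norm (g s) * (c / (1 + s)\<^sup>2)"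
        by (simp add: inner_add_right)
    qed
    moreover have "g 0 = 0" by (simp add: g_def zs_0 q0_0)
    moreover have "0 \<le> c / (1 + t)" using c0 t by simp
    ultimately have gb: "norm (g t) \<le> c" by simp
    have "norm (q0 t * snd (zs \<xi> t) / (2 * \<i> * \<xi>)) \<le> qK 0 * 1 / (2 * norm \<xi>)"
      unfolding norm_divide norm_mult using le1[OF t] qK[OF t, of 0] qK_nonneg
      by (intro divide_mono mult_mono) (auto simp: xi)
    moreover have "fst (zs \<xi> t) = g t - q0 t * snd (zs \<xi> t) / (2 * \<i> * \<xi>)" by (simp add: g_def)
    ultimately have "norm (fst (zs \<xi> t)) \<le> c + qK 0 / (2 * norm \<xi>)"
      using gb norm_triangle_ineq4[of "g t" "q0 t * snd (zs \<xi> t) / (2 * \<i> * \<xi>)"] by simp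
    also have "\<dots> = (C + qK 0) / norm \<xi> / 2" by (simp add: c_def add_divide_distrib)
    also have "\<dots> \<le> (C + qK 0) / norm \<xi>"
    proof -
      have "0 \<le> (C + qK 0) / norm \<xi>" using C0 qK_nonneg[of 0] by simp
      moreover have "y / 2 \<le> y" if "0 \<le> y" for y :: real using that by simp
      ultimately show ?thesis by blast
    qed
    finally show ?thesis .
  qed
  show thesis by (rule that[OF _ main]) (use C0 qK_nonneg in auto)
qed

lemma scattering_decay:
  obtains K where "K \<ge> 0" "\<And>\<xi>. Im \<xi> \<ge> 0 \<Longrightarrow> \<xi> \<noteq> 0 \<Longrightarrow> norm (sa \<xi> - 1) \<le> K / norm \<xi>"
    "\<And>x. x \<noteq> 0 \<Longrightarrow> norm (sb x) \<le> K / \<bar>x\<bar>"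
proof -
  obtain K where K: "K \<ge> 0" "\<And>\<xi> t. Im \<xi> \<ge> 0 \<Longrightarrow> \<xi> \<noteq> 0 \<Longrightarrow> t \<ge> 0 \<Longrightarrow> norm (fst (zs \<xi> t)) \<le> K / norm \<xi>"
    by (rule zs_decay) (assumption | rule that)+
  have a: "norm (sa \<xi> - 1) \<le> K * qK 2 / norm \<xi>" if xi: "Im \<xi> \<ge> 0" "\<xi> \<noteq> 0" for \<xi>
  proof -
    define c where "c = K / norm \<xi> * qK 2"
    have c0: "c \<ge> 0" using K(1) qK_nonneg by (simp add: c_def)
    have b: "norm (snd (zs \<xi> t) - 1) \<le> c" if t: "t \<ge> 0" for t
    proof -
      have "norm (snd (zs \<xi> t) - 1) \<le> norm (snd (zs \<xi> 0) - 1) + (- c / (1 + t)) - (- c / (1 + 0))"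
      proof (rule norm_growth_bound[OF t, where x = "\<lambda>t. snd (zs \<xi> t) - 1" and g' = "\<lambda>s. c / (1 + s)\<^sup>2"
            and x' = "\<lambda>s. - cnj (q0 s) * fst (zs \<xi> s)"])
        fix s assume s: "s \<in> {0..t}"
        show "((\<lambda>t. snd (zs \<xi> t) - 1) has_vector_derivative - cnj (q0 s) * fst (zs \<xi> s)) (at s within {0..t})"
          using has_vector_derivative_diff[OF snd_zs_deriv[OF s order_refl] has_vector_derivative_const] by simp
        show "((\<lambda>x. - c / (1 + x)) has_real_derivative c / (1 + s)\<^sup>2) (at s within {0..t})"
          using s by (auto intro!: derivative_eq_intros simp: power2_eq_square)
        show "0 \<le> c / (1 + s)\<^sup>2" using c0 by simp
        have "norm (q0 s) \<le> qK 2 / (1 + s)\<^sup>2" using qK[of s 2] s by (simp add: pos_le_divide_eq)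
        then have "norm (- cnj (q0 s) * fst (zs \<xi> s)) \<le> qK 2 / (1 + s)\<^sup>2 * (K / norm \<xi>)"
          unfolding norm_mult norm_minus_cancel complex_mod_cnj
          using K(2)[OF xi, of s] s qK_nonneg by (intro mult_mono) auto
        also have "\<dots> = c / (1 + s)\<^sup>2" by (simp add: c_def mult_ac)
        finally have "norm (- cnj (q0 s) * fst (zs \<xi> s)) \<le> c / (1 + s)\<^sup>2" .
        then show "inner (snd (zs \<xi> s) - 1) (- cnj (q0 s) * fst (zs \<xi> s)) \<le> norm (snd (zs \<xi> s) - 1) * (c / (1 + s)\<^sup>2)"
          by (intro order_trans[OF norm_cauchy_schwarz mult_left_mono]) auto
      qed
      moreover have "0 \<le> c / (1 + t)" using c0 t by simp
      ultimately show ?thesis by (simp add: zs_0)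
    qed
    have "((\<lambda>t. norm (snd (zs \<xi> t) - 1)) \<longlongrightarrow> norm (sa \<xi> - 1)) at_top"
      by (intro tendsto_intros snd_zs_limit xi)
    then have "norm (sa \<xi> - 1) \<le> c"
      by (rule tendsto_upperbound) (use b in \<open>auto simp: eventually_at_top_linorder\<close>)
    then show ?thesis by (simp add: c_def)
  qed
  have b: "norm (sb x) \<le> K / \<bar>x\<bar>" if x: "x \<noteq> 0" for x
  proof -
    have "((\<lambda>t. norm (osc (of_real x) t)) \<longlongrightarrow> norm (cnj (sb x))) at_top"
      by (intro tendsto_intros osc_limit)
    then have "norm (cnj (sb x)) \<le> K / \<bar>x\<bar>"
      by (rule tendsto_upperbound)
        (use K(2)[of "of_real x"] x in \<open>auto simp: eventually_at_top_linorder norm_osc_real\<close>)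
    then show ?thesis by simp
  qed
  show thesis
  proof (rule that[of "K * qK 2 + K"])
    show "0 \<le> K * qK 2 + K" using K(1) qK_nonneg by simp
    show "norm (sa \<xi> - 1) \<le> (K * qK 2 + K) / norm \<xi>" if "Im \<xi> \<ge> 0" "\<xi> \<noteq> 0" for \<xi>
      using a[OF that] K(1) divide_right_mono[of "K * qK 2" "K * qK 2 + K" "norm \<xi>"] by simp
    show "norm (sb x) \<le> (K * qK 2 + K) / \<bar>x\<bar>" if "x \<noteq> 0" for x
      using b[OF that] mult_nonneg_nonneg[OF K(1) qK_nonneg[of 2]] divide_right_mono[of K "K * qK 2 + K" "\<bar>x\<bar>"] by simp
  qed
qed

text \<open>For \<open>t < 0\<close> the pulse is zero and \<open>(0, 1)\<close> is stationary, so
  freezing the solution at its initial value continues it to the whole line; at 0 both one-sided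
  derivatives vanish.\<close>

lemma zs_full_line_deriv:
  "((\<lambda>t. zs \<xi> (max 0 t)) has_vector_derivative zs_rhs (q0 t) \<xi> (zs \<xi> (max 0 t))) (at t)"
proof -
  have neg: "zs_rhs 0 \<xi> (0, 1) = 0" by (simp add: zs_rhs_def zero_prod_def)
  have right: "((\<lambda>t. zs \<xi> (max 0 t)) has_vector_derivative zs_rhs (q0 t) \<xi> (zs \<xi> (max 0 t))) (at t within {0..})"
    if "t \<ge> 0" for t
    using zs_deriv[OF that, of \<xi>] that
    by (auto simp: max_absorb2 intro: has_vector_derivative_transform[rotated 2])
  have left: "((\<lambda>t. zs \<xi> (max 0 t)) has_vector_derivative 0) (at t within {..0})" if "t \<le> 0" for t
    by (rule has_vector_derivative_transform[OF _ _ has_vector_derivative_const[of "(0, 1)"]])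
      (use that in \<open>auto simp: zs_0 max_absorb1\<close>)
  consider "t < 0" | "t = 0" | "t > 0" by linarith
  then show ?thesis
  proof cases
    case 1
    then have "at t within {..0} = at t" by (intro at_within_interior) simp
    with left[of t] 1 show ?thesis by (simp add: support zs_0 neg max_absorb1)
  next
    case 2
    have "((\<lambda>t. zs \<xi> (max 0 t)) has_vector_derivative 0) (at 0)"
      using left[of 0] right[of 0] neg
      by (intro has_vector_derivative_at_of_one_sided) (simp_all add: q0_0 zs_0)
    then show ?thesis using 2 by (simp add: q0_0 zs_0 neg)
  next
    case 3
    then have "at t within {0..} = at t" by (intro at_within_interior) simp
    with right[of t] 3 show ?thesis by simp
  qed
qed

lemma exp_linear_vderiv:
  fixes c :: complex
  shows "((\<lambda>t. exp (c * of_real t)) has_vector_derivative c * exp (c * of_real t)) (at t)"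
proof -
  have "((\<lambda>w. exp (c * w)) has_field_derivative c * exp (c * of_real t)) (at (of_real t))"
    by (auto intro!: derivative_eq_intros)
  moreover have "((\<lambda>t. of_real t :: complex) has_vector_derivative 1) (at t)"
    by (auto intro!: derivative_eq_intros)
  ultimately have "(((\<lambda>w. exp (c * w)) \<circ> of_real) has_vector_derivative 1 * (c * exp (c * of_real t))) (at t)"
    by (intro field_vector_diff_chain_at)
  then show ?thesis by (simp add: o_def)
qed

text \<open>The Jost column is \<open>sa\<close> times the first plus \<open>sb\<close> times the
  second column of the solution that is the identity at \<open>t = 0\<close>. The second column
  comes from \<open>zs\<close>; the first follows from it by the conjugation symmetry of the system
  at real \<open>\<xi>\<close>.\<close>

definition jost_first :: "real \<Rightarrow> real \<Rightarrow> complex" where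
  "jost_first \<xi> t = exp (\<i> * of_real \<xi> * of_real t) * (cnj (snd (zs (of_real \<xi>) (max 0 t))) * sa (of_real \<xi>))
     + exp (- (\<i> * of_real \<xi>) * of_real t) * (fst (zs (of_real \<xi>) (max 0 t)) * sb \<xi>)"

definition jost_second :: "real \<Rightarrow> real \<Rightarrow> complex" where
  "jost_second \<xi> t = - (exp (\<i> * of_real \<xi> * of_real t) * (cnj (fst (zs (of_real \<xi>) (max 0 t))) * sa (of_real \<xi>)))
     + exp (- (\<i> * of_real \<xi>) * of_real t) * (snd (zs (of_real \<xi>) (max 0 t)) * sb \<xi>)"

lemma jost_deriv:
  "(jost_first \<xi> has_vector_derivative \<i> * of_real \<xi> * jost_first \<xi> t + q0 t * jost_second \<xi> t) (at t)"
  "(jost_second \<xi> has_vector_derivative - cnj (q0 t) * jost_first \<xi> t - \<i> * of_real \<xi> * jost_second \<xi> t) (at t)"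
proof -
  let ?n = "\<lambda>t. zs (of_real \<xi>) (max 0 t)"
  let ?x = "complex_of_real \<xi>"
  have f: "((\<lambda>t. fst (?n t)) has_vector_derivative 2 * \<i> * ?x * fst (?n t) + q0 t * snd (?n t)) (at t)"
    using bounded_linear.has_vector_derivative[OF bounded_linear_fst zs_full_line_deriv[of ?x t]] by (simp add: zs_rhs_def)
  have s: "((\<lambda>t. snd (?n t)) has_vector_derivative - cnj (q0 t) * fst (?n t)) (at t)"
    using bounded_linear.has_vector_derivative[OF bounded_linear_snd zs_full_line_deriv[of ?x t]] by (simp add: zs_rhs_def)
  note cf = bounded_linear.has_vector_derivative[OF bounded_linear_cnj f]
  note cs = bounded_linear.has_vector_derivative[OF bounded_linear_cnj s]
  have c: "((\<lambda>t. g t * k) has_vector_derivative g' * k) (at t)" if "(g has_vector_derivative g') (at t)" for g g' and k :: complex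
    using has_vector_derivative_mult[OF that has_vector_derivative_const, of k] by simp
  have 1: "((\<lambda>t. exp (\<i> * ?x * of_real t) * (cnj (snd (?n t)) * sa ?x) + exp (- (\<i> * ?x) * of_real t) * (fst (?n t) * sb \<xi>)) has_vector_derivative
     (exp (\<i> * ?x * of_real t) * (cnj (- cnj (q0 t) * fst (?n t)) * sa ?x) + \<i> * ?x * exp (\<i> * ?x * of_real t) * (cnj (snd (?n t)) * sa ?x)) +
     (exp (- (\<i> * ?x) * of_real t) * ((2 * \<i> * ?x * fst (?n t) + q0 t * snd (?n t)) * sb \<xi>) + - (\<i> * ?x) * exp (- (\<i> * ?x) * of_real t) * (fst (?n t) * sb \<xi>))) (at t)"
    by (rule has_vector_derivative_add[OF has_vector_derivative_mult[OF exp_linear_vderiv c[OF cs]]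
          has_vector_derivative_mult[OF exp_linear_vderiv c[OF f]]])
  show "(jost_first \<xi> has_vector_derivative \<i> * of_real \<xi> * jost_first \<xi> t + q0 t * jost_second \<xi> t) (at t)"
    using 1 unfolding jost_first_def[abs_def] jost_second_def by (simp add: algebra_simps)
  have 2: "((\<lambda>t. - (exp (\<i> * ?x * of_real t) * (cnj (fst (?n t)) * sa ?x)) + exp (- (\<i> * ?x) * of_real t) * (snd (?n t) * sb \<xi>)) has_vector_derivative
     - (exp (\<i> * ?x * of_real t) * (cnj (2 * \<i> * ?x * fst (?n t) + q0 t * snd (?n t)) * sa ?x) + \<i> * ?x * exp (\<i> * ?x * of_real t) * (cnj (fst (?n t)) * sa ?x)) +
     (exp (- (\<i> * ?x) * of_real t) * ((- cnj (q0 t) * fst (?n t)) * sb \<xi>) + - (\<i> * ?x) * exp (- (\<i> * ?x) * of_real t) * (snd (?n t) * sb \<xi>))) (at t)"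
    by (rule has_vector_derivative_add[OF has_vector_derivative_minus[OF has_vector_derivative_mult[OF exp_linear_vderiv c[OF cf]]]
          has_vector_derivative_mult[OF exp_linear_vderiv c[OF s]]])
  show "(jost_second \<xi> has_vector_derivative - cnj (q0 t) * jost_first \<xi> t - \<i> * of_real \<xi> * jost_second \<xi> t) (at t)"
    using 2 unfolding jost_first_def jost_second_def[abs_def] by (simp add: algebra_simps)
qed

text \<open>In the limit the combinations become \<open>|sa|^2 + |sb|^2 = 1\<close> and
  \<open>sa * sb - sb * sa = 0\<close>.\<close>

lemma jost_limits:
  "((\<lambda>t. jost_first \<xi> t - exp (\<i> * of_real (\<xi> * t))) \<longlongrightarrow> 0) at_top"
  "(jost_second \<xi> \<longlongrightarrow> 0) at_top"
proof -
  let ?x = "complex_of_real \<xi>"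
  have sl: "((\<lambda>t. snd (zs ?x t)) \<longlongrightarrow> sa ?x) at_top" by (rule snd_zs_limit) simp
  have ee: "exp (- (\<i> * ?x) * of_real t) = exp (\<i> * ?x * of_real t) * exp (- (2 * \<i> * ?x * of_real t))" for t
    unfolding exp_add[symmetric] by (rule arg_cong[of _ _ exp]) (simp add: algebra_simps)
  have ee': "exp (\<i> * ?x * of_real t) = exp (- (\<i> * ?x) * of_real t) * cnj (exp (- (2 * \<i> * ?x * of_real t)))" for t
  proof -
    have "cnj (exp (- (2 * \<i> * ?x * of_real t))) = exp (2 * \<i> * ?x * of_real t)"
      by (simp add: exp_cnj)
    then show ?thesis
      unfolding exp_add[symmetric] by (simp only: exp_add[symmetric]) (rule arg_cong[of _ _ exp], simp add: algebra_simps)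
  qed
  have one: "cnj (sa ?x) * sa ?x + cnj (sb \<xi>) * sb \<xi> = 1"
  proof -
    have "cnj (sa ?x) * sa ?x + cnj (sb \<xi>) * sb \<xi> = of_real ((norm (sa ?x))\<^sup>2 + (norm (sb \<xi>))\<^sup>2)"
      by (simp add: complex_norm_square mult.commute del: of_real_power)
    then show ?thesis by (simp only: sa_sb of_real_1)
  qed
  show "((\<lambda>t. jost_first \<xi> t - exp (\<i> * of_real (\<xi> * t))) \<longlongrightarrow> 0) at_top"
  proof (rule Lim_null_comparison)
    show "\<forall>\<^sub>F t in at_top. norm (jost_first \<xi> t - exp (\<i> * of_real (\<xi> * t))) \<le>
        norm (cnj (snd (zs ?x t)) * sa ?x + osc ?x t * sb \<xi> - 1)"
      using eventually_ge_at_top[of 0]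
    proof eventually_elim
      case (elim t)
      have "jost_first \<xi> t - exp (\<i> * of_real (\<xi> * t)) =
          exp (\<i> * ?x * of_real t) * (cnj (snd (zs ?x t)) * sa ?x + osc ?x t * sb \<xi> - 1)"
        unfolding jost_first_def osc_def ee using elim by (simp add: algebra_simps)
      then show ?case by (simp add: norm_mult)
    qed
    have "((\<lambda>t. norm (cnj (snd (zs ?x t)) * sa ?x + osc ?x t * sb \<xi> - 1)) \<longlongrightarrow> norm (cnj (sa ?x) * sa ?x + cnj (sb \<xi>) * sb \<xi> - 1)) at_top"
      by (intro tendsto_intros sl osc_limit)
    then show "((\<lambda>t. norm (cnj (snd (zs ?x t)) * sa ?x + osc ?x t * sb \<xi> - 1)) \<longlongrightarrow> 0) at_top"
      by (simp add: one)
  qed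
  show "(jost_second \<xi> \<longlongrightarrow> 0) at_top"
  proof (rule Lim_null_comparison)
    show "\<forall>\<^sub>F t in at_top. norm (jost_second \<xi> t) \<le> norm (snd (zs ?x t) * sb \<xi> - cnj (osc ?x t) * sa ?x)"
      using eventually_ge_at_top[of 0]
    proof eventually_elim
      case (elim t)
      have "jost_second \<xi> t = exp (- (\<i> * ?x) * of_real t) * (snd (zs ?x t) * sb \<xi> - cnj (osc ?x t) * sa ?x)"
        unfolding jost_second_def osc_def ee' using elim by (simp add: algebra_simps)
      then show ?case by (simp add: norm_mult)
    qed
    have "((\<lambda>t. norm (snd (zs ?x t) * sb \<xi> - cnj (osc ?x t) * sa ?x)) \<longlongrightarrow> norm (sa ?x * sb \<xi> - cnj (cnj (sb \<xi>)) * sa ?x)) at_top"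
      by (intro tendsto_intros sl osc_limit)
    then show "((\<lambda>t. norm (snd (zs ?x t) * sb \<xi> - cnj (osc ?x t) * sa ?x)) \<longlongrightarrow> 0) at_top"
      by (simp add: mult.commute)
  qed
qed

lemma jost_plus_eq:
  "jost_plus q0 t \<xi> = mat2 (jost_first \<xi> t, - cnj (jost_second \<xi> t), jost_second \<xi> t, cnj (jost_first \<xi> t))"
proof -
  let ?\<phi> = "\<lambda>t. mat2 (jost_first \<xi> t, - cnj (jost_second \<xi> t), jost_second \<xi> t, cnj (jost_first \<xi> t))"
  have "is_jost_plus q0 \<xi> ?\<phi>"
    unfolding is_jost_plus_def
  proof (intro conjI allI)
    fix t
    note d = jost_deriv[of \<xi> t]
    note cd = bounded_linear.has_vector_derivative[OF bounded_linear_cnj d(1)] bounded_linear.has_vector_derivative[OF bounded_linear_cnj d(2)]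
    have "(?\<phi> has_vector_derivative mat2 (\<i> * of_real \<xi> * jost_first \<xi> t + q0 t * jost_second \<xi> t,
       - cnj (- cnj (q0 t) * jost_first \<xi> t - \<i> * of_real \<xi> * jost_second \<xi> t),
       - cnj (q0 t) * jost_first \<xi> t - \<i> * of_real \<xi> * jost_second \<xi> t,
       cnj (\<i> * of_real \<xi> * jost_first \<xi> t + q0 t * jost_second \<xi> t))) (at t)"
      by (rule bounded_linear.has_vector_derivative[OF bounded_linear_mat2
            has_vector_derivative_Pair[OF d(1) has_vector_derivative_Pair[OF has_vector_derivative_minus[OF cd(2)]
              has_vector_derivative_Pair[OF d(2) cd(1)]]]])
    then show "(?\<phi> has_vector_derivative zs_matrix q0 \<xi> t ** ?\<phi> t) (at t)"
      unfolding zs_matrix_mat2 mat2_mult by (simp add: algebra_simps)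
  next
    have "((\<lambda>t. mat2 (jost_first \<xi> t - exp (\<i> * of_real (\<xi> * t)), - cnj (jost_second \<xi> t), jost_second \<xi> t,
        cnj (jost_first \<xi> t - exp (\<i> * of_real (\<xi> * t))))) \<longlongrightarrow> mat2 (0, - cnj 0, 0, cnj 0)) at_top"
      by (rule bounded_linear.tendsto[OF bounded_linear_mat2]) (intro tendsto_intros jost_limits)
    moreover have "mat2 (jost_first \<xi> t - exp (\<i> * of_real (\<xi> * t)), - cnj (jost_second \<xi> t), jost_second \<xi> t,
        cnj (jost_first \<xi> t - exp (\<i> * of_real (\<xi> * t)))) = ?\<phi> t - exp_sigma3 (\<i> * complex_of_real (\<xi> * t))" for t
      unfolding exp_sigma3_mat2 bounded_linear.linear[OF bounded_linear_mat2, THEN linear_diff, symmetric]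
      by (simp add: exp_cnj)
    moreover have "mat2 (0, - cnj 0, 0, cnj 0) = 0"
      by (subst mat2_cases[of 0]) simp
    ultimately show "((\<lambda>t. ?\<phi> t - exp_sigma3 (\<i> * complex_of_real (\<xi> * t))) \<longlongrightarrow> 0) at_top"
      by simp
  qed
  then have "(THE \<phi>. is_jost_plus q0 \<xi> \<phi>) = ?\<phi>"
    by (intro the_equality[where P = "is_jost_plus q0 \<xi>"] is_jost_plus_unique)
  then show ?thesis by (simp add: jost_plus_def)
qed

lemma jost_plus_0: "jost_plus q0 0 \<xi> = mat2 (sa (of_real \<xi>), - cnj (sb \<xi>), sb \<xi>, cnj (sa (of_real \<xi>)))"
  unfolding jost_plus_eq by (simp add: jost_first_def jost_second_def zs_0)

lemma reflection_coeff_eq: "reflection_coeff q0 \<xi> = sb \<xi> / sa (of_real \<xi>)"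
  by (simp add: reflection_coeff_def jost_plus_0)

lemma S11_eq: assumes "Im w \<ge> 0" shows "S11 q0 w = sa w"
proof -
  let ?P = "\<lambda>F. continuous_on {w. Im w \<ge> 0} F \<and> F analytic_on {w. Im w > 0} \<and>
             (\<forall>x. F (complex_of_real x) = sa (of_real x)) \<and> (\<forall>w. Im w < 0 \<longrightarrow> F w = 0)"
  let ?F = "\<lambda>w. if Im w \<ge> 0 then sa w else 0"
  have 1: "?P ?F"
  proof (intro conjI allI impI)
    show "continuous_on {w. Im w \<ge> 0} ?F" by (rule continuous_on_eq[OF sa_cont]) simp
    have "?F holomorphic_on {w. Im w > 0}" by (rule holomorphic_transform[OF sa_holomorphic]) simp
    then show "?F analytic_on {w. Im w > 0}" by (simp add: analytic_on_open open_halfspace_Im_gt)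
  qed auto
  have "(THE F. ?P F) = ?F"
  proof (rule the_equality[where P = ?P, OF 1])
    fix G assume G: "?P G"
    show "G = ?F"
    proof
      fix w
      show "G w = ?F w"
      proof (cases "Im w \<ge> 0")
        case True
        show ?thesis
          by (rule upper_half_plane_extension_unique[of G ?F]) (use G 1 True in auto)
      next
        case False
        then show ?thesis using G by simp
      qed
    qed
  qed
  then show ?thesis
    using assms by (simp add: S11_def upper_extension_def jost_plus_0)
qed

end

section \<open>The reflection coefficient and the phase\<close>

locale soliton_free_pulse = half_line_pulse +
  assumes no_eigenvalues: "discrete_eigenvalues q0 = {}"
    and no_singularities: "spectral_singularities q0 = {}"
begin

abbreviation r :: "real \<Rightarrow> complex" where "r \<equiv> reflection_coeff q0"

lemma sa_nonzero: assumes "Im w \<ge> 0" shows "sa w \<noteq> 0"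
proof (cases "Im w > 0")
  case True
  then show ?thesis
    using no_eigenvalues S11_eq[OF assms] by (auto simp: discrete_eigenvalues_def)
next
  case False
  then have w: "w = of_real (Re w)" using assms by (simp add: complex_eq_iff)
  have "S11 q0 (of_real (Re w)) \<noteq> 0"
    using no_singularities by (auto simp: spectral_singularities_def)
  then show ?thesis using S11_eq[OF assms] w by simp
qed

lemma sb_eq: "sb x = r x * sa (of_real x)"
  using sa_nonzero[of "of_real x"] by (simp add: reflection_coeff_eq)

lemma r_times_differentiable: "times_differentiable n r"
proof -
  have "times_differentiable n (\<lambda>x. sb x * inverse (sa (of_real x)))"
    by (rule times_differentiable_mult[OF sb_times_differentiable
          times_differentiable_inverse[OF sa_times_differentiable]]) (simp add: sa_nonzero)
  moreover have "r = (\<lambda>x. sb x * inverse (sa (of_real x)))"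
    by (rule ext) (simp add: reflection_coeff_eq divide_inverse)
  ultimately show ?thesis by simp
qed

lemma r_vderiv: "(r has_vector_derivative vderiv_iter 1 r x) (at x within S)"
  using has_vderiv_iter[OF r_times_differentiable, of 0 x S] by (simp add: vderiv_iter_def)

lemma vderiv_r_cont: "continuous_on S (vderiv_iter 1 r)"
  by (rule continuous_on_vector_derivative[OF has_vderiv_iter[OF r_times_differentiable]])

lemma ln_one_plus_r: "ln (1 + (norm (r x))\<^sup>2) = - 2 * ln (norm (sa (of_real x)))"
proof -
  have nz: "norm (sa (of_real x)) > 0" using sa_nonzero[of "of_real x"] by simp
  have "1 + (norm (r x))\<^sup>2 = 1 / (norm (sa (of_real x)))\<^sup>2"
    using sa_sb[of x] nz by (simp add: reflection_coeff_eq norm_divide power_divide field_simps)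
  then show ?thesis using nz by (simp add: ln_div ln_realpow)
qed

text \<open>Near 0 the smooth function r vanishes at least linearly, so its square absorbs
  \<open>1 / \<bar>x\<bar>\<close>. Far out \<open>sb\<close> is of order
  \<open>1 / \<bar>x\<bar>\<close> while \<open>sa\<close> stays at least 1/2 in modulus.\<close>

lemma r_bound_near_far:
  assumes r0: "r 0 = 0"
  obtains C where "\<And>x. (norm (r x))\<^sup>2 / \<bar>x\<bar> \<le> C * inverse (1 + x\<^sup>2)"
proof -
  obtain K where K: "K \<ge> 0" "\<And>\<xi>. Im \<xi> \<ge> 0 \<Longrightarrow> \<xi> \<noteq> 0 \<Longrightarrow> norm (sa \<xi> - 1) \<le> K / norm \<xi>"
    "\<And>x. x \<noteq> 0 \<Longrightarrow> norm (sb x) \<le> K / \<bar>x\<bar>"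
    by (rule scattering_decay) (rule that)
  define R where "R = 2 * K + 1"
  have R: "R \<ge> 1" using K(1) by (simp add: R_def)
  have "bounded (vderiv_iter 1 r ` {-R..R})"
    by (intro compact_imp_bounded compact_continuous_image vderiv_r_cont) auto
  then obtain B where B: "\<And>x. x \<in> {-R..R} \<Longrightarrow> norm (vderiv_iter 1 r x) \<le> B" unfolding bounded_iff by blast
  have B0: "B \<ge> 0" using order_trans[OF norm_ge_zero B[of 0]] R by simp
  have inc: "norm (r b - r a) \<le> B * (b - a)" if ab: "a \<le> b" "-R \<le> a" "b \<le> R" for a b
  proof -
    have "norm (r b - r a) \<le> norm (r a - r a) + B * b - B * a"
    proof (rule norm_growth_bound[OF ab(1), where x = "\<lambda>x. r x - r a" and x' = "vderiv_iter 1 r" and g' = "\<lambda>_. B"])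
      fix t assume t: "t \<in> {a..b}"
      show "((\<lambda>x. r x - r a) has_vector_derivative vderiv_iter 1 r t) (at t within {a..b})"
        using has_vector_derivative_diff[OF r_vderiv has_vector_derivative_const] by simp
      show "((\<lambda>t. B * t) has_real_derivative B) (at t within {a..b})" by (auto intro!: derivative_eq_intros)
      have "norm (vderiv_iter 1 r t) \<le> B" using t ab by (intro B) auto
      then show "inner (r t - r a) (vderiv_iter 1 r t) \<le> norm (r t - r a) * B"
        by (intro order_trans[OF norm_cauchy_schwarz mult_left_mono]) auto
    qed (use B0 in auto)
    then show ?thesis by (simp add: right_diff_distrib)
  qed
  have near: "norm (r x) \<le> B * \<bar>x\<bar>" if "\<bar>x\<bar> \<le> R" for x
    using inc[of 0 x] inc[of x 0] that R r0 by (cases "x \<ge> 0") auto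
  have far: "norm (r x) \<le> 2 * K / \<bar>x\<bar>" if x: "\<bar>x\<bar> > R" for x
  proof -
    have x0: "x \<noteq> 0" using x R by auto
    have "norm (sa (of_real x) - 1) \<le> K / \<bar>x\<bar>" using K(2)[of "of_real x"] x0 by simp
    also have "\<dots> \<le> 1 / 2" using x K(1) R by (simp add: R_def divide_le_eq)
    finally have "norm (sa (of_real x)) \<ge> 1 / 2"
      using norm_triangle_ineq2[of 1 "1 - sa (of_real x)"] by (simp add: norm_minus_commute)
    then have "norm (r x) \<le> norm (sb x) / (1 / 2)"
      unfolding reflection_coeff_eq norm_divide by (intro divide_left_mono) auto
    also have "\<dots> \<le> (K / \<bar>x\<bar>) / (1 / 2)" using K(3)[OF x0] by (intro divide_right_mono) auto
    finally show ?thesis by (simp add: mult.commute)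
  qed
  have main: "(norm (r x))\<^sup>2 / \<bar>x\<bar> \<le> (B\<^sup>2 * R * (1 + R\<^sup>2) + 8 * K\<^sup>2) * inverse (1 + x\<^sup>2)" for x
  proof (cases "\<bar>x\<bar> \<le> R")
    case True
    have p: "1 + x\<^sup>2 > 0" by (simp add: add_pos_nonneg)
    have "(norm (r x))\<^sup>2 / \<bar>x\<bar> \<le> (B * \<bar>x\<bar>)\<^sup>2 / \<bar>x\<bar>"
      using near[OF True] by (intro divide_right_mono power_mono) auto
    also have "\<dots> = B\<^sup>2 * \<bar>x\<bar>" by (simp add: power2_eq_square)
    also have "\<dots> \<le> B\<^sup>2 * R" using True by (intro mult_left_mono) auto
    also have "\<dots> \<le> B\<^sup>2 * R * (1 + R\<^sup>2) * inverse (1 + x\<^sup>2)"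
    proof -
      have "x\<^sup>2 \<le> R\<^sup>2" using True R by (simp add: abs_le_square_iff[symmetric])
      then have "1 \<le> (1 + R\<^sup>2) * inverse (1 + x\<^sup>2)" using p by (simp add: field_simps)
      moreover have "0 \<le> B\<^sup>2 * R" using R by simp
      ultimately show ?thesis using mult_left_mono[of 1 "(1 + R\<^sup>2) * inverse (1 + x\<^sup>2)" "B\<^sup>2 * R"]
        by (simp add: mult.assoc)
    qed
    also have "\<dots> \<le> (B\<^sup>2 * R * (1 + R\<^sup>2) + 8 * K\<^sup>2) * inverse (1 + x\<^sup>2)"
      using p by (intro mult_right_mono) auto
    finally show ?thesis .
  next
    case False
    then have x: "\<bar>x\<bar> > R" "\<bar>x\<bar> \<ge> 1" using R by auto
    have p: "1 + x\<^sup>2 > 0" by (simp add: add_pos_nonneg)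
    have x2: "x\<^sup>2 \<ge> 1" using x(2) abs_le_square_iff[of 1 x] by simp
    have "(norm (r x))\<^sup>2 / \<bar>x\<bar> \<le> (2 * K / \<bar>x\<bar>)\<^sup>2 / 1"
      using far[OF x(1)] x(2) by (intro frac_le power_mono) auto
    also have "\<dots> = 4 * K\<^sup>2 / x\<^sup>2" by (simp add: power_divide power_mult_distrib)
    also have "\<dots> \<le> 8 * K\<^sup>2 / (1 + x\<^sup>2)"
    proof -
      have "4 * K\<^sup>2 * (1 + x\<^sup>2) \<le> 4 * K\<^sup>2 * (2 * x\<^sup>2)" using x2 by (intro mult_left_mono) auto
      then show ?thesis using x2 p by (simp add: divide_simps mult_ac)
    qed
    also have "\<dots> \<le> (B\<^sup>2 * R * (1 + R\<^sup>2) + 8 * K\<^sup>2) / (1 + x\<^sup>2)"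
      using p R by (intro divide_right_mono) auto
    finally show ?thesis by (simp add: divide_inverse)
  qed
  show thesis by (rule that[OF main])
qed

text \<open>\<open>r 0 = 0\<close> forces \<open>norm (sa 0) = 1\<close>, so \<open>sa 0\<close> is
  determined by its phase. The relation \<open>ln (1 + |r|^2) = - 2 * ln |sa|\<close> gives the
  factor 2 between that phase and \<open>aleph_phase r\<close>, and hence the square; the sign of
  the exponent gives the conjugate.\<close>

lemma exp_aleph:
  assumes r0: "r 0 = 0"
  shows "exp (- \<i> * complex_of_real (aleph_phase r)) = (cnj (sa 0))\<^sup>2"
proof -
  obtain C where C: "\<And>x. (norm (r x))\<^sup>2 / \<bar>x\<bar> \<le> C * inverse (1 + x\<^sup>2)"
    using r_bound_near_far[OF r0] by blast
  let ?f = "\<lambda>x. ln (1 + (norm (r x))\<^sup>2) / x"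
  let ?g = "\<lambda>x. ln (norm (sa (of_real x))) / x"
  have fg: "?f x = (- 2) * ?g x" for x by (simp add: ln_one_plus_r)
  have "continuous_on UNIV (\<lambda>x. sa (complex_of_real x))"
    by (rule continuous_on_compose2[OF sa_cont]) (auto intro!: continuous_intros)
  then have "continuous_on UNIV (\<lambda>x. ln (norm (sa (complex_of_real x))))"
    by (intro continuous_intros) (auto simp: sa_nonzero)
  then have "(\<lambda>x. ln (norm (sa (complex_of_real x)))) \<in> borel_measurable lborel"
    by (simp add: borel_measurable_continuous_onI)
  then have gm: "?g \<in> borel_measurable lborel" by (intro borel_measurable_divide) auto
  have g: "integrable lborel ?g"
  proof (rule integrable_bounded_by_inverse_square[OF gm])
    fix x :: real
    have "\<bar>?g x\<bar> = ln (1 + (norm (r x))\<^sup>2) / \<bar>x\<bar> / 2"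
    proof -
      have "0 \<le> ln (1 + (norm (r x))\<^sup>2)" by (rule ln_ge_zero) simp
      then have "\<bar>ln (norm (sa (of_real x)))\<bar> = ln (1 + (norm (r x))\<^sup>2) / 2" unfolding ln_one_plus_r by simp
      then show ?thesis by (simp only: abs_divide) simp
    qed
    also have "\<dots> \<le> ln (1 + (norm (r x))\<^sup>2) / \<bar>x\<bar>"
    proof -
      have "0 \<le> ln (1 + (norm (r x))\<^sup>2) / \<bar>x\<bar>" by (intro divide_nonneg_nonneg ln_ge_zero) auto
      moreover have "y / 2 \<le> y" if "0 \<le> y" for y :: real using that by simp
      ultimately show ?thesis by blast
    qed
    also have "\<dots> \<le> (norm (r x))\<^sup>2 / \<bar>x\<bar>"
      by (intro divide_right_mono ln_add_one_self_le_self) auto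
    also have "\<dots> \<le> C * inverse (1 + x\<^sup>2)" by (rule C)
    finally show "\<bar>?g x\<bar> \<le> C * inverse (1 + x\<^sup>2)" .
  qed
  have f: "integrable lborel ?f" unfolding fg by (rule integrable_mult_right[OF g])
  obtain K where K: "\<And>\<xi>. Im \<xi> \<ge> 0 \<Longrightarrow> \<xi> \<noteq> 0 \<Longrightarrow> norm (sa \<xi> - 1) \<le> K / norm \<xi>"
    by (rule scattering_decay) (rule that)
  obtain l where l: "sa 0 = exp l" "Im l = - (1 / pi) * (LINT x|lborel. ?g x)"
    by (rule uhp_imaginary_part_at_0[OF sa_cont sa_holomorphic sa_nonzero K g]) (assumption, assumption, assumption, rule that)
  have "aleph_phase r = 1 / pi * (LINT x|lborel. ?f x)"
    unfolding aleph_phase_def using pv_integral_eq_integral[OF f] by simp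
  also have "(LINT x|lborel. ?f x) = (- 2) * (LINT x|lborel. ?g x)"
    unfolding fg by (rule integral_mult_right_zero)
  finally have al: "aleph_phase r = 2 * Im l" using l(2) by simp
  have "(norm (sa 0))\<^sup>2 = 1" using sa_sb[of 0] r0 sb_eq[of 0] by simp
  then have "norm (sa 0) = 1" using power2_eq_imp_eq[of "norm (sa 0)" 1] by simp
  then have "exp (Re l) = 1" using l(1) by (simp add: norm_exp_eq_Re)
  then have "Re l = 0" by simp
  then have "2 * cnj l = - \<i> * complex_of_real (2 * Im l)" by (simp add: complex_eq_iff)
  then have "exp (2 * cnj l) = exp (- \<i> * complex_of_real (2 * Im l))" by (rule arg_cong)
  then show ?thesis unfolding al l(1) exp_cnj exp_double[symmetric] by (rule sym)
qed

end

section \<open>The hierarchy at the boundary\<close>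

definition rapid :: "(real \<Rightarrow> 'a::real_normed_vector) \<Rightarrow> bool" where
  "rapid f \<longleftrightarrow> (\<forall>n. \<exists>K. \<forall>t\<ge>0. norm (f t) * (1 + t) ^ n \<le> K)"

lemma rapidE:
  assumes "rapid f" obtains K where "K \<ge> 0" "\<And>t. t \<ge> 0 \<Longrightarrow> norm (f t) \<le> K / (1 + t) ^ n"
proof -
  obtain K where K: "\<And>t. t \<ge> 0 \<Longrightarrow> norm (f t) * (1 + t) ^ n \<le> K"
    using assms unfolding rapid_def by blast
  show thesis
  proof (rule that[of K])
    show "K \<ge> 0" using order_trans[OF _ K[of 0]] by simp
    show "norm (f t) \<le> K / (1 + t) ^ n" if "t \<ge> 0" for t
      using K[OF that] that by (simp add: pos_le_divide_eq)
  qed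
qed

lemma rapid_poly_bound:
  assumes f: "rapid f" and g: "\<And>t. t \<ge> 0 \<Longrightarrow> norm (g t) \<le> C * (1 + t) ^ m * norm (f t)"
  shows "rapid g"
  unfolding rapid_def
proof
  fix n
  obtain K where K: "\<And>t. t \<ge> 0 \<Longrightarrow> norm (f t) * (1 + t) ^ (m + n) \<le> K"
    using f unfolding rapid_def by blast
  have "norm (g t) * (1 + t) ^ n \<le> \<bar>C\<bar> * K" if t: "t \<ge> 0" for t
  proof -
    have "norm (g t) * (1 + t) ^ n \<le> C * (1 + t) ^ m * norm (f t) * (1 + t) ^ n"
      using g[OF t] t by (intro mult_right_mono) auto
    also have "\<dots> = C * (norm (f t) * (1 + t) ^ (m + n))" by (simp add: power_add)
    also have "\<dots> \<le> \<bar>C\<bar> * (norm (f t) * (1 + t) ^ (m + n))" using t by (intro mult_right_mono) auto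
    also have "\<dots> \<le> \<bar>C\<bar> * K" using K[OF t] by (intro mult_left_mono) auto
    finally show ?thesis .
  qed
  then show "\<exists>K. \<forall>t\<ge>0. norm (g t) * (1 + t) ^ n \<le> K" by blast
qed

lemma rapid_add: assumes "rapid f" "rapid g" shows "rapid (\<lambda>t. f t + g t)"
  unfolding rapid_def
proof
  fix n
  obtain K1 where K1: "\<And>t. t \<ge> 0 \<Longrightarrow> norm (f t) * (1 + t) ^ n \<le> K1"
    using assms(1) unfolding rapid_def by blast
  obtain K2 where K2: "\<And>t. t \<ge> 0 \<Longrightarrow> norm (g t) * (1 + t) ^ n \<le> K2"
    using assms(2) unfolding rapid_def by blast
  have "norm (f t + g t) * (1 + t) ^ n \<le> K1 + K2" if t: "t \<ge> 0" for t
  proof -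
    have "norm (f t + g t) * (1 + t) ^ n \<le> (norm (f t) + norm (g t)) * (1 + t) ^ n"
      using t by (intro mult_right_mono norm_triangle_ineq) auto
    then show ?thesis using K1[OF t] K2[OF t] by (simp add: distrib_right)
  qed
  then show "\<exists>K. \<forall>t\<ge>0. norm (f t + g t) * (1 + t) ^ n \<le> K" by blast
qed

lemma rapid_derivative_limit:
  fixes f :: "real \<Rightarrow> 'a::euclidean_space"
  assumes d: "\<And>t. t \<ge> 0 \<Longrightarrow> (f has_vector_derivative f' t) (at t within {0..})" and r: "rapid f'"
  obtains l where "rapid (\<lambda>t. f t - l)"
proof -
  from choice[OF r[unfolded rapid_def]] obtain K
    where K': "\<forall>n. \<forall>t\<ge>0. norm (f' t) * (1 + t) ^ n \<le> K n" by (rule exE)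
  have K: "\<And>n t. t \<ge> 0 \<Longrightarrow> norm (f' t) * (1 + t) ^ n \<le> K n" using K' by blast
  obtain l where "(f \<longlongrightarrow> l) at_top" "\<And>n t. t \<ge> 0 \<Longrightarrow> norm (f t - l) * (1 + t) ^ n \<le> K (n + 2)"
    by (rule rapid_limit[OF d K], assumption, assumption, rule that)
  then have "rapid (\<lambda>t. f t - l)" unfolding rapid_def by blast
  then show thesis by (rule that)
qed

lemma rapid_seq_tendsto:
  assumes "rapid (\<lambda>t. f t - l)" shows "(\<lambda>m. f (real m)) \<longlonglongrightarrow> l"
proof -
  obtain K where K: "K \<ge> 0" "\<And>t. t \<ge> 0 \<Longrightarrow> norm (f t - l) \<le> K / (1 + t) ^ 1"
    using rapidE[OF assms] by blast
  have "(\<lambda>m. f (real m) - l) \<longlonglongrightarrow> 0"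
  proof (rule Lim_null_comparison)
    show "\<forall>\<^sub>F m in sequentially. norm (f (real m) - l) \<le> K / (1 + real m)"
      using K(2) by (auto intro!: always_eventually)
    have "filterlim (\<lambda>m. 1 + real m) at_top sequentially"
      by (rule filterlim_at_top_mono[OF filterlim_real_sequentially]) auto
    then show "(\<lambda>m. K / (1 + real m)) \<longlonglongrightarrow> 0"
      by (intro tendsto_divide_0[OF tendsto_const] filterlim_at_top_imp_at_infinity)
  qed
  then show ?thesis by (rule LIM_zero_cancel)
qed

text \<open>Conjugation by a diagonal rotation. It undoes the free oscillation of the off-diagonal
  entry and fixes the vacuum.\<close>

definition twist :: "real \<Rightarrow> complex \<times> real \<Rightarrow> complex \<times> real" where
  "twist \<theta> x = (exp (- (2 * \<i> * of_real \<theta>)) * fst x, snd x)"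

lemma norm_twist [simp]: "norm (twist \<theta> x) = norm x"
  by (cases x) (simp add: twist_def norm_Pair norm_mult)

lemma twist_add: "twist \<theta> (x + y) = twist \<theta> x + twist \<theta> y"
  and twist_scaleR: "twist \<theta> (c *\<^sub>R x) = c *\<^sub>R twist \<theta> x"
  and twist_vacuum: "twist \<theta> (0, 1) = (0, 1)"
  by (simp_all add: twist_def algebra_simps)

text \<open>\<open>T j\<close> is the coefficient of \<open>\<xi>\<^sup>j\<close> in \<open>W \<sigma>\<^sub>3 W\<inverse>\<close> for the pulse \<open>q0\<close>, \<open>U\<close> below is the full
  function of \<open>\<xi>\<close>, and \<open>Uinf\<close> its limit as \<open>t \<rightarrow> \<infinity>\<close> up to the oscillation removed by \<open>twist\<close>.\<close>

locale pulse_hierarchy = soliton_free_pulse +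
  fixes T :: "nat \<Rightarrow> real \<Rightarrow> complex \<times> real"
  assumes T_init: "T j 0 = (if j = 0 then (0, 1) else 0)"
    and T_deriv: "t \<ge> 0 \<Longrightarrow> (T j has_vector_derivative
      rot (q0 t) (T j t) + (case j of 0 \<Rightarrow> 0 | Suc i \<Rightarrow> shift (T i t))) (at t within {0..})"
    and norm_T: "t \<ge> 0 \<Longrightarrow> norm (T j t) \<le> (2 * t) ^ j"
begin

text \<open>For real \<open>\<xi>\<close> the fundamental matrix W is unitary, so
  \<open>W \<sigma>\<^sub>3 W\<inverse>\<close> equals the identity minus twice the projection onto
  the second column of W. These are its upper right and upper left entries.\<close>

definition U :: "real \<Rightarrow> real \<Rightarrow> complex \<times> real" where
  "U \<xi> t = (- 2 * (fst (zs (of_real \<xi>) t) * cnj (snd (zs (of_real \<xi>) t))),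
     (norm (snd (zs (of_real \<xi>) t)))\<^sup>2 - (norm (fst (zs (of_real \<xi>) t)))\<^sup>2)"

definition Uinf :: "real \<Rightarrow> complex \<times> real" where
  "Uinf \<xi> = (- 2 * (cnj (sb \<xi>) * cnj (sa (of_real \<xi>))), 1 - 2 * (norm (sb \<xi>))\<^sup>2)"

lemma U_0: "U \<xi> 0 = (0, 1)"
  by (simp add: U_def zs_0)

lemma U_deriv: assumes t: "t \<in> {0..S}"
  shows "(U \<xi> has_vector_derivative rot (q0 t) (U \<xi> t) + \<xi> *\<^sub>R shift (U \<xi> t)) (at t within {0..S})"
proof -
  let ?x = "complex_of_real \<xi>"
  let ?f = "\<lambda>t. fst (zs ?x t)" and ?s = "\<lambda>t. snd (zs ?x t)"
  note f = fst_zs_deriv[OF t order_refl, of ?x] and s = snd_zs_deriv[OF t order_refl, of ?x]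
  note cs = bounded_linear.has_vector_derivative[OF bounded_linear_cnj s]
  have 1: "((\<lambda>t. - 2 * (?f t * cnj (?s t))) has_vector_derivative
      - 2 * (?f t * cnj (- cnj (q0 t) * ?f t) + (2 * \<i> * ?x * ?f t + q0 t * ?s t) * cnj (?s t))) (at t within {0..S})"
    using has_vector_derivative_mult[OF has_vector_derivative_const has_vector_derivative_mult[OF f cs], of "- 2"] by simp
  have n: "(norm z)\<^sup>2 = inner z z" for z :: complex by (simp add: power2_norm_eq_inner)
  have 2: "((\<lambda>t. (norm (?s t))\<^sup>2 - (norm (?f t))\<^sup>2) has_vector_derivative
      (inner (?s t) (- cnj (q0 t) * ?f t) + inner (- cnj (q0 t) * ?f t) (?s t)) -
      (inner (?f t) (2 * \<i> * ?x * ?f t + q0 t * ?s t) + inner (2 * \<i> * ?x * ?f t + q0 t * ?s t) (?f t))) (at t within {0..S})"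
    unfolding n
    by (rule has_vector_derivative_diff[OF bounded_bilinear.has_vector_derivative[OF bounded_bilinear_inner s s]
          bounded_bilinear.has_vector_derivative[OF bounded_bilinear_inner f f]])
  have "(- 2 * (?f t * cnj (- cnj (q0 t) * ?f t) + (2 * \<i> * ?x * ?f t + q0 t * ?s t) * cnj (?s t)),
      (inner (?s t) (- cnj (q0 t) * ?f t) + inner (- cnj (q0 t) * ?f t) (?s t)) -
      (inner (?f t) (2 * \<i> * ?x * ?f t + q0 t * ?s t) + inner (2 * \<i> * ?x * ?f t + q0 t * ?s t) (?f t)))
      = rot (q0 t) (U \<xi> t) + \<xi> *\<^sub>R shift (U \<xi> t)"
    unfolding U_def rot_def shift_def fst_conv snd_conv n scaleR_Pair add_Pair prod.inject
    by (simp add: complex_eq_iff inner_complex_def) (simp add: algebra_simps)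
  with has_vector_derivative_Pair[OF 1 2] show ?thesis unfolding U_def by simp
qed

lemma T_deriv_sub: "t \<in> {0..S} \<Longrightarrow> (T j has_vector_derivative
      rot (q0 t) (T j t) + (case j of 0 \<Rightarrow> 0 | Suc i \<Rightarrow> shift (T i t))) (at t within {0..S})"
  by (rule has_vector_derivative_within_subset[OF T_deriv]) auto

lemma rot_add: "rot w (x + y) = rot w x + rot w y"
  and rot_scaleR: "rot w (c *\<^sub>R x) = c *\<^sub>R rot w x"
  and shift_add: "shift (x + y) = shift x + shift y"
  and shift_diff: "shift (x - y) = shift x - shift y"
  and shift_scaleR: "shift (c *\<^sub>R x) = c *\<^sub>R shift x"
  by (simp_all add: rot_def shift_def algebra_simps scaleR_conv_of_real)

lemma rot_0: "rot w 0 = 0"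
  by (simp add: rot_def zero_prod_def)

lemma rot_sum: "rot w (sum f A) = (\<Sum>j\<in>A. rot w (f j))"
  by (induction A rule: infinite_finite_induct) (simp_all add: rot_add rot_0)

lemma shift_sum: "shift (sum f A) = (\<Sum>j\<in>A. shift (f j))"
  by (induction A rule: infinite_finite_induct) (simp_all add: shift_add)

text \<open>The Taylor remainders satisfy the same recursion as the coefficients: rotation by
  \<open>q0\<close> plus \<open>\<xi>\<close> times the shift of the preceding remainder, with
  initial value 0. The induction starts from the constant norm of \<open>U\<close>, the shift being
  skew as well.\<close>

lemma U_taylor:
  "t \<ge> 0 \<Longrightarrow> norm (U \<xi> t - (\<Sum>j<n. \<xi> ^ j *\<^sub>R T j t)) \<le> (2 * \<bar>\<xi>\<bar> * t) ^ n"
proof (induction n arbitrary: t)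
  case 0
  have "norm (U \<xi> t) \<le> norm (U \<xi> 0) + 0 - 0"
  proof (rule norm_growth_bound[OF 0, where g' = "\<lambda>_. 0"])
    fix s assume s: "s \<in> {0..t}"
    show "(U \<xi> has_vector_derivative rot (q0 s) (U \<xi> s) + \<xi> *\<^sub>R shift (U \<xi> s)) (at s within {0..t})"
      by (rule U_deriv[OF s])
    have "inner (U \<xi> s) (shift (U \<xi> s)) = 0"
      by (cases "U \<xi> s") (simp add: shift_def inner_complex_def)
    then show "inner (U \<xi> s) (rot (q0 s) (U \<xi> s) + \<xi> *\<^sub>R shift (U \<xi> s)) \<le> norm (U \<xi> s) * 0"
      by (simp add: inner_add_right)
  qed (auto intro!: derivative_eq_intros)
  then show ?case by (simp add: U_0 norm_Pair)
next
  case (Suc n)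
  define S where "S n t = U \<xi> t - (\<Sum>j<n. \<xi> ^ j *\<^sub>R T j t)" for n t
  let ?g = "\<lambda>t. (2 * \<bar>\<xi>\<bar> * t) ^ Suc n"
  let ?g' = "\<lambda>t. 2 * \<bar>\<xi>\<bar> * (real (Suc n) * (2 * \<bar>\<xi>\<bar> * t) ^ n)"
  have S0: "S (Suc n) 0 = 0"
    unfolding S_def sum.lessThan_Suc_shift by (simp add: U_0 T_init)
  have "norm (S (Suc n) t) \<le> norm (S (Suc n) 0) + ?g t - ?g 0"
  proof (rule norm_growth_bound[OF Suc.prems, where g' = ?g' and x' = "\<lambda>t. rot (q0 t) (S (Suc n) t) + \<xi> *\<^sub>R shift (S n t)"])
    fix s assume s: "s \<in> {0..t}"
    have "((\<lambda>t. \<Sum>j<Suc n. \<xi> ^ j *\<^sub>R T j t) has_vector_derivative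
        (\<Sum>j<Suc n. \<xi> ^ j *\<^sub>R (rot (q0 s) (T j s) + (case j of 0 \<Rightarrow> 0 | Suc i \<Rightarrow> shift (T i s))))) (at s within {0..t})"
      by (intro has_vector_derivative_sum bounded_linear.has_vector_derivative[OF bounded_linear_scaleR_right] T_deriv_sub s)
    from has_vector_derivative_diff[OF U_deriv[OF s] this]
    have "(S (Suc n) has_vector_derivative rot (q0 s) (U \<xi> s) + \<xi> *\<^sub>R shift (U \<xi> s) -
        (\<Sum>j<Suc n. \<xi> ^ j *\<^sub>R (rot (q0 s) (T j s) + (case j of 0 \<Rightarrow> 0 | Suc i \<Rightarrow> shift (T i s))))) (at s within {0..t})"
      unfolding S_def .
    moreover have "(\<Sum>j<Suc n. \<xi> ^ j *\<^sub>R (rot (q0 s) (T j s) + (case j of 0 \<Rightarrow> 0 | Suc i \<Rightarrow> shift (T i s)))) =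
        rot (q0 s) (\<Sum>j<Suc n. \<xi> ^ j *\<^sub>R T j s) + \<xi> *\<^sub>R shift (\<Sum>j<n. \<xi> ^ j *\<^sub>R T j s)"
    proof -
      have "(\<Sum>j<Suc n. \<xi> ^ j *\<^sub>R (case j of 0 \<Rightarrow> 0 | Suc i \<Rightarrow> shift (T i s))) = \<xi> *\<^sub>R shift (\<Sum>j<n. \<xi> ^ j *\<^sub>R T j s)"
        unfolding sum.lessThan_Suc_shift shift_sum scaleR_sum_right by (simp add: shift_scaleR)
      then show ?thesis
        by (simp add: scaleR_add_right sum.distrib rot_sum rot_scaleR del: sum.lessThan_Suc)
    qed
    ultimately show "(S (Suc n) has_vector_derivative rot (q0 s) (S (Suc n) s) + \<xi> *\<^sub>R shift (S n s)) (at s within {0..t})"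
      unfolding S_def by (simp add: rot_diff shift_diff scaleR_diff_right algebra_simps del: sum.lessThan_Suc)
    show "(?g has_real_derivative ?g' s) (at s within {0..t})"
      by (rule derivative_eq_intros refl | simp)+
    show nn: "0 \<le> ?g' s" using s by simp
    have p: "0 \<le> (2 * \<bar>\<xi>\<bar> * s) ^ n" using s by simp
    have "norm (\<xi> *\<^sub>R shift (S n s)) \<le> \<bar>\<xi>\<bar> * (2 * (2 * \<bar>\<xi>\<bar> * s) ^ n)"
      unfolding norm_scaleR using Suc.IH[of s] s norm_shift[of "S n s"]
      by (intro mult_mono) (auto simp: S_def)
    also have "\<dots> = 2 * \<bar>\<xi>\<bar> * (1 * (2 * \<bar>\<xi>\<bar> * s) ^ n)" by simp
    also have "\<dots> \<le> ?g' s" using p by (intro mult_left_mono mult_right_mono) auto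
    finally have "norm (\<xi> *\<^sub>R shift (S n s)) \<le> ?g' s" .
    then show "inner (S (Suc n) s) (rot (q0 s) (S (Suc n) s) + \<xi> *\<^sub>R shift (S n s)) \<le> norm (S (Suc n) s) * ?g' s"
      by (simp only: inner_add_right inner_rot add_0_left)
        (rule order_trans[OF norm_cauchy_schwarz mult_left_mono], auto)
  qed
  moreover have "?g 0 = 0" by simp
  ultimately have "norm (S (Suc n) t) \<le> ?g t" unfolding S0 by simp
  then show ?case unfolding S_def .
qed

text \<open>The bound is free of \<open>\<xi>\<close>, which permits \<open>\<xi>\<close> to tend to
  0 while t tends to infinity.\<close>

lemma twist_U_limit:
  assumes t: "t \<ge> 0"
  shows "norm (twist (\<xi> * t) (U \<xi> t) - Uinf \<xi>) \<le> 8 * qK (n + 2) / (1 + t) ^ n"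
proof -
  let ?x = "complex_of_real \<xi>"
  define c where "c = qK (n + 2) / (1 + t) ^ n"
  have a: "norm (snd (zs ?x t) - sa ?x) \<le> c"
    using snd_zs_limit(2)[of ?x t n] t by (simp add: c_def pos_le_divide_eq)
  have b: "norm (osc ?x t - cnj (sb \<xi>)) \<le> c"
    using osc_limit(2)[of t \<xi> n] t by (simp add: c_def pos_le_divide_eq)
  have le1: "norm (sa ?x) \<le> 1" "norm (sb \<xi>) \<le> 1" "norm (osc ?x t) \<le> 1" "norm (snd (zs ?x t)) \<le> 1"
  proof -
    have aux: "a \<le> 1" "b \<le> 1" if "a\<^sup>2 + b\<^sup>2 = 1" for a b :: real
    proof -
      have "a\<^sup>2 \<le> 1" "b\<^sup>2 \<le> 1" using that zero_le_power2[of a] zero_le_power2[of b] by linarith+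
      then show "a \<le> 1" "b \<le> 1" unfolding abs_square_le_1 by simp_all
    qed
    show "norm (sa ?x) \<le> 1" "norm (sb \<xi>) \<le> 1" "norm (osc ?x t) \<le> 1" "norm (snd (zs ?x t)) \<le> 1"
      using aux[OF sa_sb[of \<xi>]] aux[OF norm_zs_real[OF t, of \<xi>]] unfolding norm_osc_real by blast+
  qed
  have e: "twist (\<xi> * t) (U \<xi> t) = (- 2 * (osc ?x t * cnj (snd (zs ?x t))), 1 - 2 * (norm (osc ?x t))\<^sup>2)"
  proof -
    have s: "(norm (snd (zs ?x t)))\<^sup>2 - (norm (fst (zs ?x t)))\<^sup>2 = 1 - 2 * (norm (osc ?x t))\<^sup>2"
      using norm_zs_real[OF t, of \<xi>] unfolding norm_osc_real by linarith
    show ?thesis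
      unfolding twist_def U_def fst_conv snd_conv s prod.inject by (simp add: osc_def mult_ac)
  qed
  have "osc ?x t * cnj (snd (zs ?x t)) - cnj (sb \<xi>) * cnj (sa ?x) =
      osc ?x t * cnj (snd (zs ?x t) - sa ?x) + (osc ?x t - cnj (sb \<xi>)) * cnj (sa ?x)"
    by (simp add: algebra_simps)
  then have "norm (osc ?x t * cnj (snd (zs ?x t)) - cnj (sb \<xi>) * cnj (sa ?x)) \<le>
      norm (osc ?x t) * norm (snd (zs ?x t) - sa ?x) + norm (osc ?x t - cnj (sb \<xi>)) * norm (sa ?x)"
    using norm_triangle_ineq[of "osc ?x t * cnj (snd (zs ?x t) - sa ?x)" "(osc ?x t - cnj (sb \<xi>)) * cnj (sa ?x)"]
    by (simp add: norm_mult flip: complex_cnj_diff)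
  also have "\<dots> \<le> 1 * c + c * 1"
    using a b le1 order_trans[OF norm_ge_zero a] by (intro add_mono mult_mono) auto
  finally have 1: "norm (osc ?x t * cnj (snd (zs ?x t)) - cnj (sb \<xi>) * cnj (sa ?x)) \<le> 2 * c" by simp
  have "\<bar>(norm (osc ?x t))\<^sup>2 - (norm (sb \<xi>))\<^sup>2\<bar> = \<bar>norm (osc ?x t) - norm (cnj (sb \<xi>))\<bar> * \<bar>norm (osc ?x t) + norm (sb \<xi>)\<bar>"
  proof -
    have "\<bar>u\<^sup>2 - v\<^sup>2\<bar> = \<bar>u - v\<bar> * \<bar>u + v\<bar>" for u v :: real
      by (simp only: abs_mult[symmetric]) (simp add: power2_eq_square algebra_simps)
    then show ?thesis by simp
  qed
  also have "\<dots> \<le> c * 2"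
    using norm_triangle_ineq3[of "osc ?x t" "cnj (sb \<xi>)"] b le1 by (intro mult_mono) auto
  finally have 2: "\<bar>(norm (osc ?x t))\<^sup>2 - (norm (sb \<xi>))\<^sup>2\<bar> \<le> 2 * c" by simp
  have "norm (twist (\<xi> * t) (U \<xi> t) - Uinf \<xi>) \<le>
      norm (- 2 * (osc ?x t * cnj (snd (zs ?x t)) - cnj (sb \<xi>) * cnj (sa ?x))) + norm (- 2 * ((norm (osc ?x t))\<^sup>2 - (norm (sb \<xi>))\<^sup>2))"
    unfolding e Uinf_def diff_Pair
    by (rule order_trans[OF norm_Pair_le]) (simp add: algebra_simps)
  also have "\<dots> \<le> 2 * (2 * c) + 2 * (2 * c)"
    using 1 2 unfolding norm_mult by (intro add_mono mult_mono) auto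
  finally show ?thesis by (simp add: c_def)
qed

definition dev :: "nat \<Rightarrow> real \<Rightarrow> complex \<times> real" where
  "dev k t = T k t - (if k = 0 then (0, 1) else 0)"

lemma shift_dev: "shift (T k t) = shift (dev k t)"
  by (simp add: dev_def shift_def)

lemma T_sum_dev: "(\<Sum>j<Suc n. \<xi> ^ j *\<^sub>R T j t) = (0, 1) + (\<Sum>j<Suc n. \<xi> ^ j *\<^sub>R dev j t)"
  unfolding sum.lessThan_Suc_shift by (simp add: dev_def)

text \<open>Evaluating the Taylor expansion at \<open>\<xi> = (1 + m) powr - (2 k + 2)\<close> and \<open>t = m\<close> makes all the
  error terms vanish as \<open>m\<close> tends to infinity.\<close>

lemma dev_limit_identify:
  assumes prev: "\<And>j. j < k \<Longrightarrow> rapid (dev j)" and l: "rapid (\<lambda>t. dev k t - l)"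
  shows "(\<lambda>m. (1 / (1 / (1 + real m) ^ (2 * k + 2)) ^ k) *\<^sub>R (Uinf (1 / (1 + real m) ^ (2 * k + 2)) - (0, 1))) \<longlonglongrightarrow> l"
proof -
  \<comment> \<open>After division by \<open>x m ^ k\<close> the Taylor remainder of order k + 1
    becomes \<open>x m * (2 * real m) ^ Suc k\<close>; the exponent 2 k + 2 makes this of order
    \<open>1 / (1 + real m)\<close>. It also sends \<open>\<theta> m\<close> to 0, so the twist
    disappears in the limit.\<close>
  define x where "x m = 1 / (1 + real m) ^ (2 * k + 2)" for m
  define \<theta> where "\<theta> m = x m * real m" for m
  \<comment> \<open>Division by \<open>x m ^ k\<close> costs \<open>k * (2 * k + 2)\<close> powers
    of 1 + m; one more order of decay leaves \<open>1 / (1 + real m)\<close> for all rapidly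
    decaying terms.\<close>
  define N where "N = k * (2 * k + 2) + 1"
  have x0: "x m > 0" "x m \<le> 1" for m using one_le_power[of "1 + real m" "2 * k + 2"] by (auto simp: x_def divide_le_eq simp del: power_Suc)
  have xk: "1 / x m ^ k = (1 + real m) ^ (k * (2 * k + 2))" for m
  proof -
    have "x m ^ k = 1 / (1 + real m) ^ (k * (2 * k + 2))"
      unfolding x_def by (simp only: power_one_over power_mult[symmetric] mult.commute[of k])
    then show ?thesis by simp
  qed
  have ex: "\<exists>K. j < k \<longrightarrow> K \<ge> 0 \<and> (\<forall>t\<ge>0. norm (dev j t) \<le> K / (1 + t) ^ N)" for j
  proof (cases "j < k")
    case True
    obtain K where "K \<ge> 0" "\<And>t. t \<ge> 0 \<Longrightarrow> norm (dev j t) \<le> K / (1 + t) ^ N"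
      by (rule rapidE[OF prev[OF True], of N]) (rule that)
    then show ?thesis by blast
  qed simp
  from choice[OF allI[OF ex]] obtain K
    where K': "\<forall>j. j < k \<longrightarrow> K j \<ge> 0 \<and> (\<forall>t\<ge>0. norm (dev j t) \<le> K j / (1 + t) ^ N)" by (rule exE)
  have K: "\<And>j. j < k \<Longrightarrow> K j \<ge> 0" "\<And>j t. j < k \<Longrightarrow> t \<ge> 0 \<Longrightarrow> norm (dev j t) \<le> K j / (1 + t) ^ N"
    using K' by blast+
  define C where "C = 8 * qK (N + 2) + (\<Sum>j<k. K j) + 2 ^ (k + 1)"
  let ?D = "\<lambda>m. (1 / x m ^ k) *\<^sub>R (Uinf (x m) - (0, 1))"
  have pw: "(1 + real m) ^ (k * (2 * k + 2)) / (1 + real m) ^ N = 1 / (1 + real m)" for m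
    by (simp add: N_def)
  have bound: "norm (?D m - twist (\<theta> m) (dev k (real m))) \<le> C / (1 + real m)" for m
  proof -
    define E1 where "E1 = Uinf (x m) - twist (\<theta> m) (U (x m) (real m))"
    define E2 where "E2 = U (x m) (real m) - (\<Sum>j<Suc k. x m ^ j *\<^sub>R T j (real m))"
    define E3 where "E3 = (\<Sum>j<k. x m ^ j *\<^sub>R dev j (real m))"
    have "U (x m) (real m) = (0, 1) + (E3 + x m ^ k *\<^sub>R dev k (real m)) + E2"
      unfolding E2_def T_sum_dev E3_def by simp
    then have "Uinf (x m) - (0, 1) = E1 + twist (\<theta> m) E3 + x m ^ k *\<^sub>R twist (\<theta> m) (dev k (real m)) + twist (\<theta> m) E2"
      unfolding E1_def by (simp add: twist_add twist_vacuum twist_scaleR)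
    then have "?D m - twist (\<theta> m) (dev k (real m)) = (1 / x m ^ k) *\<^sub>R (E1 + twist (\<theta> m) E3 + twist (\<theta> m) E2)"
      using x0(1)[of m] by (simp add: scaleR_add_right)
    then have "norm (?D m - twist (\<theta> m) (dev k (real m))) \<le> 1 / x m ^ k * (norm E1 + norm E3 + norm E2)"
      using x0(1)[of m] norm_triangle_ineq[of "E1 + twist (\<theta> m) E3" "twist (\<theta> m) E2"] norm_triangle_ineq[of E1 "twist (\<theta> m) E3"]
      by (simp add: divide_right_mono)
    also have "\<dots> \<le> 1 / x m ^ k * (8 * qK (N + 2) / (1 + real m) ^ N + (\<Sum>j<k. K j) / (1 + real m) ^ N + (2 * x m * real m) ^ Suc k)"
    proof (intro mult_left_mono add_mono)
      show "norm E1 \<le> 8 * qK (N + 2) / (1 + real m) ^ N"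
        unfolding E1_def \<theta>_def using twist_U_limit[of "real m" "x m" N] by (simp add: norm_minus_commute)
      have "norm E3 \<le> (\<Sum>j<k. K j / (1 + real m) ^ N)"
        unfolding E3_def
      proof (rule sum_norm_le)
        fix j assume "j \<in> {..<k}"
        then have j: "j < k" by simp
        have "norm (x m ^ j *\<^sub>R dev j (real m)) \<le> 1 * (K j / (1 + real m) ^ N)"
          unfolding norm_scaleR using x0[of m] K(2)[OF j, of "real m"] by (intro mult_mono) (auto simp: power_le_one)
        then show "norm (x m ^ j *\<^sub>R dev j (real m)) \<le> K j / (1 + real m) ^ N" by simp
      qed
      then show "norm E3 \<le> (\<Sum>j<k. K j) / (1 + real m) ^ N" by (simp add: sum_divide_distrib)
      show "norm E2 \<le> (2 * x m * real m) ^ Suc k"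
        unfolding E2_def using U_taylor[of "real m" "x m" "Suc k"] x0(1)[of m] by simp
    qed (use x0(1)[of m] in simp)
    also have "\<dots> = (8 * qK (N + 2) + (\<Sum>j<k. K j)) * ((1 + real m) ^ (k * (2 * k + 2)) / (1 + real m) ^ N) + 1 / x m ^ k * (2 * x m * real m) ^ Suc k"
      unfolding xk by (simp add: add_divide_distrib algebra_simps)
    also have "1 / x m ^ k * (2 * x m * real m) ^ Suc k = x m * (2 * real m) ^ Suc k"
      using x0(1)[of m] by (simp add: power_mult_distrib field_simps)
    also have "x m * (2 * real m) ^ Suc k \<le> 2 ^ (k + 1) * (1 / (1 + real m))"
    proof -
      have "(2 * real m) ^ Suc k \<le> (2 * (1 + real m)) ^ Suc k" by (intro power_mono) auto
      then have "x m * (2 * real m) ^ Suc k \<le> x m * (2 * (1 + real m)) ^ Suc k"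
        using x0(1)[of m] by (intro mult_left_mono) auto
      also have "\<dots> = 2 ^ (k + 1) * (1 / (1 + real m) ^ Suc k)"
      proof -
        have "(1 + real m) ^ (2 * k + 2) = (1 + real m) ^ Suc k * (1 + real m) ^ Suc k"
          by (simp add: power_add[symmetric] mult_2)
        moreover define y where "y = (1 + real m) ^ Suc k"
        ultimately have xm: "x m = 1 / (y * y)" by (simp only: x_def)
        have "(2 * (1 + real m)) ^ Suc k = 2 ^ (k + 1) * y" by (simp only: power_mult_distrib y_def Suc_eq_plus1)
        moreover have "y > 0" by (simp add: y_def)
        ultimately show ?thesis unfolding xm y_def[symmetric] by simp
      qed
      also have "\<dots> \<le> 2 ^ (k + 1) * (1 / (1 + real m))"
        by (intro mult_left_mono divide_left_mono) (auto simp: self_le_power)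
      finally show ?thesis .
    qed
    finally show ?thesis unfolding pw by (simp add: C_def add_divide_distrib)
  qed
  have flt: "filterlim (\<lambda>m. 1 + real m) at_top sequentially"
    by (rule filterlim_at_top_mono[OF filterlim_real_sequentially]) auto
  have inv0: "(\<lambda>m. c / (1 + real m)) \<longlonglongrightarrow> 0" for c
    by (intro tendsto_divide_0[OF tendsto_const] filterlim_at_top_imp_at_infinity flt)
  have diff0: "(\<lambda>m. ?D m - twist (\<theta> m) (dev k (real m))) \<longlonglongrightarrow> 0"
    by (rule Lim_null_comparison[OF always_eventually inv0[of C]]) (use bound in blast)
  have "\<theta> \<longlonglongrightarrow> 0"
  proof (rule Lim_null_comparison[OF always_eventually inv0[of 1]], rule allI)
    fix m
    have "\<theta> m \<le> x m * (1 + real m)" unfolding \<theta>_def using x0(1)[of m] by (intro mult_left_mono) auto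
    also have "\<dots> = 1 / (1 + real m) ^ (2 * k + 1)" by (simp add: x_def)
    also have "\<dots> \<le> 1 / (1 + real m)" by (intro divide_left_mono) (auto simp: self_le_power)
    finally show "norm (\<theta> m) \<le> 1 / (1 + real m)" using x0(1)[of m] by (simp add: \<theta>_def)
  qed
  then have el: "(\<lambda>m. exp (- (2 * \<i> * of_real (\<theta> m)))) \<longlonglongrightarrow> exp (- (2 * \<i> * of_real 0))"
    by (intro tendsto_intros)
  have dl: "(\<lambda>m. dev k (real m)) \<longlonglongrightarrow> l" by (rule rapid_seq_tendsto[OF l])
  have "(\<lambda>m. twist (\<theta> m) (dev k (real m))) \<longlonglongrightarrow> (exp (- (2 * \<i> * of_real 0)) * fst l, snd l)"
    unfolding twist_def by (rule tendsto_Pair[OF tendsto_mult[OF el tendsto_fst[OF dl]] tendsto_snd[OF dl]])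
  then have "(\<lambda>m. twist (\<theta> m) (dev k (real m))) \<longlonglongrightarrow> l" by simp
  from tendsto_add[OF diff0 this] show ?thesis by (simp add: x_def)
qed

text \<open>In terms of r, the off-diagonal part of \<open>Uinf - (0, 1)\<close> is linear in
  \<open>cnj r\<close> and the diagonal part is quadratic. The first vanishes to order M at 0; the
  second keeps a spare factor r after the division and tends to 0.\<close>

lemma Uinf_scaled_limit:
  assumes low: "\<And>m. m < M \<Longrightarrow> vderiv_iter m r 0 = 0" and M: "M \<ge> 1" and k: "k \<le> M"
  shows "(\<lambda>m. (1 / (1 / (1 + real m) ^ (2 * k + 2)) ^ k) *\<^sub>R (Uinf (1 / (1 + real m) ^ (2 * k + 2)) - (0, 1))) \<longlonglongrightarrow>
    (if k = M then (- 2 * (cnj (vderiv_iter M r 0) / fact M * (cnj (sa 0))\<^sup>2), 0) else 0)"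
proof -
  define x where "x m = 1 / (1 + real m) ^ (2 * k + 2)" for m
  have x0: "x m > 0" "x m \<le> 1" for m
    using one_le_power[of "1 + real m" "2 * k + 2"] by (auto simp: x_def divide_le_eq simp del: power_Suc)
  have flt: "filterlim (\<lambda>m. 1 + real m) at_top sequentially"
    by (rule filterlim_at_top_mono[OF filterlim_real_sequentially]) auto
  have inv0: "(\<lambda>m. 1 / (1 + real m)) \<longlonglongrightarrow> 0"
    by (intro tendsto_divide_0[OF tendsto_const] filterlim_at_top_imp_at_infinity flt)
  have xlim: "x \<longlonglongrightarrow> 0"
  proof (rule Lim_null_comparison[OF always_eventually inv0], rule allI)
    fix m
    have "1 + real m \<le> (1 + real m) ^ (2 * k + 2)" by (rule self_le_power) auto
    then show "norm (x m) \<le> 1 / (1 + real m)" by (auto simp: x_def intro!: divide_left_mono)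
  qed
  obtain K where K: "\<And>x. 0 \<le> x \<Longrightarrow> x \<le> 1 \<Longrightarrow> norm (r x - of_real (x ^ M / fact M) * vderiv_iter M r 0) \<le> K * x ^ Suc M"
    by (rule norm_taylor_remainder_le[OF r_times_differentiable low]) (assumption, rule that)
  have K0: "K \<ge> 0" using order_trans[OF norm_ge_zero K[of 1]] by simp
  define \<rho> where "\<rho> = of_real (0 ^ (M - k) / fact M) * vderiv_iter M r 0"
  have ratio: "(\<lambda>m. r (x m) / of_real (x m ^ k)) \<longlonglongrightarrow> \<rho>"
  proof -
    have "(\<lambda>m. r (x m) / of_real (x m ^ k) - of_real (x m ^ (M - k) / fact M) * vderiv_iter M r 0) \<longlonglongrightarrow> 0"
    proof (rule Lim_null_comparison[OF always_eventually], rule allI)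
      show "(\<lambda>m. K * x m) \<longlonglongrightarrow> 0" using tendsto_mult[OF tendsto_const xlim, of K] by simp
      fix m
      have xk: "x m ^ k > 0" using x0(1) by simp
      have "x m ^ M = x m ^ (M - k) * x m ^ k" using k by (simp add: power_add[symmetric])
      then have "r (x m) / of_real (x m ^ k) - of_real (x m ^ (M - k) / fact M) * vderiv_iter M r 0 =
          (r (x m) - of_real (x m ^ M / fact M) * vderiv_iter M r 0) / of_real (x m ^ k)"
        using x0(1)[of m] by (simp add: diff_divide_distrib)
      then have "norm (r (x m) / of_real (x m ^ k) - of_real (x m ^ (M - k) / fact M) * vderiv_iter M r 0) =
          norm (r (x m) - of_real (x m ^ M / fact M) * vderiv_iter M r 0) / x m ^ k"
        using x0(1)[of m] by (simp add: norm_divide norm_power)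
      also have "\<dots> \<le> K * x m ^ Suc M / x m ^ k"
        using K[of "x m"] x0[of m] by (intro divide_right_mono) auto
      also have "\<dots> = K * (x m * x m ^ (M - k))"
      proof -
        have "x m ^ Suc M = x m * x m ^ (M - k) * x m ^ k" using k by (simp add: power_add[symmetric])
        then have "K * x m ^ Suc M / x m ^ k = K * (x m * x m ^ (M - k)) * x m ^ k / x m ^ k" by (simp only: mult_ac)
        then show ?thesis using xk by (simp only: nonzero_mult_div_cancel_right[OF less_imp_neq[OF xk, symmetric]])
      qed
      also have "\<dots> \<le> K * (x m * 1)"
        using x0[of m] K0 by (intro mult_left_mono) (auto simp: power_le_one)
      finally show "norm (r (x m) / of_real (x m ^ k) - of_real (x m ^ (M - k) / fact M) * vderiv_iter M r 0) \<le> K * x m"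
        by simp
    qed
    moreover have "(\<lambda>m. of_real (x m ^ (M - k) / fact M) * vderiv_iter M r 0) \<longlonglongrightarrow> \<rho>"
      unfolding \<rho>_def by (intro tendsto_intros xlim) simp
    ultimately show ?thesis using tendsto_add[of _ 0 sequentially _ \<rho>] by fastforce
  qed
  have salim: "(\<lambda>m. sa (of_real (x m))) \<longlonglongrightarrow> sa 0"
  proof (rule continuous_on_tendsto_compose[OF sa_cont])
    show "(\<lambda>m. complex_of_real (x m)) \<longlonglongrightarrow> 0" using tendsto_of_real[OF xlim] by simp
  qed auto
  have r0: "r 0 = 0" using low[of 0] M by (simp add: vderiv_iter_def)
  have rlim: "(\<lambda>m. r (x m)) \<longlonglongrightarrow> 0"
  proof -
    have "continuous_on UNIV r" by (rule continuous_on_vector_derivative[OF r_vderiv])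
    from continuous_on_tendsto_compose[OF this xlim] show ?thesis by (simp add: r0)
  qed
  let ?D = "\<lambda>m. (1 / x m ^ k) *\<^sub>R (Uinf (x m) - (0, 1))"
  have "?D m = (- 2 * (cnj (r (x m) / of_real (x m ^ k)) * (cnj (sa (of_real (x m))))\<^sup>2),
      - 2 * (norm (r (x m) / of_real (x m ^ k)) * norm (r (x m)) * (norm (sa (of_real (x m))))\<^sup>2))" for m
    using x0(1)[of m]
    by (simp add: Uinf_def sb_eq norm_mult norm_divide norm_power scaleR_conv_of_real power2_eq_square)
  moreover have "(\<lambda>m. (- 2 * (cnj (r (x m) / of_real (x m ^ k)) * (cnj (sa (of_real (x m))))\<^sup>2),
      - 2 * (norm (r (x m) / of_real (x m ^ k)) * norm (r (x m)) * (norm (sa (of_real (x m))))\<^sup>2))) \<longlonglongrightarrow>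
      (- 2 * (cnj \<rho> * (cnj (sa 0))\<^sup>2), - 2 * (norm \<rho> * norm (0::complex) * (norm (sa 0))\<^sup>2))"
    by (intro tendsto_intros ratio salim rlim)
  ultimately have "?D \<longlonglongrightarrow> (- 2 * (cnj \<rho> * (cnj (sa 0))\<^sup>2), 0)" by simp
  moreover have "(- 2 * (cnj \<rho> * (cnj (sa 0))\<^sup>2), 0) =
      (if k = M then (- 2 * (cnj (vderiv_iter M r 0) / fact M * (cnj (sa 0))\<^sup>2), 0) else (0 :: complex \<times> real))"
    using k by (auto simp: \<rho>_def zero_prod_def power_0_left divide_inverse mult_ac)
  ultimately show ?thesis by (simp add: x_def)
qed

end

section \<open>Large-time behaviour of the boundary coefficients\<close>

locale pulse_hierarchy_moment = pulse_hierarchy +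
  fixes M :: nat
  assumes M: "M \<ge> 1" and low: "\<And>m. m < M \<Longrightarrow> vderiv_iter m r 0 = 0"
begin

text \<open>The coefficient of order M at 0 of the off-diagonal component of
  \<open>Uinf\<close>.\<close>

definition kap :: complex where
  "kap = - 2 * (cnj (vderiv_iter M r 0) / fact M * (cnj (sa 0))\<^sup>2)"

lemma q0_rapid: "rapid q0"
  unfolding rapid_def using qK by blast

lemma T_deriv_rapid:
  assumes "\<And>j. j < k \<Longrightarrow> rapid (dev j)"
  shows "rapid (\<lambda>t. rot (q0 t) (T k t) + (case k of 0 \<Rightarrow> 0 | Suc i \<Rightarrow> shift (T i t)))"
proof (rule rapid_add)
  show "rapid (\<lambda>t. rot (q0 t) (T k t))"
  proof (rule rapid_poly_bound[OF q0_rapid])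
    fix t :: real assume t: "t \<ge> 0"
    have "norm (rot (q0 t) (T k t)) \<le> 2 * norm (q0 t) * (2 * t) ^ k"
      using norm_rot[of "q0 t" "T k t"] mult_left_mono[OF norm_T[OF t, of k], of "2 * norm (q0 t)"] by simp
    also have "\<dots> \<le> 2 * norm (q0 t) * (2 * (1 + t)) ^ k"
      using t by (intro mult_left_mono power_mono) auto
    finally show "norm (rot (q0 t) (T k t)) \<le> (2 * 2 ^ k) * (1 + t) ^ k * norm (q0 t)"
      by (simp only: power_mult_distrib mult_ac)
  qed
  show "rapid (\<lambda>t. case k of 0 \<Rightarrow> 0 | Suc i \<Rightarrow> shift (T i t))"
  proof (cases k)
    case 0 then show ?thesis by (auto simp: rapid_def)
  next
    case (Suc i)
    have "rapid (\<lambda>t. shift (T i t))"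
      by (rule rapid_poly_bound[OF assms[of i], of _ 2 0]) (use Suc norm_shift[of "dev i _"] in \<open>auto simp: shift_dev\<close>)
    then show ?thesis by (simp add: Suc)
  qed
qed

text \<open>If all earlier deviations decay rapidly, then so does the derivative of the k-th one,
  which therefore has a limit; comparing with \<open>Uinf\<close> near 0 identifies it. Below M the
  limit is 0, so the induction continues; at M it is \<open>kap\<close>.\<close>

lemma dev_rapid: "k \<le> M \<Longrightarrow> rapid (\<lambda>t. dev k t - (if k = M then (kap, 0) else 0))"
proof (induction k rule: less_induct)
  case (less k)
  have prev: "rapid (dev j)" if "j < k" for j
    using less.IH[OF that] that less.prems by simp
  have "(dev k has_vector_derivative rot (q0 t) (T k t) + (case k of 0 \<Rightarrow> 0 | Suc i \<Rightarrow> shift (T i t))) (at t within {0..})"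
    if "t \<ge> 0" for t
    using has_vector_derivative_diff[OF T_deriv[OF that, of k] has_vector_derivative_const]
    unfolding dev_def by simp
  from rapid_derivative_limit[OF this T_deriv_rapid[OF prev]]
  obtain l where l: "rapid (\<lambda>t. dev k t - l)" by blast
  have "l = (if k = M then (kap, 0) else 0)"
    using LIMSEQ_unique[OF dev_limit_identify[OF prev l] Uinf_scaled_limit[OF low M less.prems]]
    by (simp add: kap_def)
  with l show ?case by simp
qed

text \<open>The polynomial growth is counted from the bounded coefficient \<open>T M\<close>, so
  \<open>T (M + j)\<close> grows like the power j of t, not M + j. The M powers saved here become
  the factor \<open>z ^ M\<close>.\<close>

lemma dev_growth:
  obtains K where "K \<ge> 0" "\<And>j t. t \<ge> 0 \<Longrightarrow> norm (T (M + j) t) \<le> K * (2 * (1 + t)) ^ j"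
proof -
  have devM: "dev M = T M" using M by (simp add: dev_def fun_eq_iff)
  obtain K1 where K1: "K1 \<ge> 0" "\<And>t. t \<ge> 0 \<Longrightarrow> norm (dev M t - (kap, 0)) \<le> K1 / (1 + t) ^ 0"
    using rapidE[OF dev_rapid[of M], of 0] by auto
  define K where "K = K1 + norm kap"
  have K0: "K \<ge> 0" using K1 by (simp add: K_def)
  have main: "t \<ge> 0 \<Longrightarrow> norm (T (M + j) t) \<le> K * (2 * (1 + t)) ^ j" for j t
  proof (induction j arbitrary: t)
    case 0
    have "norm (T M t) \<le> norm (T M t - (kap, 0)) + norm (kap, 0::real)"
      using norm_triangle_ineq[of "T M t - (kap, 0)" "(kap, 0)"] by simp
    then show ?case using K1(2)[OF 0] by (simp add: devM K_def norm_Pair)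
  next
    case (Suc j)
    let ?g = "\<lambda>t. K * (2 * (1 + t)) ^ Suc j"
    let ?g' = "\<lambda>t. K * (2 * (real (Suc j) * (2 * (1 + t)) ^ j))"
    have "norm (T (M + Suc j) t) \<le> norm (T (M + Suc j) 0) + ?g t - ?g 0"
    proof (rule norm_growth_bound[OF Suc.prems, where g' = ?g' and x' = "\<lambda>t. rot (q0 t) (T (M + Suc j) t) + shift (T (M + j) t)"])
      fix s assume s: "s \<in> {0..t}"
      show "(T (M + Suc j) has_vector_derivative rot (q0 s) (T (M + Suc j) s) + shift (T (M + j) s)) (at s within {0..t})"
        using T_deriv_sub[OF s, of "M + Suc j"] by simp
      show "(?g has_real_derivative ?g' s) (at s within {0..t})"
        by (rule derivative_eq_intros refl | simp)+
      have p: "0 \<le> (2 * (1 + s)) ^ j" using s by simp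
      then show "0 \<le> ?g' s" using K0 by simp
      have "norm (shift (T (M + j) s)) \<le> 2 * (K * (2 * (1 + s)) ^ j)"
        using norm_shift[of "T (M + j) s"] Suc.IH[of s] s by simp
      also have "\<dots> = K * (2 * (1 * (2 * (1 + s)) ^ j))" by simp
      also have "\<dots> \<le> ?g' s" using p K0 by (intro mult_left_mono mult_right_mono) auto
      finally show "inner (T (M + Suc j) s) (rot (q0 s) (T (M + Suc j) s) + shift (T (M + j) s)) \<le> norm (T (M + Suc j) s) * ?g' s"
        by (simp only: inner_add_right inner_rot add_0_left)
          (rule order_trans[OF norm_cauchy_schwarz mult_left_mono], auto)
    qed
    moreover have "0 \<le> ?g 0" using K0 by simp
    moreover have "T (M + Suc j) 0 = 0" by (simp add: T_init)
    ultimately show ?case by simp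
  qed
  show thesis by (rule that[OF K0 main])
qed

definition err :: "nat \<Rightarrow> real \<Rightarrow> complex" where
  "err j t = fst (T (M + j) t) - kap * (2 * \<i> * of_real t) ^ j / fact j"

lemma err_deriv:
  assumes t: "t \<in> {0..S}"
  shows "(err (Suc j) has_vector_derivative - 2 * q0 t * of_real (snd (T (M + Suc j) t)) + 2 * \<i> * err j t) (at t within {0..S})"
proof -
  have 1: "((\<lambda>t. fst (T (M + Suc j) t)) has_vector_derivative
      - 2 * q0 t * of_real (snd (T (M + Suc j) t)) + 2 * \<i> * fst (T (M + j) t)) (at t within {0..S})"
    using bounded_linear.has_vector_derivative[OF bounded_linear_fst T_deriv_sub[OF t, of "M + Suc j"]]
    by (simp add: rot_def shift_def)
  have "((\<lambda>w. kap * (2 * \<i> * w) ^ Suc j / fact (Suc j)) has_field_derivative 2 * \<i> * (kap * (2 * \<i> * of_real t) ^ j / fact j)) (at (of_real t) within of_real ` {0..S})"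
  proof -
    have "((\<lambda>w. kap / fact (Suc j) * (2 * \<i> * w) ^ Suc j) has_field_derivative
        kap / fact (Suc j) * (of_nat (Suc j) * (2 * \<i> * of_real t) ^ j * (2 * \<i>))) (at (of_real t) within of_real ` {0..S})"
      by (rule derivative_eq_intros refl | simp)+
    moreover have "kap / fact (Suc j) * (of_nat (Suc j) * w * (2 * \<i>)) = 2 * \<i> * (kap * w / fact j)" for w
    proof -
      have "kap / (a * F) * (a * w * (2 * \<i>)) = 2 * \<i> * (kap * w / F)" if "a \<noteq> 0" "F \<noteq> 0" for a F :: complex
        using that by (simp add: field_simps)
      from this[OF of_nat_neq_0 fact_nonzero] show ?thesis by (simp only: fact_Suc)
    qed
    ultimately show ?thesis by (simp only: times_divide_eq_left)
  qed
  moreover have "((\<lambda>t. of_real t :: complex) has_vector_derivative 1) (at t within {0..S})"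
    by (auto intro!: derivative_eq_intros)
  ultimately have 2: "((\<lambda>t. kap * (2 * \<i> * of_real t) ^ Suc j / fact (Suc j)) has_vector_derivative
      2 * \<i> * (kap * (2 * \<i> * of_real t) ^ j / fact j)) (at t within {0..S})"
    using field_vector_diff_chain_within[of of_real 1 t "{0..S}" "\<lambda>w. kap * (2 * \<i> * w) ^ Suc j / fact (Suc j)"]
    by (simp add: o_def)
  from has_vector_derivative_diff[OF 1 2] show ?thesis
    unfolding err_def by (simp add: algebra_simps)
qed

lemma err_0: "err (Suc j) 0 = 0"
  by (simp add: err_def T_init)

lemma err_M_rapid: "rapid (err 0)"
proof (rule rapid_poly_bound[OF dev_rapid[OF order_refl], of _ 1 0])
  fix t :: real
  have "dev M t - (kap, 0) = (fst (T M t) - kap, snd (T M t))"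
    using M by (cases "T M t") (simp add: dev_def)
  then show "norm (err 0 t) \<le> 1 * (1 + t) ^ 0 * norm (dev M t - (if M = M then (kap, 0) else 0))"
    using norm_fst_le[of "fst (T M t) - kap" "snd (T M t)"] by (simp add: err_def)
qed

text \<open>The subtracted polynomial satisfies the equation without pulse exactly. As
  \<open>err 0\<close> decays rapidly, \<open>err 1\<close> stays bounded and each later step adds
  one power of t: always one power fewer than the leading term. The growth of the \<open>q0\<close>
  term is defeated by the decay of the pulse.\<close>

lemma err_growth:
  obtains K where "K \<ge> 0" "\<And>j t. t \<ge> 0 \<Longrightarrow> norm (err (Suc j) t) \<le> K * (4 * (1 + t)) ^ j"
proof -
  obtain K1 where K1: "K1 \<ge> 0" "\<And>j t. t \<ge> 0 \<Longrightarrow> norm (T (M + j) t) \<le> K1 * (2 * (1 + t)) ^ j"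
    by (rule dev_growth) (rule that)
  obtain K2 where K2: "K2 \<ge> 0" "\<And>t. t \<ge> 0 \<Longrightarrow> norm (err 0 t) \<le> K2 / (1 + t) ^ 2"
    using rapidE[OF err_M_rapid, of 2] by auto
  \<comment> \<open>The two summands bound, after division by \<open>(1 + s)\<^sup>2\<close>, the
    pulse term and the contribution of \<open>err 0\<close> to the derivative of
    \<open>err 1\<close>.\<close>
  define c where "c = 4 * qK 3 * K1 + 2 * K2"
  \<comment> \<open>Chosen so that the pulse term \<open>8 * K1 * qK 2\<close> is at most
    \<open>2 * K\<close>. With the \<open>2 * K\<close> from the previous coefficient this makes
    \<open>4 * K\<close>, whence the base 4.\<close>
  define K where "K = c + 4 * qK 2 * K1"
  have c0: "c \<ge> 0" using K1(1) K2(1) qK_nonneg by (simp add: c_def)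
  have K0: "K \<ge> 0" using c0 K1(1) qK_nonneg by (simp add: K_def)
  have nsnd: "norm (- 2 * q0 t * of_real (snd (T (M + Suc j) t))) \<le> 2 * norm (q0 t) * (K1 * (2 * (1 + t)) ^ Suc j)"
    if t: "t \<ge> 0" for j t
  proof -
    have "\<bar>snd (T (M + Suc j) t)\<bar> \<le> norm (T (M + Suc j) t)"
      using norm_snd_le[of "snd (T (M + Suc j) t)" "fst (T (M + Suc j) t)"] by simp
    also have "\<dots> \<le> K1 * (2 * (1 + t)) ^ Suc j" by (rule K1(2)[OF t])
    finally have "2 * norm (q0 t) * \<bar>snd (T (M + Suc j) t)\<bar> \<le> 2 * norm (q0 t) * (K1 * (2 * (1 + t)) ^ Suc j)"
      by (rule mult_left_mono) simp
    then show ?thesis by (simp add: norm_mult)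
  qed
  have base: "norm (err (Suc 0) t) \<le> c" if t: "t \<ge> 0" for t
  proof -
    have "norm (err (Suc 0) t) \<le> norm (err (Suc 0) 0) + (- c / (1 + t)) - (- c / (1 + 0))"
    proof (rule norm_growth_bound[OF t err_deriv, where g' = "\<lambda>s. c / (1 + s)\<^sup>2"])
      fix s assume s: "s \<in> {0..t}"
      then have s0: "s \<ge> 0" by simp
      show "((\<lambda>x. - c / (1 + x)) has_real_derivative c / (1 + s)\<^sup>2) (at s within {0..t})"
        using s by (auto intro!: derivative_eq_intros simp: power2_eq_square)
      show "0 \<le> c / (1 + s)\<^sup>2" using c0 by simp
      have q3: "norm (q0 s) * (1 + s) \<le> qK 3 / (1 + s)\<^sup>2"
        using qK[OF s0, of 3] s0 by (simp add: pos_le_divide_eq power3_eq_cube power2_eq_square mult.assoc)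
      have "norm (- 2 * q0 s * of_real (snd (T (M + Suc 0) s)) + 2 * \<i> * err 0 s) \<le>
          2 * norm (q0 s) * (K1 * (2 * (1 + s)) ^ Suc 0) + 2 * (K2 / (1 + s)\<^sup>2)"
        using norm_triangle_ineq[of "- 2 * q0 s * of_real (snd (T (M + Suc 0) s))" "2 * \<i> * err 0 s"] nsnd[OF s0, of 0] K2(2)[OF s0]
        by (simp add: norm_mult)
      also have "\<dots> = 4 * K1 * (norm (q0 s) * (1 + s)) + 2 * (K2 / (1 + s)\<^sup>2)" by simp
      also have "\<dots> \<le> 4 * K1 * (qK 3 / (1 + s)\<^sup>2) + 2 * (K2 / (1 + s)\<^sup>2)"
        using K1(1) q3 by (intro add_right_mono mult_left_mono) auto
      also have "\<dots> = c / (1 + s)\<^sup>2" by (simp add: c_def add_divide_distrib mult_ac)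
      finally have b: "norm (- 2 * q0 s * of_real (snd (T (M + Suc 0) s)) + 2 * \<i> * err 0 s) \<le> c / (1 + s)\<^sup>2" .
      show "inner (err (Suc 0) s) (- 2 * q0 s * of_real (snd (T (M + Suc 0) s)) + 2 * \<i> * err 0 s) \<le> norm (err (Suc 0) s) * (c / (1 + s)\<^sup>2)"
        by (rule order_trans[OF norm_cauchy_schwarz mult_left_mono[OF b norm_ge_zero]])
    qed
    moreover have "0 \<le> c / (1 + t)" using c0 t by simp
    ultimately show ?thesis by (simp add: err_0)
  qed
  have main: "t \<ge> 0 \<Longrightarrow> norm (err (Suc j) t) \<le> K * (4 * (1 + t)) ^ j" for j t
  proof (induction j arbitrary: t)
    case 0
    have "c \<le> K" using K1(1) qK_nonneg by (simp add: K_def)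
    then show ?case using base[OF 0] by simp
  next
    case (Suc j)
    let ?g = "\<lambda>t. K * (4 * (1 + t)) ^ Suc j"
    let ?g' = "\<lambda>t. K * (4 * (real (Suc j) * (4 * (1 + t)) ^ j))"
    have "norm (err (Suc (Suc j)) t) \<le> norm (err (Suc (Suc j)) 0) + ?g t - ?g 0"
    proof (rule norm_growth_bound[OF Suc.prems err_deriv, where g' = ?g'])
      fix s assume s: "s \<in> {0..t}"
      then have s0: "s \<ge> 0" by simp
      show "(?g has_real_derivative ?g' s) (at s within {0..t})"
        by (rule derivative_eq_intros refl | simp)+
      have p: "0 \<le> (4 * (1 + s)) ^ j" using s by simp
      then show "0 \<le> ?g' s" using K0 by simp
      have "2 * norm (q0 s) * (K1 * (2 * (1 + s)) ^ Suc (Suc j)) = 8 * K1 * (norm (q0 s) * (1 + s)\<^sup>2) * (2 * (1 + s)) ^ j"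
      proof -
        have "2 * x * (K1 * (2 * u * (2 * u * b))) = 8 * K1 * (x * (u * u)) * b" for x u b :: real by simp
        then show ?thesis by (simp only: power2_eq_square power_Suc)
      qed
      also have "\<dots> \<le> 8 * K1 * qK 2 * (4 * (1 + s)) ^ j"
        using K1(1) qK[OF s0, of 2] s0 qK_nonneg by (intro mult_mono power_mono) auto
      also have "\<dots> \<le> 2 * K * (4 * (1 + s)) ^ j"
        using p c0 by (intro mult_right_mono) (auto simp: K_def)
      finally have a: "2 * norm (q0 s) * (K1 * (2 * (1 + s)) ^ Suc (Suc j)) \<le> 2 * K * (4 * (1 + s)) ^ j" .
      have "norm (- 2 * q0 s * of_real (snd (T (M + Suc (Suc j)) s)) + 2 * \<i> * err (Suc j) s) \<le>
          2 * norm (q0 s) * (K1 * (2 * (1 + s)) ^ Suc (Suc j)) + 2 * (K * (4 * (1 + s)) ^ j)"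
        using norm_triangle_ineq[of "- 2 * q0 s * of_real (snd (T (M + Suc (Suc j)) s))" "2 * \<i> * err (Suc j) s"]
          nsnd[OF s0, of "Suc j"] Suc.IH[OF s0] by (simp add: norm_mult)
      also have "\<dots> \<le> K * (4 * (1 * (4 * (1 + s)) ^ j))" using a by simp
      also have "\<dots> \<le> ?g' s" using p K0 by (intro mult_left_mono mult_right_mono) auto
      finally have b: "norm (- 2 * q0 s * of_real (snd (T (M + Suc (Suc j)) s)) + 2 * \<i> * err (Suc j) s) \<le> ?g' s" .
      show "inner (err (Suc (Suc j)) s) (- 2 * q0 s * of_real (snd (T (M + Suc (Suc j)) s)) + 2 * \<i> * err (Suc j) s) \<le> norm (err (Suc (Suc j)) s) * ?g' s"
        by (rule order_trans[OF norm_cauchy_schwarz mult_left_mono[OF b norm_ge_zero]])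
    qed
    moreover have "0 \<le> ?g 0" using K0 by simp
    ultimately show ?case by (simp add: err_0)
  qed
  show thesis by (rule that[OF K0 main])
qed

text \<open>For \<open>N = M\<close> the leading part of the off-diagonal boundary data. For
  \<open>N = M + 1\<close> the sequence is delayed by one place, which amounts to integrating once
  in z and so describes q.\<close>

definition coef :: "nat \<Rightarrow> real \<Rightarrow> nat \<Rightarrow> complex" where
  "coef N t n = (if n < N then 0 else kap * (2 * \<i> * of_real t) ^ (n - N) / fact (n - N))"

lemma norm_coef: assumes "t \<ge> 0" shows "norm (coef N t n) \<le> norm kap * (1 + 2 * t) ^ n"
proof (cases "n < N")
  case False
  have "norm (coef N t n) = norm kap * (2 * t) ^ (n - N) / fact (n - N)"
    using False assms by (simp add: coef_def norm_mult norm_divide norm_power)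
  also have "\<dots> \<le> norm kap * (2 * t) ^ (n - N) / 1"
    using assms by (intro divide_left_mono) auto
  also have "\<dots> \<le> norm kap * (1 + 2 * t) ^ (n - N)"
    using assms by (simp only: div_by_1, intro mult_left_mono power_mono) auto
  also have "\<dots> \<le> norm kap * (1 + 2 * t) ^ n"
    using assms by (intro mult_left_mono power_increasing) auto
  finally show ?thesis .
qed (use assms in \<open>simp add: coef_def\<close>)

text \<open>Along the curve, z itself is a power of t, so rapid decay beats every power of
  z.\<close>

lemma rapid_le_power_of_z:
  fixes f :: "real \<Rightarrow> 'a::real_normed_vector"
  assumes f: "rapid f" and C: "C > 0"
  obtains K where "K \<ge> 0" "\<And>t. t \<ge> 1 \<Longrightarrow> norm (f t) \<le> K * (C * t powr \<alpha>) ^ s"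
proof -
  define n where "n = nat \<lceil>- \<alpha> * real s\<rceil>"
  obtain K where K: "K \<ge> 0" "\<And>t. t \<ge> 0 \<Longrightarrow> norm (f t) \<le> K / (1 + t) ^ n"
    using rapidE[OF f, of n] by auto
  show thesis
  proof (rule that[of "K / C ^ s"])
    show "K / C ^ s \<ge> 0" using K C by simp
    fix t :: real assume t: "t \<ge> 1"
    have "norm (f t) \<le> K / (1 + t) ^ n" using K(2)[of t] t by simp
    also have "\<dots> \<le> K / t ^ n" using t K(1) by (intro divide_left_mono power_mono mult_pos_pos) auto
    also have "\<dots> = K * t powr (- real n)" using t by (simp add: powr_minus powr_realpow divide_inverse)
    also have "\<dots> \<le> K * t powr (\<alpha> * real s)"
    proof (intro mult_left_mono powr_mono)
      have "- \<alpha> * real s \<le> real n" unfolding n_def by linarith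
      then show "- real n \<le> \<alpha> * real s" by simp
    qed (use t K in auto)
    also have "\<dots> = K / C ^ s * (C * t powr \<alpha>) ^ s"
      using t C by (simp add: power_mult_distrib powr_power mult.commute)
    finally show "norm (f t) \<le> K / C ^ s * (C * t powr \<alpha>) ^ s" .
  qed
qed

text \<open>Since \<open>t z\<close> stays bounded, powers of \<open>t\<close> are absorbed by powers of \<open>\<gamma> = const / z\<close>, and \<open>\<gamma> z\<close> is
  bounded. This turns the smallness of the deviations at \<open>z = 0\<close> into relative factors \<open>z\<^sup>M\<close> and \<open>z\<^bsup>M+1\<^esup>\<close>.\<close>

lemma scaled_bounds:
  assumes C: "C > 0" and \<alpha>: "\<alpha> \<le> - 1"
  obtains K1 K2 where "K1 \<ge> 0" "K2 \<ge> 0"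
    "\<And>t k. t \<ge> 1 \<Longrightarrow> norm (dev k t) \<le> K1 * (C * t powr \<alpha>) ^ M * (8 * max C 1 / (C * t powr \<alpha>)) ^ k"
    "\<And>t k. t \<ge> 1 \<Longrightarrow> norm (fst (T k t) - coef M t k) \<le> K2 * (C * t powr \<alpha>) ^ (M + 1) * (8 * max C 1 / (C * t powr \<alpha>)) ^ k"
proof -
  define Z where "Z t = C * t powr \<alpha>" for t
  \<comment> \<open>For \<open>t \<ge> 1\<close>, \<open>4 * (1 + t) \<le> 8 * t\<close> and
    \<open>t * Z t \<le> C\<close>, so \<open>\<gamma> t\<close> dominates
    \<open>4 * (1 + t)\<close>. The maximum with 1 ensures that \<open>Z t * \<gamma> t\<close> is
    at least 1.\<close>
  define c0 where "c0 = 8 * max C 1"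
  define \<gamma> where "\<gamma> t = c0 / Z t" for t
  have c0: "c0 \<ge> 1" by (simp add: c0_def)
  have Z: "Z t > 0" "Z t \<le> C" "4 * (1 + t) \<le> \<gamma> t" "1 \<le> \<gamma> t" if t: "t \<ge> 1" for t
  proof -
    show Z0: "Z t > 0" using C t by (simp add: Z_def)
    have "t powr \<alpha> \<le> t powr 0" using t \<alpha> by (intro powr_mono) auto
    then show "Z t \<le> C" using C t by (simp add: Z_def mult_left_le)
    have "t * t powr \<alpha> \<le> 1"
    proof -
      have "t * t powr \<alpha> = t powr (1 + \<alpha>)" using t by (simp add: powr_add)
      also have "\<dots> \<le> t powr 0" using t \<alpha> by (intro powr_mono) auto
      finally show ?thesis using t by simp
    qed
    then have "t * Z t \<le> C" using C by (simp add: Z_def mult.left_commute mult_left_le)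
    then have "4 * (1 + t) * Z t \<le> c0"
    proof -
      have "4 * (1 + t) * Z t \<le> 8 * t * Z t" using t Z0 by (intro mult_right_mono) auto
      then show ?thesis using \<open>t * Z t \<le> C\<close> unfolding c0_def by linarith
    qed
    then show g: "4 * (1 + t) \<le> \<gamma> t" using Z0 by (simp add: \<gamma>_def pos_le_divide_eq)
    have "1 \<le> 4 * (1 + t)" using t by simp
    then show "1 \<le> \<gamma> t" using g by (rule order_trans)
  qed
  \<comment> \<open>Since the product of \<open>Z t\<close> and \<open>\<gamma> t\<close> is the
    constant \<open>c0 \<ge> 1\<close>, any number s of factors of this product may be inserted.
    This trades s missing powers of t for the factor \<open>Z t ^ s\<close>.\<close>
  have scale: "(4 * (1 + t)) ^ j \<le> Z t ^ s * \<gamma> t ^ (s + j)" if t: "t \<ge> 1" for t j s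
  proof -
    have "Z t ^ s * \<gamma> t ^ s = c0 ^ s" using Z(1)[OF t] by (simp add: \<gamma>_def power_mult_distrib[symmetric])
    then have "1 \<le> Z t ^ s * \<gamma> t ^ s" using c0 by simp
    moreover have "(4 * (1 + t)) ^ j \<le> \<gamma> t ^ j" using Z(3)[OF t] t by (intro power_mono) auto
    moreover have "0 \<le> (4 * (1 + t)) ^ j" using t by simp
    ultimately have "1 * (4 * (1 + t)) ^ j \<le> (Z t ^ s * \<gamma> t ^ s) * \<gamma> t ^ j"
      using Z[OF t] by (intro mult_mono) auto
    then show ?thesis by (simp add: power_add mult.assoc)
  qed
  obtain K1 where K1: "K1 \<ge> 0" "\<And>j t. t \<ge> 0 \<Longrightarrow> norm (T (M + j) t) \<le> K1 * (2 * (1 + t)) ^ j"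
    by (rule dev_growth) (rule that)
  obtain K2 where K2: "K2 \<ge> 0" "\<And>j t. t \<ge> 0 \<Longrightarrow> norm (err (Suc j) t) \<le> K2 * (4 * (1 + t)) ^ j"
    by (rule err_growth) (rule that)
  have rapid_small: "rapid (dev k)" if "k < M" for k using dev_rapid[of k] that by simp
  have "\<exists>K. K \<ge> 0 \<and> (k < M \<longrightarrow> (\<forall>t\<ge>1. norm (dev k t) \<le> K * Z t ^ (M + 1)))" for k
  proof (cases "k < M")
    case True
    obtain K where "K \<ge> 0" "\<And>t. t \<ge> 1 \<Longrightarrow> norm (dev k t) \<le> K * (C * t powr \<alpha>) ^ (M + 1)"
      by (rule rapid_le_power_of_z[OF rapid_small[OF True] C, of \<alpha> "M + 1"]) (rule that)
    then show ?thesis unfolding Z_def by blast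
  qed auto
  then have "\<forall>k. \<exists>K. K \<ge> 0 \<and> (k < M \<longrightarrow> (\<forall>t\<ge>1. norm (dev k t) \<le> K * Z t ^ (M + 1)))" by blast
  from choice[OF this] obtain L where L': "\<forall>k. L k \<ge> 0 \<and> (k < M \<longrightarrow> (\<forall>t\<ge>1. norm (dev k t) \<le> L k * Z t ^ (M + 1)))" by (rule exE)
  define K3 where "K3 = (\<Sum>k<M. L k)"
  have K3: "norm (dev k t) \<le> K3 * Z t ^ (M + 1)" if "k < M" "t \<ge> 1" for k t
  proof -
    have "norm (dev k t) \<le> L k * Z t ^ (M + 1)" using L' that by blast
    also have "\<dots> \<le> K3 * Z t ^ (M + 1)"
      unfolding K3_def using L' that Z(1)[OF that(2)] by (intro mult_right_mono member_le_sum) auto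
    finally show ?thesis .
  qed
  have K30: "K3 \<ge> 0" unfolding K3_def using L' by (intro sum_nonneg) blast
  obtain K4 where K4: "K4 \<ge> 0" "\<And>t. t \<ge> 1 \<Longrightarrow> norm (err 0 t) \<le> K4 * (C * t powr \<alpha>) ^ (M + 1)"
    by (rule rapid_le_power_of_z[OF err_M_rapid C, of \<alpha> "M + 1"]) (rule that)
  have g1: "1 \<le> \<gamma> t ^ k" if "t \<ge> 1" for t k using Z(4)[OF that] by (rule one_le_power)
  have b1: "norm (dev k t) \<le> (K1 + K3 * C) * Z t ^ M * \<gamma> t ^ k" if t: "t \<ge> 1" for t k
  proof (cases "k < M")
    case True
    have "norm (dev k t) \<le> K3 * Z t ^ (M + 1)" by (rule K3[OF True t])
    also have "\<dots> = K3 * Z t * Z t ^ M * 1" by simp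
    also have "\<dots> \<le> (K1 + K3 * C) * Z t ^ M * \<gamma> t ^ k"
      using Z[OF t] K30 K1(1) g1[OF t] C by (intro mult_mono) (auto intro: add_increasing mult_left_mono)
    finally show ?thesis .
  next
    case False
    then obtain j where k: "k = M + j" using le_Suc_ex not_less by blast
    have "dev k t = T (M + j) t" using M by (simp add: dev_def k)
    then have "norm (dev k t) \<le> K1 * (2 * (1 + t)) ^ j" using K1(2)[of t j] t by simp
    also have "\<dots> \<le> K1 * (4 * (1 + t)) ^ j" using t K1(1) by (intro mult_left_mono power_mono) auto
    also have "\<dots> \<le> K1 * (Z t ^ M * \<gamma> t ^ (M + j))" using K1(1) scale[OF t, of j M] by (rule mult_left_mono[rotated])
    also have "\<dots> \<le> (K1 + K3 * C) * (Z t ^ M * \<gamma> t ^ k)"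
      unfolding k using Z[OF t] K30 C by (intro mult_right_mono) auto
    finally show ?thesis by (simp add: mult.assoc)
  qed
  have b2: "norm (fst (T k t) - coef M t k) \<le> (K2 + K3 + K4) * Z t ^ (M + 1) * \<gamma> t ^ k" if t: "t \<ge> 1" for t k
  proof -
    \<comment> \<open>Below M the data are zero and the deviation is rapid; at M the remainder
      \<open>err 0\<close> is rapid. Above M the remainder is short of the index k by M + 1 powers
      of t, the value of s used in \<open>scale\<close>.\<close>
    consider "k < M" | "k = M" | j where "k = M + Suc j"
      by (metis less_imp_Suc_add linorder_neqE_nat add_Suc_right)
    then show ?thesis
    proof cases
      case 1
      have "fst (T k t) - coef M t k = fst (dev k t)" using 1 by (simp add: coef_def dev_def)
      then have "norm (fst (T k t) - coef M t k) \<le> norm (dev k t)"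
        using norm_fst_le[of "fst (dev k t)" "snd (dev k t)"] by simp
      also have "\<dots> \<le> K3 * Z t ^ (M + 1) * 1" using K3[OF 1 t] by simp
      also have "\<dots> \<le> (K2 + K3 + K4) * Z t ^ (M + 1) * \<gamma> t ^ k"
        using Z[OF t] K30 K2(1) K4(1) g1[OF t] by (intro mult_mono mult_nonneg_nonneg) auto
      finally show ?thesis .
    next
      case 2
      have "norm (fst (T k t) - coef M t k) \<le> K4 * Z t ^ (M + 1) * 1"
        using K4(2)[OF t] 2 by (simp add: coef_def err_def Z_def)
      also have "\<dots> \<le> (K2 + K3 + K4) * Z t ^ (M + 1) * \<gamma> t ^ k"
        using Z[OF t] K30 K2(1) K4(1) g1[OF t] by (intro mult_mono mult_nonneg_nonneg) auto
      finally show ?thesis .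
    next
      case 3
      have "fst (T k t) - coef M t k = err (Suc j) t" by (simp add: 3 coef_def err_def)
      then have "norm (fst (T k t) - coef M t k) \<le> K2 * (4 * (1 + t)) ^ j" using K2(2)[of t j] t by simp
      also have "\<dots> \<le> K2 * (Z t ^ (M + 1) * \<gamma> t ^ (M + 1 + j))" using K2(1) scale[OF t, of j "M + 1"] by (rule mult_left_mono[rotated])
      also have "\<dots> \<le> (K2 + K3 + K4) * (Z t ^ (M + 1) * \<gamma> t ^ (M + 1 + j))"
        using Z[OF t] K30 K4(1) by (intro mult_right_mono mult_nonneg_nonneg) auto
      finally show ?thesis by (simp add: 3 mult.assoc)
    qed
  qed
  show thesis
  proof (rule that[of "K1 + K3 * C" "K2 + K3 + K4"])
    show "0 \<le> K1 + K3 * C" "0 \<le> K2 + K3 + K4" using K1(1) K2(1) K30 K4(1) C by auto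
  qed (use b1 b2 in \<open>simp_all add: Z_def \<gamma>_def c0_def\<close>)
qed

end

section \<open>The regime of bounded \<open>t z\<close>\<close>

text \<open>The power series part of the Bessel functions: \<open>J\<^sub>n(2\<i>\<surd>x) = (\<i>\<surd>x)\<^sup>n bessel_sum n x\<close>.\<close>

definition bessel_sum :: "nat \<Rightarrow> real \<Rightarrow> real" where
  "bessel_sum n x = (\<Sum>m. x ^ m / (fact m * fact (m + n)))"

lemma bessel_sum_term: "norm (x ^ m / (fact m * fact (m + n)) :: real) \<le> inverse (fact m) * \<bar>x\<bar> ^ m"
proof -
  have "\<bar>x\<bar> ^ m / (fact m * fact (m + n)) \<le> \<bar>x\<bar> ^ m / (fact m * 1)"
    by (intro divide_left_mono mult_left_mono) auto
  then show ?thesis by (simp add: abs_mult power_abs divide_inverse mult.commute)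
qed

lemma bessel_sum_summable: "summable (\<lambda>m. x ^ m / (fact m * fact (m + n)) :: real)"
  by (rule summable_comparison_test'[OF summable_exp[of "\<bar>x\<bar>"] bessel_sum_term])

lemma bessel_sum_le: "\<bar>bessel_sum n x\<bar> \<le> exp \<bar>x\<bar>"
proof -
  have "norm (\<Sum>m. x ^ m / (fact m * fact (m + n)) :: real) \<le> (\<Sum>m. inverse (fact m) * \<bar>x\<bar> ^ m)"
    by (rule norm_suminf_le[OF bessel_sum_term summable_exp])
  then show ?thesis by (simp add: bessel_sum_def exp_def)
qed

lemma bessel_J_imaginary:
  assumes x: "x \<ge> 0"
  shows "bessel_J n (2 * \<i> * of_real (sqrt x)) = (\<i> * of_real (sqrt x)) ^ n * of_real (bessel_sum n x)"
proof -
  have sq: "(\<i> * complex_of_real (sqrt x))\<^sup>2 = - of_real x"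
    using x by (simp add: power_mult_distrib of_real_power[symmetric] del: of_real_power)
  have "(-1) ^ k / (fact k * fact (k + n)) * (2 * \<i> * of_real (sqrt x) / 2) ^ (2 * k + n) =
      (\<i> * of_real (sqrt x)) ^ n * of_real (x ^ k / (fact k * fact (k + n)))" for k
  proof -
    have "(2 * \<i> * complex_of_real (sqrt x) / 2) ^ (2 * k + n) = (\<i> * of_real (sqrt x)) ^ n * (- of_real x) ^ k"
      by (simp add: power_add power_mult sq)
    moreover have "(-1) ^ k * (- complex_of_real x) ^ k = of_real x ^ k"
      by (simp add: power_mult_distrib[symmetric])
    ultimately show ?thesis by (simp add: mult_ac)
  qed
  then have "bessel_J n (2 * \<i> * of_real (sqrt x)) =
      (\<Sum>k. (\<i> * of_real (sqrt x)) ^ n * complex_of_real (x ^ k / (fact k * fact (k + n))))"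
    by (simp only: bessel_J_def)
  also have "\<dots> = (\<i> * of_real (sqrt x)) ^ n * (\<Sum>k. complex_of_real (x ^ k / (fact k * fact (k + n))))"
    by (rule suminf_mult[OF summable_of_real[OF bessel_sum_summable]])
  also have "(\<Sum>k. complex_of_real (x ^ k / (fact k * fact (k + n)))) = of_real (bessel_sum n x)"
    unfolding bessel_sum_def by (rule suminf_of_real[OF bessel_sum_summable, symmetric])
  finally show ?thesis .
qed

lemma exp_series_at_0: "exp_series c j 0 = c j"
  using powser_zero[of "\<lambda>k. c (j + k) / fact k"] by (simp add: exp_series_def)

text \<open>The first N entries vanish, which splits off \<open>(- \<i> * z) ^ N\<close>. In the
  remaining terms \<open>(2 * \<i> * t) * (- \<i> * z) = 2 * t * z\<close>, and the two factorials
  are those of the Bessel series.\<close>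

lemma (in pulse_hierarchy_moment) exp_series_coef:
  assumes t: "t \<ge> 0"
  shows "exp_series (coef N t) 0 z = kap * (- \<i> * of_real z) ^ N * of_real (bessel_sum N (2 * t * z))"
proof -
  let ?f = "\<lambda>k. coef N t (0 + k) / fact k * (- \<i> * complex_of_real z) ^ k"
  have "summable ?f" by (rule exp_series_summable[OF norm_coef]) (use t in auto)
  then have "exp_series (coef N t) 0 z = (\<Sum>k. ?f (k + N)) + sum ?f {..<N}"
    unfolding exp_series_def by (rule suminf_split_initial_segment)
  also have "sum ?f {..<N} = 0" by (auto simp: coef_def intro!: sum.neutral)
  also have "(\<lambda>k. ?f (k + N)) = (\<lambda>k. kap * (- \<i> * of_real z) ^ N * of_real ((2 * t * z) ^ k / (fact k * fact (k + N))))"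
  proof
    fix k
    have "(2 * \<i> * complex_of_real t) * (- \<i> * complex_of_real z) = of_real (2 * t * z)" by simp
    then have "(2 * \<i> * complex_of_real t) ^ k * (- \<i> * complex_of_real z) ^ k = of_real (2 * t * z) ^ k"
      by (simp only: power_mult_distrib[symmetric])
    then show "?f (k + N) = kap * (- \<i> * of_real z) ^ N * of_real ((2 * t * z) ^ k / (fact k * fact (k + N)))"
      by (simp add: coef_def power_add divide_inverse)
  qed
  also have "(\<Sum>k. kap * (- \<i> * of_real z) ^ N * complex_of_real ((2 * t * z) ^ k / (fact k * fact (k + N)))) =
      kap * (- \<i> * of_real z) ^ N * of_real (bessel_sum N (2 * t * z))"
    unfolding bessel_sum_def suminf_of_real[OF bessel_sum_summable]
    by (rule suminf_mult[OF summable_of_real[OF bessel_sum_summable]])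
  finally show ?thesis by simp
qed

text \<open>The hierarchy in t and z and its trace at \<open>z = 0\<close>, taken together. The
  z-range ends at \<open>C\<close>, which contains the whole curve for
  \<open>t \<ge> 1\<close>.\<close>

locale scaled_pulse = mb_hierarchy q0 q P D C R + pulse_hierarchy_moment q0 "\<lambda>k t. R k t 0" M
  for q0 q P D C R M +
  fixes \<alpha> :: real
  assumes C: "C > 0" and \<alpha>: "\<alpha> \<le> - 1"
begin

definition zt :: "real \<Rightarrow> real" where
  "zt t = C * t powr \<alpha>"

lemma zt_pos: "t \<ge> 1 \<Longrightarrow> zt t > 0"
  using C by (simp add: zt_def)

lemma zt_mult_le: assumes "t \<ge> 1" shows "t * zt t \<le> C"
proof -
  have "t * t powr \<alpha> = t powr (1 + \<alpha>)" using assms by (simp add: powr_add)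
  also have "\<dots> \<le> t powr 0" using assms \<alpha> by (intro powr_mono) auto
  finally show ?thesis using C assms by (simp add: zt_def mult.left_commute mult_left_le)
qed

lemma zt_le: assumes "t \<ge> 1" shows "zt t \<le> C"
  using zt_mult_le[OF assms] mult_right_mono[OF assms less_imp_le[OF zt_pos[OF assms]]] by simp

text \<open>Here \<open>M \<ge> 1\<close> enters: it gives \<open>2 * M \<ge> M + 1\<close>, so
  quadratic corrections are of the size of the error.\<close>

lemma zt_power_double_le: assumes t: "t \<ge> 1" shows "(zt t ^ M)\<^sup>2 \<le> C ^ (M - 1) * zt t ^ (M + 1)"
proof -
  have "(zt t ^ M)\<^sup>2 = zt t ^ (M - 1) * zt t ^ (M + 1)"
    using M by (simp only: power_mult[symmetric] power_add[symmetric]) (rule arg_cong[of _ _ "power (zt t)"], simp)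
  also have "\<dots> \<le> C ^ (M - 1) * zt t ^ (M + 1)"
    using zt_pos[OF t] zt_le[OF t] by (intro mult_right_mono power_mono) auto
  finally show ?thesis .
qed

lemma eps_0_eq_dev: "eps k t 0 = dev k t"
  by (cases k) (simp_all add: eps_def dev_def)

text \<open>With \<open>\<gamma> = c0 / zt t\<close> the product \<open>\<gamma> * y\<close> is at
  most \<open>c0\<close> on the range of y, so the exponentials of the comparison bounds become
  constants and only powers of \<open>zt t\<close> remain.\<close>

lemma P_D_asymptotics:
  obtains K where "K \<ge> 0"
    "\<And>t y. t \<ge> 1 \<Longrightarrow> y \<in> {0..zt t} \<Longrightarrow> norm (P t y - exp_series (coef M t) 0 y) \<le> K * zt t ^ (M + 1)"
    "\<And>t. t \<ge> 1 \<Longrightarrow> \<bar>D t (zt t) - 1\<bar> \<le> K * zt t ^ (M + 1)"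
proof -
  define c0 where "c0 = 8 * max C 1"
  have c0: "c0 > 0" by (simp add: c0_def)
  obtain K1 K2 where K: "K1 \<ge> 0" "K2 \<ge> 0"
    "\<And>t k. t \<ge> 1 \<Longrightarrow> norm (dev k t) \<le> K1 * zt t ^ M * (c0 / zt t) ^ k"
    "\<And>t k. t \<ge> 1 \<Longrightarrow> norm (fst (R k t 0) - coef M t k) \<le> K2 * zt t ^ (M + 1) * (c0 / zt t) ^ k"
    by (rule scaled_bounds[OF C \<alpha>, folded zt_def, folded c0_def]) (rule that)
  define K3 where "K3 = K1\<^sup>2 * C ^ (M - 1) * (exp c0)\<^sup>2"
  have K3: "K3 \<ge> 0" using C by (simp add: K3_def)
  have sq: "(K1 * zt t ^ M * exp c0)\<^sup>2 \<le> K3 * zt t ^ (M + 1)" if t: "t \<ge> 1" for t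
  proof -
    have "(K1 * zt t ^ M * exp c0)\<^sup>2 = K1\<^sup>2 * (exp c0)\<^sup>2 * (zt t ^ M)\<^sup>2"
      by (simp only: power_mult_distrib mult_ac)
    also have "\<dots> \<le> K1\<^sup>2 * (exp c0)\<^sup>2 * (C ^ (M - 1) * zt t ^ (M + 1))"
      by (intro mult_left_mono zt_power_double_le t) auto
    finally show ?thesis by (simp only: K3_def mult_ac)
  qed
  define K4 where "K4 = (K2 + K3 * c0) * exp c0"
  have K4: "K4 \<ge> 0" using K K3 c0 by (simp add: K4_def)
  have bP: "norm (P t y - exp_series (coef M t) 0 y) \<le> K4 * zt t ^ (M + 1)" if t: "t \<ge> 1" and y: "y \<in> {0..zt t}" for t y
  proof -
    have z: "0 < zt t" "zt t \<le> C" using zt_pos[OF t] zt_le[OF t] by auto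
    have "norm (P t y - exp_series (coef M t) 0 y) \<le>
        (K2 * zt t ^ (M + 1) + (K1 * zt t ^ M * exp (c0 / zt t * zt t))\<^sup>2 * (c0 / zt t) * y) * exp (c0 / zt t * y)"
    proof (rule P_exp_series_bound[where A = "norm kap" and a = "1 + 2 * t"])
      show "norm (eps k t 0) \<le> K1 * zt t ^ M * (c0 / zt t) ^ k" for k
        unfolding eps_0_eq_dev by (rule K(3)[OF t])
      show "norm (fst (R k t 0) - coef M t k) \<le> K2 * zt t ^ (M + 1) * (c0 / zt t) ^ k" for k
        by (rule K(4)[OF t])
      show "norm (coef M t n) \<le> norm kap * (1 + 2 * t) ^ n" for n using t by (intro norm_coef) auto
    qed (use t z y K c0 in auto)
    also have "\<dots> = (K2 * zt t ^ (M + 1) + (K1 * zt t ^ M * exp c0)\<^sup>2 * (c0 / zt t * y)) * exp (c0 / zt t * y)"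
      using z by simp
    also have "\<dots> \<le> (K2 * zt t ^ (M + 1) + (K3 * zt t ^ (M + 1)) * c0) * exp c0"
    proof -
      have "c0 / zt t * y \<le> c0 / zt t * zt t" using y z c0 by (intro mult_left_mono) auto
      then have l: "c0 / zt t * y \<le> c0" using z by simp
      have nn: "0 \<le> c0 / zt t * y" using y z c0 by simp
      show ?thesis
        using l nn sq[OF t] K(2) K3 z c0 by (intro mult_mono add_mono order_refl) auto
    qed
    also have "\<dots> = K4 * zt t ^ (M + 1)" by (simp add: K4_def algebra_simps)
    finally show ?thesis .
  qed
  \<comment> \<open>On the unit sphere the squared distance from \<open>(0, 1)\<close> is
    \<open>2 - 2 * D\<close>, so the deviation of D is quadratic in \<open>eps 0\<close>.\<close>
  have bD: "\<bar>D t (zt t) - 1\<bar> \<le> K3 * zt t ^ (M + 1)" if t: "t \<ge> 1" for t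
  proof -
    have z: "0 < zt t" "zt t \<le> C" using zt_pos[OF t] zt_le[OF t] by auto
    have "norm (eps 0 t (zt t)) \<le> (c0 / zt t) ^ 0 * (K1 * zt t ^ M) * exp (c0 / zt t * zt t)"
    proof (rule eps_bound)
      show "norm (eps k t 0) \<le> K1 * zt t ^ M * (c0 / zt t) ^ k" for k
        unfolding eps_0_eq_dev by (rule K(3)[OF t])
    qed (use t z K c0 in auto)
    then have "(norm (eps 0 t (zt t)))\<^sup>2 \<le> (K1 * zt t ^ M * exp c0)\<^sup>2"
      using z by (intro power_mono) auto
    then have "(norm (eps 0 t (zt t)))\<^sup>2 \<le> K3 * zt t ^ (M + 1)" using sq[OF t] by linarith
    moreover have "(norm (eps 0 t (zt t)))\<^sup>2 = (norm (P t (zt t)))\<^sup>2 + (D t (zt t) - 1)\<^sup>2"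
      by (simp add: eps_def R_0 rho_def norm_Pair)
    moreover have "(norm (P t (zt t)))\<^sup>2 + (D t (zt t))\<^sup>2 = 1"
      using norm_rho[of "zt t" t] z t by (simp add: rho_def norm_Pair)
    moreover have "(D t (zt t))\<^sup>2 \<le> 1\<^sup>2"
      using calculation(3) zero_le_power2[of "norm (P t (zt t))"] unfolding one_power2 by linarith
    then have "\<bar>D t (zt t)\<bar> \<le> 1" using abs_le_square_iff[of "D t (zt t)" 1] by simp
    moreover have "0 \<le> K3 * zt t ^ (M + 1)" using K3 z by simp
    ultimately show ?thesis unfolding power2_diff by simp
  qed
  show thesis
  proof (rule that[of "K3 + K4"])
    fix t y :: real assume t: "t \<ge> 1"
    have "0 \<le> K3 * zt t ^ (M + 1)" "0 \<le> K4 * zt t ^ (M + 1)" using K3 K4 zt_pos[OF t] by auto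
    then show "\<bar>D t (zt t) - 1\<bar> \<le> (K3 + K4) * zt t ^ (M + 1)"
      "y \<in> {0..zt t} \<Longrightarrow> norm (P t y - exp_series (coef M t) 0 y) \<le> (K3 + K4) * zt t ^ (M + 1)"
      using bP[OF t, of y] bD[OF t] by (simp_all add: distrib_right)
  qed (use K3 K4 in auto)
qed

text \<open>Integrating \<open>q_z = - P\<close> from the boundary gains one power of z. The
  boundary value \<open>q0 t\<close> decays rapidly and is absorbed in any power of z.\<close>

lemma q_asymptotics:
  obtains K where "K \<ge> 0"
    "\<And>t. t \<ge> 1 \<Longrightarrow> norm (q t (zt t) - (- \<i>) * exp_series (coef (M + 1) t) 0 (zt t)) \<le> K * zt t ^ (M + 2)"
proof -
  obtain K1 where K1: "K1 \<ge> 0"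
    "\<And>t y. t \<ge> 1 \<Longrightarrow> y \<in> {0..zt t} \<Longrightarrow> norm (P t y - exp_series (coef M t) 0 y) \<le> K1 * zt t ^ (M + 1)"
    by (rule P_D_asymptotics) (rule that)
  obtain K2 where K2: "K2 \<ge> 0" "\<And>t. t \<ge> 1 \<Longrightarrow> norm (q0 t) \<le> K2 * zt t ^ (M + 2)"
    by (rule rapid_le_power_of_z[OF q0_rapid C, where \<alpha> = \<alpha> and s = "M + 2", folded zt_def]) (rule that)
  show thesis
  proof (rule that[of "K1 + K2"])
    fix t :: real assume t: "t \<ge> 1"
    let ?f = "\<lambda>y. q t y + \<i> * exp_series (coef (M + 1) t) 0 y"
    have z: "zt t > 0" by (rule zt_pos[OF t])
    have "coef (M + 1) t (Suc k) = coef M t k" for k by (cases "k < M") (simp_all add: coef_def)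
    then have shift: "exp_series (coef (M + 1) t) (Suc 0) y = exp_series (coef M t) 0 y" for y
      by (simp add: exp_series_def)
    have d: "(?f has_vector_derivative - (P t y - exp_series (coef M t) 0 y)) (at y within {0..zt t})" if y: "y \<in> {0..zt t}" for y
    proof -
      have "((\<lambda>y. q t y) has_vector_derivative - P t y) (at y within {0..zt t})"
        by (rule has_vector_derivative_within_subset[OF q_z]) (use y in auto)
      moreover have "(exp_series (coef (M + 1) t) 0 has_vector_derivative - \<i> * exp_series (coef M t) 0 y) (at y within {0..zt t})"
        unfolding shift[symmetric] by (rule exp_series_deriv[OF norm_coef]) (use t in auto)
      ultimately have "(?f has_vector_derivative - P t y + \<i> * (- \<i> * exp_series (coef M t) 0 y)) (at y within {0..zt t})"
        by (intro has_vector_derivative_add has_vector_derivative_mult_right)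
      then show ?thesis by simp
    qed
    have "norm (?f (zt t) - ?f 0) \<le> K1 * zt t ^ (M + 1) * norm (zt t - 0)"
    proof (rule differentiable_bound[OF convex_real_interval(5)])
      show "(?f has_derivative (\<lambda>h. h *\<^sub>R - (P t y - exp_series (coef M t) 0 y))) (at y within {0..zt t})" if "y \<in> {0..zt t}" for y
        using d[OF that] by (simp add: has_vector_derivative_def)
      show "onorm (\<lambda>h::real. h *\<^sub>R - (P t y - exp_series (coef M t) 0 y)) \<le> K1 * zt t ^ (M + 1)" if "y \<in> {0..zt t}" for y
        by (rule onorm_le) (use K1(2)[OF t that] in \<open>simp add: mult.commute mult_left_mono norm_minus_commute\<close>)
    qed (use z in auto)
    moreover have "?f 0 = q0 t" by (simp add: q_boundary exp_series_at_0 coef_def)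
    ultimately have "norm (?f (zt t)) \<le> K1 * zt t ^ (M + 1) * zt t + K2 * zt t ^ (M + 2)"
      using norm_triangle_ineq[of "?f (zt t) - ?f 0" "?f 0"] K2(2)[OF t] z by simp
    also have "\<dots> = (K1 + K2) * zt t ^ (M + 2)" by (simp add: algebra_simps)
    finally show "norm (q t (zt t) - (- \<i>) * exp_series (coef (M + 1) t) 0 (zt t)) \<le> (K1 + K2) * zt t ^ (M + 2)"
      by simp
  qed (use K1 K2 in auto)
qed

end

text \<open>The powers of t and of 2 in the prefactor cancel those in the leading power of the
  Bessel function; \<open>z ^ n\<close> and one factor 2 are left.\<close>

lemma powr_sqrt_power_identity:
  fixes t z :: real
  assumes "t > 0" "z > 0"
  shows "2 powr (1 - 1/2 * real n) * (z / t) powr (1/2 * real n) * sqrt (2 * t * z) ^ n = 2 * z ^ n"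
proof -
  have "sqrt (2 * t * z) ^ n = (2 * t * z) powr (1/2 * real n)"
    using assms by (simp add: powr_half_sqrt[symmetric] powr_realpow[symmetric] powr_powr)
  moreover have "2 powr (1 - 1/2 * real n) = 2 / 2 powr (1/2 * real n)" by (simp add: powr_diff)
  moreover have "(2 * t * z) powr (1/2 * real n) = 2 powr (1/2 * real n) * t powr (1/2 * real n) * z powr (1/2 * real n)"
    using assms by (simp add: powr_mult)
  moreover have "z powr (1/2 * real n) * z powr (1/2 * real n) = z ^ n"
    using assms by (simp add: powr_add[symmetric] powr_realpow)
  ultimately show ?thesis using assms by (simp add: powr_divide field_simps)
qed

text \<open>Converts powers of z into the stated powers of t: \<open>\<alpha> \<le> - 1\<close>
  gives \<open>\<alpha> * s \<le> - (1/2) * s * (1 - \<alpha>)\<close>, and t is at least 1.\<close>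

lemma bigo_of_power_bound:
  fixes f :: "real \<Rightarrow> complex"
  assumes f: "\<And>t. t \<ge> 1 \<Longrightarrow> norm (f t) \<le> K * (C * t powr \<alpha>) ^ s" and K: "K \<ge> 0" and C: "C > 0" and \<alpha>: "\<alpha> \<le> - 1"
  shows "f \<in> O[at_top](\<lambda>t. complex_of_real (t powr (- (1/2) * real s * (1 - \<alpha>)) + t powr b))"
proof (rule bigoI[of _ "K * C ^ s"], rule eventually_mono[OF eventually_ge_at_top[of 1]])
  fix t :: real assume t: "t \<ge> 1"
  have "\<alpha> \<le> - (1/2) * (1 - \<alpha>)" using \<alpha> by (simp add: field_simps)
  from mult_right_mono[OF this, of "real s"] have "\<alpha> * real s \<le> - (1/2) * real s * (1 - \<alpha>)"
    by (simp add: algebra_simps)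
  then have "t powr (\<alpha> * real s) \<le> t powr (- (1/2) * real s * (1 - \<alpha>))"
    using t by (intro powr_mono) auto
  then have le: "t powr (\<alpha> * real s) \<le> t powr (- (1/2) * real s * (1 - \<alpha>)) + t powr b"
    by (rule add_increasing2[rotated]) simp
  have "norm (f t) \<le> K * (C * t powr \<alpha>) ^ s" by (rule f[OF t])
  also have "\<dots> = K * C ^ s * t powr (\<alpha> * real s)"
    using t by (simp add: power_mult_distrib powr_power mult.commute)
  also have "\<dots> \<le> K * C ^ s * (t powr (- (1/2) * real s * (1 - \<alpha>)) + t powr b)"
    by (rule mult_left_mono[OF le]) (use K C in auto)
  also have "t powr (- (1/2) * real s * (1 - \<alpha>)) + t powr b =
      norm (complex_of_real (t powr (- (1/2) * real s * (1 - \<alpha>)) + t powr b))"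
    by (simp only: norm_of_real) simp
  finally show "norm (f t) \<le> K * C ^ s * norm (complex_of_real (t powr (- (1/2) * real s * (1 - \<alpha>)) + t powr b))" .
qed

section \<open>Matching the exponential series with the Bessel terms\<close>

context scaled_pulse
begin

lemma kap_eq: "kap = - 2 * (cnj (moment r M) * exp (- \<i> * complex_of_real (aleph_phase r)) / fact M)"
proof -
  have "r 0 = 0" using low[of 0] M by (simp add: vderiv_iter_def)
  from exp_aleph[OF this] show ?thesis by (simp add: kap_def moment_def)
qed

text \<open>The sign and the power of \<open>\<i>\<close> from the Bessel function at an imaginary
  argument combine to \<open>(- \<i>) ^ (M + 1)\<close>, the phase of the exponential series; the
  factor - 2 is that in \<open>kap\<close>.\<close>

lemma q_leading_term:
  assumes t: "t \<ge> 1"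
  shows "\<i> * (-1) ^ (M + 1) * (cnj (moment r M) * exp (- \<i> * complex_of_real (aleph_phase r)) / fact M)
      * complex_of_real (2 powr (1/2 * (1 - real M)) * (zt t / t) powr (1/2 * (real M + 1)))
      * bessel_J (M + 1) (2 * \<i> * complex_of_real (sqrt (2 * t * zt t)))
    = (- \<i>) * exp_series (coef (M + 1) t) 0 (zt t)"
proof -
  define \<kappa> where "\<kappa> = cnj (moment r M) * exp (- \<i> * complex_of_real (aleph_phase r)) / fact M"
  define b where "b = 2 powr (1/2 * (1 - real M)) * (zt t / t) powr (1/2 * (real M + 1))"
  have z: "zt t > 0" "t > 0" using zt_pos[OF t] t by auto
  have "b * sqrt (2 * t * zt t) ^ (M + 1) = 2 * zt t ^ (M + 1)"
  proof -
    have e: "1 - 1/2 * real (M + 1) = 1/2 * (1 - real M)" "1/2 * real (M + 1) = 1/2 * (real M + 1)"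
      by (simp_all add: field_simps)
    show ?thesis unfolding b_def using powr_sqrt_power_identity[OF z(2,1), of "M + 1"] unfolding e(1) unfolding e(2) .
  qed
  then have b: "complex_of_real b * of_real (sqrt (2 * t * zt t)) ^ (M + 1) = 2 * of_real (zt t) ^ (M + 1)"
    by (metis of_real_mult of_real_numeral of_real_power)
  have "\<i> * (-1) ^ (M + 1) * \<kappa> * of_real b * ((\<i> * of_real (sqrt (2 * t * zt t))) ^ (M + 1) * of_real (bessel_sum (M + 1) (2 * t * zt t))) =
      \<i> * (-1) ^ (M + 1) * \<kappa> * \<i> ^ (M + 1) * (of_real b * of_real (sqrt (2 * t * zt t)) ^ (M + 1)) * of_real (bessel_sum (M + 1) (2 * t * zt t))"
    by (simp only: power_mult_distrib mult_ac)
  also have "\<dots> = (- \<i>) * ((- 2 * \<kappa>) * ((-1) ^ (M + 1) * \<i> ^ (M + 1) * of_real (zt t) ^ (M + 1)) * of_real (bessel_sum (M + 1) (2 * t * zt t)))"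
    unfolding b by simp
  also have "(-1) ^ (M + 1) * \<i> ^ (M + 1) * complex_of_real (zt t) ^ (M + 1) = (- \<i> * of_real (zt t)) ^ (M + 1)"
    by (simp only: power_mult_distrib[symmetric]) simp
  finally show ?thesis
    using z t bessel_J_imaginary[of "2 * t * zt t" "M + 1"] exp_series_coef[of t "M + 1" "zt t"]
    unfolding kap_eq b_def[symmetric] \<kappa>_def[symmetric] by (simp only:) simp
qed

lemma P_leading_term:
  assumes t: "t \<ge> 1"
  shows "(-1) ^ (M + 1) * (cnj (moment r M) * exp (- \<i> * complex_of_real (aleph_phase r)) / fact M)
      * complex_of_real (2 powr (1 - 1/2 * real M) * (zt t / t) powr (1/2 * real M))
      * bessel_J M (2 * \<i> * complex_of_real (sqrt (2 * t * zt t)))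
    = exp_series (coef M t) 0 (zt t)"
proof -
  define \<kappa> where "\<kappa> = cnj (moment r M) * exp (- \<i> * complex_of_real (aleph_phase r)) / fact M"
  define b where "b = 2 powr (1 - 1/2 * real M) * (zt t / t) powr (1/2 * real M)"
  have z: "zt t > 0" "t > 0" using zt_pos[OF t] t by auto
  have "b * sqrt (2 * t * zt t) ^ M = 2 * zt t ^ M"
    unfolding b_def by (rule powr_sqrt_power_identity[OF z(2,1)])
  then have b: "complex_of_real b * of_real (sqrt (2 * t * zt t)) ^ M = 2 * of_real (zt t) ^ M"
    by (metis of_real_mult of_real_numeral of_real_power)
  have "(-1) ^ (M + 1) * \<kappa> * of_real b * ((\<i> * of_real (sqrt (2 * t * zt t))) ^ M * of_real (bessel_sum M (2 * t * zt t))) =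
      (-1) ^ (M + 1) * \<kappa> * \<i> ^ M * (of_real b * of_real (sqrt (2 * t * zt t)) ^ M) * of_real (bessel_sum M (2 * t * zt t))"
    by (simp only: power_mult_distrib mult_ac)
  also have "\<dots> = (- 2 * \<kappa>) * ((-1) ^ M * \<i> ^ M * of_real (zt t) ^ M) * of_real (bessel_sum M (2 * t * zt t))"
    unfolding b by simp
  also have "(-1) ^ M * \<i> ^ M * complex_of_real (zt t) ^ M = (- \<i> * of_real (zt t)) ^ M"
    by (simp only: power_mult_distrib[symmetric]) simp
  finally show ?thesis
    using z t bessel_J_imaginary[of "2 * t * zt t" M] exp_series_coef[of t M "zt t"]
    unfolding kap_eq b_def[symmetric] \<kappa>_def[symmetric] by (simp only:) simp
qed

text \<open>Bounded \<open>t * z\<close> keeps the Bessel power series bounded, and the prefactors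
  combine to \<open>2 * zt t ^ (2 * M)\<close>. Hence the Bessel term in D is itself of order
  \<open>zt t ^ (M + 1)\<close>, and the expansion of D follows from the bound on D - 1.\<close>

lemma D_leading_term_bound:
  obtains K where "K \<ge> 0" "\<And>t. t \<ge> 1 \<Longrightarrow>
    norm ((-1) ^ (M + 1) * complex_of_real ((cmod (moment r M) / fact M)\<^sup>2)
      * complex_of_real (2 powr (1 - real M) * (zt t / t) ^ M)
      * (bessel_J M (2 * \<i> * complex_of_real (sqrt (2 * t * zt t))))\<^sup>2) \<le> K * zt t ^ (M + 1)"
proof (rule that[of "(cmod (moment r M) / fact M)\<^sup>2 * 2 * (exp (2 * C))\<^sup>2 * C ^ (M - 1)"])
  show "0 \<le> (cmod (moment r M) / fact M)\<^sup>2 * 2 * (exp (2 * C))\<^sup>2 * C ^ (M - 1)" using C by simp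
  fix t :: real assume t: "t \<ge> 1"
  define \<kappa> where "\<kappa> = (cmod (moment r M) / fact M)\<^sup>2"
  define b where "b = bessel_sum M (2 * t * zt t)"
  have \<kappa>: "\<kappa> \<ge> 0" by (simp add: \<kappa>_def)
  have z: "zt t > 0" "t > 0" using zt_pos[OF t] t by auto
  have b: "\<bar>b\<bar>\<^sup>2 \<le> (exp (2 * C))\<^sup>2"
  proof (rule power_mono)
    have "\<bar>b\<bar> \<le> exp \<bar>2 * t * zt t\<bar>" unfolding b_def by (rule bessel_sum_le)
    also have "\<dots> \<le> exp (2 * C)" using zt_mult_le[OF t] z by simp
    finally show "\<bar>b\<bar> \<le> exp (2 * C)" .
  qed simp
  have nb: "norm (bessel_J M (2 * \<i> * complex_of_real (sqrt (2 * t * zt t)))) = sqrt (2 * t * zt t) ^ M * \<bar>b\<bar>"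
    using z by (simp add: bessel_J_imaginary[of "2 * t * zt t"] b_def norm_mult norm_power)
  have p: "2 powr (1 - real M) * (zt t / t) ^ M * (sqrt (2 * t * zt t) ^ M)\<^sup>2 = 2 * (zt t ^ M)\<^sup>2"
  proof -
    have "(sqrt (2 * t * zt t) ^ M)\<^sup>2 = (2 * t * zt t) ^ M"
      using z by (simp add: power_mult[symmetric] mult.commute[of M]) (simp add: power_mult)
    moreover have "2 powr (1 - real M) = 2 / 2 ^ M" by (simp add: powr_diff powr_realpow)
    ultimately show ?thesis
      using z by (simp add: power_mult_distrib power_divide power2_eq_square)
  qed
  have "norm ((-1) ^ (M + 1) * complex_of_real \<kappa> * complex_of_real (2 powr (1 - real M) * (zt t / t) ^ M)
      * (bessel_J M (2 * \<i> * complex_of_real (sqrt (2 * t * zt t))))\<^sup>2) =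
      \<kappa> * (2 powr (1 - real M) * (zt t / t) ^ M) * (sqrt (2 * t * zt t) ^ M * \<bar>b\<bar>)\<^sup>2"
    unfolding norm_mult norm_power nb norm_of_real using z \<kappa> by simp
  also have "\<dots> = \<kappa> * (2 powr (1 - real M) * (zt t / t) ^ M * (sqrt (2 * t * zt t) ^ M)\<^sup>2) * \<bar>b\<bar>\<^sup>2"
    by (simp only: power_mult_distrib mult_ac)
  also have "\<dots> = \<kappa> * 2 * \<bar>b\<bar>\<^sup>2 * (zt t ^ M)\<^sup>2" unfolding p by (simp only: mult_ac)
  also have "\<dots> \<le> \<kappa> * 2 * (exp (2 * C))\<^sup>2 * (C ^ (M - 1) * zt t ^ (M + 1))"
    by (intro mult_mono b zt_power_double_le t mult_nonneg_nonneg \<kappa>) (use \<kappa> in auto)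
  also have "\<dots> = \<kappa> * 2 * (exp (2 * C))\<^sup>2 * C ^ (M - 1) * zt t ^ (M + 1)" by (simp only: mult_ac)
  finally show "norm ((-1) ^ (M + 1) * complex_of_real \<kappa> * complex_of_real (2 powr (1 - real M) * (zt t / t) ^ M)
      * (bessel_J M (2 * \<i> * complex_of_real (sqrt (2 * t * zt t))))\<^sup>2) \<le> \<kappa> * 2 * (exp (2 * C))\<^sup>2 * C ^ (M - 1) * zt t ^ (M + 1)" .
qed

end

theorem theorem5:
  fixes q0 r :: "real \<Rightarrow> complex"
    and q P :: "real \<Rightarrow> real \<Rightarrow> complex" and D :: "real \<Rightarrow> real \<Rightarrow> real"
    and M N :: nat and C \<alpha> :: real
  assumes "schwartz q0"
    and "\<forall>t<0. q0 t = 0"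
    and "discrete_eigenvalues q0 = {}"
    and "spectral_singularities q0 = {}"
    and "r = reflection_coeff q0" and "r 0 = 0"
    and "M \<ge> 1" and "first_nonzero_moment r M"
    and "C > 0" and "\<alpha> \<le> - 1"
    and "N \<ge> M + 2"
    and "maxwell_bloch_solution q0 1 q P D" and "causal q"
  shows
    "(\<lambda>t. let z = C * t powr \<alpha> in
        q t z
        - \<i> * (-1) ^ (M + 1) * (cnj (moment r M) * exp (- \<i> * complex_of_real (aleph_phase r)) / fact M)
          * complex_of_real (2 powr (1/2 * (1 - real M)) * (z / t) powr (1/2 * (real M + 1)))
          * bessel_J (M + 1) (2 * \<i> * complex_of_real (sqrt (2 * t * z))))
      \<in> O[at_top](\<lambda>t. complex_of_real
           (t powr (- (1/2) * (real M + 2) * (1 - \<alpha>)) + t powr (1 - real N))) \<and>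
    (\<lambda>t. let z = C * t powr \<alpha> in
        P t z
        - (-1) ^ (M + 1) * (cnj (moment r M) * exp (- \<i> * complex_of_real (aleph_phase r)) / fact M)
          * complex_of_real (2 powr (1 - 1/2 * real M) * (z / t) powr (1/2 * real M))
          * bessel_J M (2 * \<i> * complex_of_real (sqrt (2 * t * z))))
      \<in> O[at_top](\<lambda>t. complex_of_real
           (t powr (- (1/2) * (real M + 1) * (1 - \<alpha>)) + t powr (3/2 - real N))) \<and>
    (\<lambda>t. let z = C * t powr \<alpha> in
        complex_of_real (D t z)
        - (1 + (-1) ^ (M + 1) * complex_of_real ((cmod (moment r M) / fact M)\<^sup>2)
          * complex_of_real (2 powr (1 - real M) * (z / t) ^ M)
          * (bessel_J M (2 * \<i> * complex_of_real (sqrt (2 * t * z))))\<^sup>2))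
      \<in> O[at_top](\<lambda>t. complex_of_real
           (t powr (- (1/2) * (real M + 1) * (1 - \<alpha>)) + t powr (3/2 - real N)))"
proof -
  have r: "r = reflection_coeff q0" by fact
  interpret mb: causal_mb q0 q P D by unfold_locales fact+
  have "0 \<le> C" using \<open>C > 0\<close> by simp
  \<comment> \<open>The range \<open>{0..C}\<close> suffices, because
    \<open>C * t powr \<alpha> \<le> C\<close> for \<open>t \<ge> 1\<close>.\<close>
  then obtain R where R: "mb_hierarchy q0 q P D C R" by (rule mb.mb_hierarchy_exists) (rule that)
  interpret h: mb_hierarchy q0 q P D C R by (rule R)
  have C0: "0 \<in> {0..C}" using \<open>C > 0\<close> by simp
  \<comment> \<open>The boundary condition \<open>q t 0 = q0 t\<close> turns the equations for
    \<open>R\<close> at \<open>z = 0\<close> into those of the hierarchy of the incident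
    pulse.\<close>
  interpret s: scaled_pulse q0 q P D C R M \<alpha>
  proof unfold_locales
    show "q0 t = 0" if "t < 0" for t using \<open>\<forall>t<0. q0 t = 0\<close> that by blast
    show "R j 0 0 = (if j = 0 then (0, 1) else 0)" for j
      using h.R_init[OF C0] mb.rho_0[of 0] by (cases j) (auto simp: h.R_0)
    show "((\<lambda>t. R j t 0) has_vector_derivative
        rot (q0 t) (R j t 0) + (case j of 0 \<Rightarrow> 0 | Suc i \<Rightarrow> shift (R i t 0))) (at t within {0..})" if "t \<ge> 0" for j t
      using h.R_deriv[OF that C0, of j] by (simp add: mb.q_boundary)
    show "norm (R j t 0) \<le> (2 * t) ^ j" if "t \<ge> 0" for j t by (rule h.norm_R[OF that C0])
    show "vderiv_iter m (reflection_coeff q0) 0 = 0" if "m < M" for m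
      using \<open>first_nonzero_moment r M\<close> that by (simp add: first_nonzero_moment_def moment_def r)
  qed fact+
  obtain K1 where K1: "K1 \<ge> 0" "\<And>t y. t \<ge> 1 \<Longrightarrow> y \<in> {0..s.zt t} \<Longrightarrow> norm (P t y - exp_series (s.coef M t) 0 y) \<le> K1 * s.zt t ^ (M + 1)"
    "\<And>t. t \<ge> 1 \<Longrightarrow> \<bar>D t (s.zt t) - 1\<bar> \<le> K1 * s.zt t ^ (M + 1)"
    by (rule s.P_D_asymptotics) (rule that)
  obtain K2 where K2: "K2 \<ge> 0" "\<And>t. t \<ge> 1 \<Longrightarrow> norm (q t (s.zt t) - (- \<i>) * exp_series (s.coef (M + 1) t) 0 (s.zt t)) \<le> K2 * s.zt t ^ (M + 2)"
    by (rule s.q_asymptotics) (rule that)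
  obtain K3 where K3: "K3 \<ge> 0" "\<And>t. t \<ge> 1 \<Longrightarrow>
    norm ((-1) ^ (M + 1) * complex_of_real ((cmod (moment r M) / fact M)\<^sup>2)
      * complex_of_real (2 powr (1 - real M) * (s.zt t / t) ^ M)
      * (bessel_J M (2 * \<i> * complex_of_real (sqrt (2 * t * s.zt t))))\<^sup>2) \<le> K3 * s.zt t ^ (M + 1)"
    by (rule s.D_leading_term_bound[folded r]) (rule that)
  note big = bigo_of_power_bound[OF _ _ \<open>C > 0\<close> \<open>\<alpha> \<le> - 1\<close>]
  have M2: "real M + 2 = real (M + 2)" and M1: "real M + 1 = real (M + 1)" by auto
  show ?thesis
    unfolding Let_def s.zt_def[symmetric]
  proof (intro conjI)
    show "(\<lambda>t. q t (s.zt t)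
        - \<i> * (-1) ^ (M + 1) * (cnj (moment r M) * exp (- \<i> * complex_of_real (aleph_phase r)) / fact M)
          * complex_of_real (2 powr (1/2 * (1 - real M)) * (s.zt t / t) powr (1/2 * (real M + 1)))
          * bessel_J (M + 1) (2 * \<i> * complex_of_real (sqrt (2 * t * s.zt t))))
      \<in> O[at_top](\<lambda>t. complex_of_real
           (t powr (- (1/2) * (real M + 2) * (1 - \<alpha>)) + t powr (1 - real N)))"
      unfolding M2 by (rule big[OF _ K2(1)]) (use K2(2) s.q_leading_term in \<open>simp only: r s.zt_def\<close>)
    show "(\<lambda>t. P t (s.zt t)
        - (-1) ^ (M + 1) * (cnj (moment r M) * exp (- \<i> * complex_of_real (aleph_phase r)) / fact M)
          * complex_of_real (2 powr (1 - 1/2 * real M) * (s.zt t / t) powr (1/2 * real M))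
          * bessel_J M (2 * \<i> * complex_of_real (sqrt (2 * t * s.zt t))))
      \<in> O[at_top](\<lambda>t. complex_of_real
           (t powr (- (1/2) * (real M + 1) * (1 - \<alpha>)) + t powr (3/2 - real N)))"
      unfolding M1
    proof (rule big[OF _ K1(1)])
      fix t :: real assume t: "t \<ge> 1"
      have "s.zt t \<in> {0..s.zt t}" using s.zt_pos[OF t] by simp
      from K1(2)[OF t this]
      show "norm (P t (s.zt t)
        - (-1) ^ (M + 1) * (cnj (moment r M) * exp (- \<i> * complex_of_real (aleph_phase r)) / fact M)
          * complex_of_real (2 powr (1 - 1/2 * real M) * (s.zt t / t) powr (1/2 * real M))
          * bessel_J M (2 * \<i> * complex_of_real (sqrt (2 * t * s.zt t)))) \<le> K1 * (C * t powr \<alpha>) ^ (M + 1)"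
        unfolding r unfolding s.P_leading_term[OF t] unfolding s.zt_def .
    qed
    show "(\<lambda>t. complex_of_real (D t (s.zt t))
        - (1 + (-1) ^ (M + 1) * complex_of_real ((cmod (moment r M) / fact M)\<^sup>2)
          * complex_of_real (2 powr (1 - real M) * (s.zt t / t) ^ M)
          * (bessel_J M (2 * \<i> * complex_of_real (sqrt (2 * t * s.zt t))))\<^sup>2))
      \<in> O[at_top](\<lambda>t. complex_of_real
           (t powr (- (1/2) * (real M + 1) * (1 - \<alpha>)) + t powr (3/2 - real N)))"
      unfolding M1
    proof (rule big)
      show "0 \<le> K1 + K3" using K1 K3 by simp
      fix t :: real assume t: "t \<ge> 1"
      let ?L = "(-1) ^ (M + 1) * complex_of_real ((cmod (moment r M) / fact M)\<^sup>2)
          * complex_of_real (2 powr (1 - real M) * (s.zt t / t) ^ M)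
          * (bessel_J M (2 * \<i> * complex_of_real (sqrt (2 * t * s.zt t))))\<^sup>2"
      have "norm (complex_of_real (D t (s.zt t)) - (1 + ?L)) \<le> norm (complex_of_real (D t (s.zt t)) - 1) + norm ?L"
        unfolding diff_diff_eq[symmetric] by (rule norm_triangle_ineq4)
      also have "norm (complex_of_real (D t (s.zt t)) - 1) = \<bar>D t (s.zt t) - 1\<bar>"
        using norm_of_real[of "D t (s.zt t) - 1", where 'a = complex] by simp
      also have "\<bar>D t (s.zt t) - 1\<bar> + norm ?L \<le> K1 * s.zt t ^ (M + 1) + K3 * s.zt t ^ (M + 1)"
        by (rule add_mono[OF K1(3)[OF t] K3(2)[OF t]])
      finally show "norm (complex_of_real (D t (s.zt t)) - (1 + ?L)) \<le> (K1 + K3) * (C * t powr \<alpha>) ^ (M + 1)"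
        by (simp only: s.zt_def distrib_right)
    qed
  qed
qed

end
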